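(* Let $k$ be a finitely generated field of characteristic zero, let $A$ be a torsion-free abelian minimax group, and let $P$ be a faithful prime ideal of $kA$. Let $R=kA/P$ and let $h$ be the field of fractions of $R$, so that $A\le h^*$ via the natural map. Let $C$ be a finitely generated dense subgroup of $A$, and let $\tau$ be the set of all roots of $1$ of degree $p^n$ for all $p\in\pi(A/C)$ and all positive integers $n$, together with a primitive $4$-th root of $1$. Let $f$ be the field obtained by adjoining to $h$ all elements of $\tau$ (inside an algebraic closure of $h$), let $s$ be the subfield of $f$ generated over $k$ by $\tau$ and $C$, and let $B=A\cap s^*$. Let $D$ be a dense subgroup of $C$, let $d$ be the subfield of $f$ generated over $k$ by $D$ and $t(s^* )$, and let $H=A\cap d^*$. Then: (i) $B$ and $H$ are finitely generated dense subgroups of $A$ and $H\le B$; (ii) both $B$ and $H$ control the ideal $P$.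
   Context: An ideal $I$ of $kA$ is faithful if $A\cap(1+I)=\{1\}$; a subgroup $H\le A$ controls $I$ if $I=(I\cap kH)kA$. A subgroup $B$ of an abelian group $A$ is dense if for every $a\in A$ some positive power $a^n$ lies in $B$ (i.e. $A/B$ is torsion). An abelian group is minimax if it has a finite series each of whose factors is cyclic or quasicyclic. $\pi(X)$ is the set of primes dividing orders of elements of a torsion group $X$; $t(s^* )$ is the group of roots of unity in $s$. *)

theory Defs
  imports "HOL-Library.Poly_Mapping" "HOL-Computational_Algebra.Polynomial"
    "HOL-Computational_Algebra.Primes"
begin

text \<open>Abelian groups are written additively (type class ab_group_add); the whole
  group A is the type 'a. The group ring kA is the monoid ring ('a =>0 'k) of
  finitely supported functions with convolution product (HOL-Library.Poly_Mapping).
  The group element a corresponds to Poly_Mapping.single a 1.\<close>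

fun nmul :: "nat \<Rightarrow> 'a::monoid_add \<Rightarrow> 'a" where
  "nmul 0 x = 0"
| "nmul (Suc n) x = x + nmul n x"

definition zmul :: "int \<Rightarrow> 'a::ab_group_add \<Rightarrow> 'a" where
  "zmul m x = (if 0 \<le> m then nmul (nat m) x else - nmul (nat (- m)) x)"

definition is_subgroup :: "'a::ab_group_add set \<Rightarrow> bool" where
  "is_subgroup G \<longleftrightarrow> 0 \<in> G \<and> (\<forall>x\<in>G. \<forall>y\<in>G. x + y \<in> G) \<and> (\<forall>x\<in>G. - x \<in> G)"

definition subgroup_gen :: "'a::ab_group_add set \<Rightarrow> 'a set" where
  "subgroup_gen S = \<Inter>{G. is_subgroup G \<and> S \<subseteq> G}"

definition fin_gen_subgroup :: "'a::ab_group_add set \<Rightarrow> bool" where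
  "fin_gen_subgroup G \<longleftrightarrow> (\<exists>S. finite S \<and> G = subgroup_gen S)"

definition dense_in :: "'a::ab_group_add set \<Rightarrow> 'a set \<Rightarrow> bool" where
  "dense_in B G \<longleftrightarrow> is_subgroup B \<and> B \<subseteq> G \<and> (\<forall>a\<in>G. \<exists>n>0. nmul n a \<in> B)"

definition torsion_free :: "'a::ab_group_add itself \<Rightarrow> bool" where
  "torsion_free _ \<longleftrightarrow> (\<forall>(a::'a) n. n > 0 \<and> nmul n a = 0 \<longrightarrow> a = 0)"

definition cyclic_factor :: "'a::ab_group_add set \<Rightarrow> 'a set \<Rightarrow> bool" where
  "cyclic_factor L U \<longleftrightarrow> (\<exists>g\<in>U. \<forall>x\<in>U. \<exists>m. x - zmul m g \<in> L)"

text \<open>U/L is quasicyclic (a Pruefer p-group): generated by cosets g_0, g_1, ...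
  with g_0 nontrivial, p g_0 = 0 and p g_(n+1) = g_n (modulo L).\<close>
definition quasicyclic_factor :: "'a::ab_group_add set \<Rightarrow> 'a set \<Rightarrow> bool" where
  "quasicyclic_factor L U \<longleftrightarrow> (\<exists>p g. prime (p::nat) \<and> (\<forall>n. g n \<in> U) \<and> g 0 \<notin> L
     \<and> nmul p (g 0) \<in> L \<and> (\<forall>n. nmul p (g (Suc n)) - g n \<in> L)
     \<and> (\<forall>x\<in>U. \<exists>n m. x - zmul m (g n) \<in> L))"

definition minimax :: "'a::ab_group_add itself \<Rightarrow> bool" where
  "minimax _ \<longleftrightarrow> (\<exists>n (G :: nat \<Rightarrow> 'a set). G 0 = {0} \<and> G n = UNIV
     \<and> (\<forall>i\<le>n. is_subgroup (G i))
     \<and> (\<forall>i<n. G i \<subseteq> G (Suc i)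
           \<and> (cyclic_factor (G i) (G (Suc i)) \<or> quasicyclic_factor (G i) (G (Suc i)))))"

definition coset_order :: "'a::ab_group_add set \<Rightarrow> 'a \<Rightarrow> nat" where
  "coset_order C a = (LEAST n. n > 0 \<and> nmul n a \<in> C)"

definition pi_quot :: "'a::ab_group_add set \<Rightarrow> nat set" where
  "pi_quot C = {p. prime p \<and> (\<exists>a. (\<exists>n>0. nmul n a \<in> C) \<and> p dvd coset_order C a)}"

definition is_subfield :: "'c::field set \<Rightarrow> bool" where
  "is_subfield F \<longleftrightarrow> 0 \<in> F \<and> 1 \<in> F \<and> (\<forall>x\<in>F. \<forall>y\<in>F. x + y \<in> F \<and> x * y \<in> F)
     \<and> (\<forall>x\<in>F. - x \<in> F \<and> inverse x \<in> F)"

definition subfield_gen :: "'c::field set \<Rightarrow> 'c set" where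
  "subfield_gen S = \<Inter>{F. is_subfield F \<and> S \<subseteq> F}"

definition fin_gen_field :: "'k::field itself \<Rightarrow> bool" where
  "fin_gen_field _ \<longleftrightarrow> (\<exists>S::'k set. finite S \<and> subfield_gen S = UNIV)"

definition alg_closed :: "'c::field itself \<Rightarrow> bool" where
  "alg_closed _ \<longleftrightarrow> (\<forall>q::'c poly. degree q > 0 \<longrightarrow> (\<exists>x. poly q x = 0))"

definition roots_of_unity_in :: "'c::field set \<Rightarrow> 'c set" where
  "roots_of_unity_in F = {x\<in>F. \<exists>n>0. x ^ n = 1}"

definition is_ideal :: "'r::comm_ring_1 set \<Rightarrow> bool" where
  "is_ideal I \<longleftrightarrow> 0 \<in> I \<and> (\<forall>x\<in>I. \<forall>y\<in>I. x + y \<in> I) \<and> (\<forall>x\<in>I. \<forall>r. r * x \<in> I)"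

definition is_prime_ideal :: "'r::comm_ring_1 set \<Rightarrow> bool" where
  "is_prime_ideal I \<longleftrightarrow> is_ideal I \<and> 1 \<notin> I \<and> (\<forall>x y. x * y \<in> I \<longrightarrow> x \<in> I \<or> y \<in> I)"

definition ideal_span :: "'r::comm_ring_1 set \<Rightarrow> 'r set" where
  "ideal_span S = {\<Sum>i<n. f i * g i | (n::nat) f g. \<forall>i<n. f i \<in> S}"

definition group_subring :: "'a::ab_group_add set \<Rightarrow> ('a \<Rightarrow>\<^sub>0 'k::field) set" where
  "group_subring H = {x. Poly_Mapping.keys x \<subseteq> H}"

definition faithful :: "('a::ab_group_add \<Rightarrow>\<^sub>0 'k::field) set \<Rightarrow> bool" where
  "faithful I \<longleftrightarrow> (\<forall>a. Poly_Mapping.single a 1 - 1 \<in> I \<longrightarrow> a = 0)"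

definition controls :: "'a::ab_group_add set \<Rightarrow> ('a \<Rightarrow>\<^sub>0 'k::field) set \<Rightarrow> bool" where
  "controls H I \<longleftrightarrow> I = ideal_span (I \<inter> group_subring H)"

end

(*
  Control. Let K <= L be fields such that K contains a fourth root of unity and all roots of unity
  in L of the relevant prime orders. Then elements of L that are radical over K and pairwise not
  proportional over K are linearly independent over K (a version of Kneser's theorem). Applied to
  A over s, and to B over d with L = s, it shows that coset representatives of B in A, resp. of H
  in B, are independent over s, resp. d. An element of P is then a combination of coset
  representatives whose coefficients are themselves in P and in kB, resp. kH.

  Finite generation. By the same theorem over the finitely generated field K generated by k, C, i
  and the p-th roots of unity, p in pi(A/C), every element of B is a root of unity times an
  element of K: it is radical over K and lies in the K-span of roots of unity. So it suffices that
  an element u of K with u^m = c_1^e_1 ... c_r^e_r and all e_i small relative to m is a root of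
  unity; a pigeonhole argument then bounds the index of C in B. For number fields this is a
  Northcott argument: the powers u^j have characteristic polynomials in a fixed finite set. For
  a finite extension of K(t) with u transcendental over K, the powers of u are linearly
  independent over K, while those of bounded exponent fit into a space of too small dimension;
  hence u is algebraic over K, and one descends to the field of constants.
*)

theory Submission
  imports Defs "HOL-Number_Theory.Cong" "Jordan_Normal_Form.Char_Poly"
begin

section \<open>Subfields and finite extensions\<close>

text \<open>The field \<open>s\<close> may contain roots of unity of unbounded order, so it need not
  be finitely generated, and the discreteness of exponents cannot be applied to it. The field K
  keeps only the roots of prime order, which is all that independence of radicals asks for; they are
  finitely many because minimaxity makes pi(A/C) finite. Independence is stated relative to a larger
  field L: only the roots of unity that lie in L must lie in K. This is what makes control by H
  work. Orders modulo D may involve any primes, and \<open>d\<close> contains only the roots of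
  unity of \<open>s\<close>; so A is treated over \<open>s\<close> inside the whole field, B over
  \<open>d\<close> inside \<open>s\<close>, and the two results are combined as in a tower of bases.
  As L is not assumed normal over K, conjugation is replaced by minimal polynomials and dimension
  counts. The fourth root of unity guards against an exception at the prime 2: 1, i and 1+i are
  radicals over the rationals, pairwise not proportional, and yet dependent.\<close>

lemma sf_simps:
  assumes "is_subfield K"
  shows sf_0: "0 \<in> K" and sf_1: "1 \<in> K"
    and sf_add: "\<And>x y. x \<in> K \<Longrightarrow> y \<in> K \<Longrightarrow> x + y \<in> K"
    and sf_mult: "\<And>x y. x \<in> K \<Longrightarrow> y \<in> K \<Longrightarrow> x * y \<in> K"
    and sf_minus: "\<And>x. x \<in> K \<Longrightarrow> - x \<in> K"
    and sf_inverse: "\<And>x. x \<in> K \<Longrightarrow> inverse x \<in> K"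
  using assms unfolding is_subfield_def by auto

lemma sf_diff: "is_subfield K \<Longrightarrow> x \<in> K \<Longrightarrow> y \<in> K \<Longrightarrow> x - y \<in> K"
  using sf_add[of K x "- y"] sf_minus by fastforce

lemma sf_divide: "is_subfield K \<Longrightarrow> x \<in> K \<Longrightarrow> y \<in> K \<Longrightarrow> x / y \<in> K"
  by (simp add: divide_inverse sf_mult sf_inverse)

lemma sf_power: "is_subfield K \<Longrightarrow> x \<in> K \<Longrightarrow> x ^ n \<in> K"
  by (induction n) (auto simp: sf_1 sf_mult)

lemma sf_power_int: "is_subfield K \<Longrightarrow> x \<in> K \<Longrightarrow> x powi n \<in> K"
  unfolding power_int_def by (auto simp: sf_power sf_inverse)

lemma sf_sum: "is_subfield K \<Longrightarrow> (\<And>i. i \<in> I \<Longrightarrow> f i \<in> K) \<Longrightarrow> sum f I \<in> K"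
  by (induction I rule: infinite_finite_induct) (auto simp: sf_0 sf_add)

lemma sf_prod: "is_subfield K \<Longrightarrow> (\<And>i. i \<in> I \<Longrightarrow> f i \<in> K) \<Longrightarrow> prod f I \<in> K"
  by (induction I rule: infinite_finite_induct) (auto simp: sf_1 sf_mult)

lemma sf_of_nat: "is_subfield K \<Longrightarrow> of_nat n \<in> K"
  by (induction n) (auto simp: sf_0 sf_1 sf_add)

lemma sf_of_int: "is_subfield K \<Longrightarrow> of_int n \<in> K"
  by (cases n) (auto simp: sf_of_nat sf_minus sf_1 sf_diff)

lemma sf_mult_cancel:
  assumes "is_subfield K" "x \<in> K" "x \<noteq> 0" "x * y \<in> K"
  shows "y \<in> K"
proof -
  have "y = (x * y) / x" using assms by simp
  thus ?thesis using assms sf_divide by metis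
qed

lemma sf_UNIV: "is_subfield UNIV"
  unfolding is_subfield_def by auto

lemma sf_gen: "is_subfield (subfield_gen S)"
  unfolding subfield_gen_def is_subfield_def by auto

lemma sf_gen_superset: "S \<subseteq> subfield_gen S"
  unfolding subfield_gen_def by auto

lemma sf_gen_least: "is_subfield F \<Longrightarrow> S \<subseteq> F \<Longrightarrow> subfield_gen S \<subseteq> F"
  unfolding subfield_gen_def by auto

lemma sf_gen_mono: "S \<subseteq> T \<Longrightarrow> subfield_gen S \<subseteq> subfield_gen T"
  by (meson sf_gen sf_gen_least sf_gen_superset subset_trans)

lemma sf_pow_gcd:
  assumes K: "is_subfield K" and x: "x \<noteq> 0" "x ^ a \<in> K" "x ^ b \<in> K"
  shows "x ^ gcd a b \<in> K"
proof -
  obtain u v where uv: "u * int a + v * int b = gcd (int a) (int b)"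
    using bezout_int by blast
  have "x powi (gcd (int a) (int b)) = x powi (int a * u) * x powi (int b * v)"
    unfolding uv[symmetric] by (subst power_int_add) (use x in \<open>simp_all add: mult.commute\<close>)
  also have "\<dots> = (x ^ a) powi u * (x ^ b) powi v"
    by (simp only: power_int_mult power_int_of_nat)
  also have "\<dots> \<in> K"
    using K x by (auto intro!: sf_mult sf_power_int)
  finally show ?thesis by (simp add: gcd_int_int_eq)
qed

lemma sf_pow_coprime:
  "is_subfield K \<Longrightarrow> x \<noteq> 0 \<Longrightarrow> x ^ a \<in> K \<Longrightarrow> x ^ b \<in> K \<Longrightarrow> coprime a b \<Longrightarrow> x \<in> K"
  using sf_pow_gcd[of K x a b] by simp

subsection \<open>Polynomials with coefficients in a subfield\<close>

text \<open>All fields are subsets of one ambient type, so the ring K[X] is a predicate on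
  polynomials over that type, and a change of base field changes no type.\<close>

definition polyover :: "'c::field set \<Rightarrow> 'c poly \<Rightarrow> bool" where
  "polyover K f \<longleftrightarrow> (\<forall>i. coeff f i \<in> K)"

lemma po_coeff: "polyover K f \<Longrightarrow> coeff f i \<in> K"
  unfolding polyover_def by auto

lemma po_mono: "polyover K f \<Longrightarrow> K \<subseteq> L \<Longrightarrow> polyover L f"
  unfolding polyover_def by auto

context
  fixes K :: "'c::field set"
  assumes K: "is_subfield K"
begin

lemma po_0: "polyover K 0"
  and po_add: "\<And>f g. polyover K f \<Longrightarrow> polyover K g \<Longrightarrow> polyover K (f + g)"
  and po_diff: "\<And>f g. polyover K f \<Longrightarrow> polyover K g \<Longrightarrow> polyover K (f - g)"
  and po_smult: "\<And>f c. c \<in> K \<Longrightarrow> polyover K f \<Longrightarrow> polyover K (Polynomial.smult c f)"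
  and po_monom: "\<And>c n. c \<in> K \<Longrightarrow> polyover K (monom c n)"
  and po_mult: "\<And>f g. polyover K f \<Longrightarrow> polyover K g \<Longrightarrow> polyover K (f * g)"
  using K unfolding polyover_def
  by (auto simp: sf_0 sf_add sf_diff sf_mult coeff_mult intro!: sf_sum)

lemma po_pCons: "polyover K (pCons a f) \<longleftrightarrow> a \<in> K \<and> polyover K f"
  unfolding polyover_def by (auto simp: coeff_pCons split: nat.splits)

lemma po_const: "c \<in> K \<Longrightarrow> polyover K [:c:]"
  and po_1: "polyover K 1"
  and po_X: "polyover K [:0, 1:]"
  using K by (auto simp: po_pCons po_0 sf_0 sf_1 one_pCons)

lemma po_power: "polyover K f \<Longrightarrow> polyover K (f ^ n)"
  by (induction n) (auto simp: po_1 po_mult)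

lemma po_sum: "(\<And>i. i \<in> I \<Longrightarrow> polyover K (f i)) \<Longrightarrow> polyover K (sum f I)"
  by (induction I rule: infinite_finite_induct) (auto simp: po_0 po_add)

lemma po_pcompose: "polyover K f \<Longrightarrow> polyover K g \<Longrightarrow> polyover K (pcompose f g)"
  by (induction f) (auto simp: pcompose_pCons po_0 po_pCons po_const po_add po_mult)

lemma po_poly: "polyover K f \<Longrightarrow> x \<in> K \<Longrightarrow> poly f x \<in> K"
  by (induction f) (use K in \<open>auto simp: po_pCons sf_0 sf_add sf_mult\<close>)

text \<open>The usual cancellation of leading terms, carried out so as to see that quotient and
  remainder keep their coefficients in K.\<close>

lemma po_divmod:
  assumes g: "polyover K g" "g \<noteq> 0" and f: "polyover K f"
  obtains q r where "polyover K q" "polyover K r" "f = q * g + r" "r = 0 \<or> degree r < degree g"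
proof -
  have "\<exists>q r. polyover K q \<and> polyover K r \<and> f = q * g + r \<and> (r = 0 \<or> degree r < degree g)"
    using f
  proof (induction "degree f" arbitrary: f rule: less_induct)
    case less
    show ?case
    proof (cases "degree f < degree g \<or> f = 0")
      case True
      thus ?thesis using less.prems po_0 by (intro exI[of _ 0] exI[of _ f]) auto
    next
      case False
      define c where "c = lead_coeff f / lead_coeff g"
      define m where "m = monom c (degree f - degree g)"
      have c: "c \<in> K" unfolding c_def using K less.prems g by (auto intro!: sf_divide po_coeff)
      have m: "polyover K m" unfolding m_def using c by (rule po_monom)
      have c0: "c \<noteq> 0" using False g unfolding c_def by auto
      have dm: "degree (m * g) = degree f"
        using False g c0 by (simp add: degree_mult_eq m_def degree_monom_eq)
      have lm: "coeff (m * g) (degree f) = lead_coeff f"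
        using dm g c0 by (metis c_def degree_monom_eq lead_coeff_monom lead_coeff_mult m_def
            leading_coeff_0_iff nonzero_divide_eq_eq)
      define h where "h = f - m * g"
      have h: "polyover K h" unfolding h_def using less.prems m g by (intro po_diff po_mult)
      show ?thesis
      proof (cases "h = 0")
        case True
        thus ?thesis using m po_0 unfolding h_def by (intro exI[of _ m] exI[of _ 0]) auto
      next
        case h0: False
        have "degree h \<le> degree f" unfolding h_def using dm degree_diff_le by (metis order_refl)
        moreover have "coeff h (degree f) = 0" unfolding h_def using lm by simp
        ultimately have "degree h < degree f" using h0
          by (metis le_neq_implies_less leading_coeff_0_iff)
        from less.hyps[OF this h] obtain q r where
          qr: "polyover K q" "polyover K r" "h = q * g + r" "r = 0 \<or> degree r < degree g" by blast
        have "f = (q + m) * g + r" using qr(3) unfolding h_def by (simp add: algebra_simps)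
        thus ?thesis using qr m po_add by blast
      qed
    qed
  qed
  thus ?thesis using that by blast
qed

section \<open>Elements algebraic over K\<close>

definition alg_over :: "'c \<Rightarrow> bool" where
  "alg_over y \<longleftrightarrow> (\<exists>f. polyover K f \<and> f \<noteq> 0 \<and> poly f y = 0)"

text \<open>Divisibility is meant in the full polynomial ring of the ambient field; its use is that
  every root of q is a root of f.\<close>

lemma min_poly_ex:
  assumes "polyover K g" "g \<noteq> 0" "poly g y = 0"
  obtains q where "polyover K q" "q \<noteq> 0" "poly q y = 0"
    "\<And>f. polyover K f \<Longrightarrow> poly f y = 0 \<Longrightarrow> q dvd f"
proof -
  define A where "A = {f. polyover K f \<and> f \<noteq> 0 \<and> poly f y = 0}"
  have "g \<in> A" using assms unfolding A_def by auto
  then obtain q where q: "q \<in> A" "\<And>f. f \<in> A \<Longrightarrow> degree q \<le> degree f"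
    using ex_has_least_nat[of "\<lambda>f. f \<in> A" g degree] by auto
  show ?thesis
  proof (rule that[of q])
    fix f assume f: "polyover K f" "poly f y = 0"
    obtain a r where ar: "polyover K a" "polyover K r" "f = a * q + r" "r = 0 \<or> degree r < degree q"
      using po_divmod[of q f] q(1) f(1) unfolding A_def by blast
    have "poly r y = 0" using f ar(3) q(1) unfolding A_def by auto
    hence "r = 0" using ar q(2)[of r] unfolding A_def by fastforce
    thus "q dvd f" using ar by simp
  qed (use q in \<open>auto simp: A_def\<close>)
qed

text \<open>Removing factors X from g leaves a relation with nonzero constant term a, and z h(z) =
  -a exhibits the inverse of z.\<close>

lemma alg_inverse_poly:
  assumes "alg_over z" "z \<noteq> 0"
  obtains f where "polyover K f" "inverse z = poly f z"
proof -
  obtain g where g: "polyover K g" "g \<noteq> 0" "poly g z = 0" using assms unfolding alg_over_def by auto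
  have "\<exists>f. polyover K f \<and> inverse z = poly f z" using g
  proof (induction g)
    case (pCons a h)
    show ?case
    proof (cases "a = 0")
      case True
      hence "h \<noteq> 0" "poly h z = 0" "polyover K h" using pCons assms by (auto simp: po_pCons)
      thus ?thesis using pCons by auto
    next
      case False
      have "polyover K (Polynomial.smult (- inverse a) h)" using pCons.prems
        by (intro po_smult sf_minus[OF K] sf_inverse[OF K]) (simp_all add: po_pCons)
      moreover have "inverse z = poly (Polynomial.smult (- inverse a) h) z"
      proof -
        have "z * poly h z = - a" using pCons.prems by (simp add: add_eq_0_iff)
        hence "z * (- inverse a * poly h z) = 1" using False by (simp add: field_simps)
        thus ?thesis using assms by (simp add: inverse_unique)
      qed
      ultimately show ?thesis by blast
    qed
  qed auto
  thus ?thesis using that by blast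
qed

text \<open>A ring of algebraic elements is closed under inverses, since these are polynomials in
  the element. It serves for K[y], for relative algebraic closures and for the adjunction of roots
  of unity.\<close>

lemma sf_of_algebraic:
  assumes R: "K \<subseteq> R" "\<And>x y. x \<in> R \<Longrightarrow> y \<in> R \<Longrightarrow> x + y \<in> R"
    "\<And>x y. x \<in> R \<Longrightarrow> y \<in> R \<Longrightarrow> x * y \<in> R" "\<And>x. x \<in> R \<Longrightarrow> alg_over x"
  shows "is_subfield R"
proof -
  have pol: "poly f x \<in> R" if "polyover K f" "x \<in> R" for f x
    using that
  proof (induction f)
    case 0 thus ?case using R(1) sf_0[OF K] by auto
  next
    case (pCons a p) thus ?case using R by (auto simp: po_pCons)
  qed
  have "- x \<in> R" if "x \<in> R" for x
    using R(3)[of "-1" x] R(1) that sf_minus[OF K sf_1[OF K]] by auto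
  moreover have "inverse x \<in> R" if "x \<in> R" for x
  proof (cases "x = 0")
    case True thus ?thesis using that by simp
  next
    case False
    thus ?thesis using alg_inverse_poly[OF R(4)[OF that] False] pol that by metis
  qed
  moreover have "0 \<in> R" "1 \<in> R" using R(1) sf_0[OF K] sf_1[OF K] by auto
  ultimately show ?thesis
    unfolding is_subfield_def using R(2,3) by simp
qed

subsection \<open>Linear spans over a subfield\<close>

text \<open>Coefficients are indexed by the vectors themselves, so a family enters as its image, and
  repetitions only make the spanning set smaller. For infinite S the sum is 0 by convention, whence
  the finiteness hypotheses below.\<close>

definition kspan :: "'c set \<Rightarrow> 'c set" where
  "kspan S = {\<Sum>s\<in>S. k s * s | k. \<forall>s. k s \<in> K}"

lemma kspanI: "x = (\<Sum>s\<in>S. k s * s) \<Longrightarrow> \<forall>s. k s \<in> K \<Longrightarrow> x \<in> kspan S"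
  unfolding kspan_def by auto

lemma kspanE:
  assumes "x \<in> kspan S"
  obtains k where "x = (\<Sum>s\<in>S. k s * s)" "\<forall>s. k s \<in> K"
  using assms unfolding kspan_def by auto

lemma kspan_0: "0 \<in> kspan S"
  unfolding kspan_def using sf_0[OF K] by (auto intro!: exI[of _ "\<lambda>_. 0"])

lemma kspan_add: "x \<in> kspan S \<Longrightarrow> y \<in> kspan S \<Longrightarrow> x + y \<in> kspan S"
proof -
  assume "x \<in> kspan S" "y \<in> kspan S"
  then obtain k l where "x = (\<Sum>s\<in>S. k s * s)" "y = (\<Sum>s\<in>S. l s * s)" "\<forall>s. k s \<in> K" "\<forall>s. l s \<in> K"
    unfolding kspan_def by auto
  thus ?thesis unfolding kspan_def using sf_add[OF K]
    by (auto simp: sum.distrib algebra_simps intro!: exI[of _ "\<lambda>s. k s + l s"])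
qed

lemma kspan_scale: "c \<in> K \<Longrightarrow> x \<in> kspan S \<Longrightarrow> c * x \<in> kspan S"
proof -
  assume c: "c \<in> K" and "x \<in> kspan S"
  then obtain k where "x = (\<Sum>s\<in>S. k s * s)" "\<forall>s. k s \<in> K"
    unfolding kspan_def by auto
  hence "c * x = (\<Sum>s\<in>S. (c * k s) * s)" "\<forall>s. c * k s \<in> K" using sf_mult[OF K c]
    by (auto simp: sum_distrib_left mult.assoc)
  thus ?thesis by (rule kspanI)
qed

lemma kspan_sum: "(\<And>i. i \<in> I \<Longrightarrow> f i \<in> kspan S) \<Longrightarrow> sum f I \<in> kspan S"
  by (induction I rule: infinite_finite_induct) (auto simp: kspan_0 kspan_add)

lemma kspan_base: "finite S \<Longrightarrow> s \<in> S \<Longrightarrow> s \<in> kspan S"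
proof -
  assume "finite S" "s \<in> S"
  hence "s = (\<Sum>t\<in>S. (if t = s then 1 else 0) * t)"
    by (subst sum.remove[of _ s]) auto
  moreover have "\<forall>t. (if t = s then 1 else 0) \<in> K" using K sf_0 sf_1 by auto
  ultimately show ?thesis unfolding kspan_def
    by (auto intro!: exI[of _ "\<lambda>t. if t = s then 1 else 0"])
qed

lemma kspan_least:
  assumes "x \<in> kspan S" "0 \<in> V" "\<And>x y. x \<in> V \<Longrightarrow> y \<in> V \<Longrightarrow> x + y \<in> V"
    "\<And>c s. c \<in> K \<Longrightarrow> s \<in> S \<Longrightarrow> c * s \<in> V"
  shows "x \<in> V"
proof -
  obtain k where x: "x = (\<Sum>s\<in>S. k s * s)" "\<forall>s. k s \<in> K" using assms unfolding kspan_def by auto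
  have "(\<Sum>s\<in>T. k s * s) \<in> V" if "T \<subseteq> S" for T
    using that by (induction T rule: infinite_finite_induct) (use assms x in auto)
  thus ?thesis using x by auto
qed

lemma kspan_mono: "finite T \<Longrightarrow> S \<subseteq> T \<Longrightarrow> kspan S \<subseteq> kspan T"
  using kspan_least[of _ S "kspan T"] kspan_0 kspan_add kspan_scale kspan_base by blast

lemma kspan_mult:
  assumes "finite S" "finite T" "x \<in> kspan S" "y \<in> kspan T"
  shows "x * y \<in> kspan ((\<lambda>(a, b). a * b) ` (S \<times> T))"
proof -
  let ?U = "(\<lambda>(a, b). a * b) ` (S \<times> T)"
  have fin: "finite ?U" using assms by auto
  obtain k l where kl: "x = (\<Sum>s\<in>S. k s * s)" "\<forall>s. k s \<in> K" "y = (\<Sum>t\<in>T. l t * t)" "\<forall>s. l s \<in> K"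
    using assms unfolding kspan_def by auto
  have "x * y = (\<Sum>s\<in>S. \<Sum>t\<in>T. (k s * l t) * (s * t))"
    unfolding kl(1,3) sum_product by (simp add: algebra_simps)
  also have "\<dots> \<in> kspan ?U"
    by (intro kspan_sum kspan_scale kspan_base fin sf_mult[OF K]) (use kl in auto)
  finally show ?thesis .
qed

text \<open>Steinitz exchange as Gaussian elimination on the generators; all dimension counts go
  through it. The w j form an indexed family, so equal vectors at different indices are
  dependent.\<close>

lemma kspan_dependent:
  assumes "finite S" "finite J" "card S < card J" "\<And>j. j \<in> J \<Longrightarrow> w j \<in> kspan S"
  obtains k where "\<And>j. k j \<in> K" "\<exists>j\<in>J. k j \<noteq> 0" "(\<Sum>j\<in>J. k j * w j) = 0"
proof -
  have "\<exists>k. (\<forall>j. k j \<in> K) \<and> (\<exists>j\<in>J. k j \<noteq> 0) \<and> (\<Sum>j\<in>J. k j * w j) = 0"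
    using assms
  proof (induction S arbitrary: J w rule: finite_induct)
    case empty
    then obtain j where "j \<in> J" by fastforce
    moreover have "w j = 0" if "j \<in> J" for j using empty that unfolding kspan_def by auto
    ultimately show ?case using sf_1[OF K] by (intro exI[of _ "\<lambda>_. 1"]) auto
  next
    case (insert s S)
    have "\<exists>c v. c \<in> K \<and> v \<in> kspan S \<and> w j = c * s + v" if j: "j \<in> J" for j
    proof -
      obtain k where k: "w j = (\<Sum>s\<in>insert s S. k s * s)" "\<forall>s. k s \<in> K"
        using insert.prems(3)[OF j] by (rule kspanE)
      hence "w j = k s * s + (\<Sum>s\<in>S. k s * s)" using insert.hyps by simp
      thus ?thesis using k kspanI[OF refl] by blast
    qed
    then obtain c v where cv: "\<And>j. j \<in> J \<Longrightarrow> c j \<in> K" "\<And>j. j \<in> J \<Longrightarrow> v j \<in> kspan S"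
      "\<And>j. j \<in> J \<Longrightarrow> w j = c j * s + v j" by metis
    show ?case
    proof (cases "\<exists>i\<in>J. c i \<noteq> 0")
      case False
      have "\<And>j. j \<in> J \<Longrightarrow> w j \<in> kspan S" using cv False by auto
      thus ?thesis using insert.IH[of J w] insert.prems insert.hyps by auto
    next
      case True
      then obtain i where i: "i \<in> J" "c i \<noteq> 0" by auto
      \<comment> \<open>Subtracting a multiple of w i removes the generator s; \<open>l\<close>
        afterwards collects what was subtracted into the coefficient of w i.\<close>
      define w' where "w' j = w j - (c j / c i) * w i" for j
      have w': "w' j \<in> kspan S" if "j \<in> J - {i}" for j
      proof -
        have "w' j = v j + (- (c j / c i)) * v i"
          unfolding w'_def using cv(3)[of j] cv(3)[of i] i that by (simp add: field_simps)
        moreover have "v j + (- (c j / c i)) * v i \<in> kspan S" using cv i that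
          by (intro kspan_add kspan_scale sf_minus[OF K] sf_divide[OF K]) auto
        ultimately show ?thesis by (simp only:)
      qed
      have "card S < card (J - {i})" using insert i by auto
      then obtain k where k: "\<And>j. k j \<in> K" "\<exists>j\<in>J-{i}. k j \<noteq> 0" "(\<Sum>j\<in>J-{i}. k j * w' j) = 0"
        using insert.IH[of "J - {i}" w'] w' insert.prems by auto
      define l where "l j = (if j = i then - (\<Sum>j\<in>J-{i}. k j * (c j / c i)) else k j)" for j
      have "\<And>j. l j \<in> K" unfolding l_def using k cv i K
        by (auto intro!: sf_minus sf_sum sf_mult sf_divide)
      moreover have "\<exists>j\<in>J. l j \<noteq> 0" using k(2) unfolding l_def by auto
      moreover have "(\<Sum>j\<in>J. l j * w j) = 0"
      proof -
        have "(\<Sum>j\<in>J. l j * w j) = l i * w i + (\<Sum>j\<in>J-{i}. l j * w j)"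
          using i insert.prems by (simp add: sum.remove)
        also have "(\<Sum>j\<in>J-{i}. l j * w j) = (\<Sum>j\<in>J-{i}. k j * w' j + (k j * (c j / c i)) * w i)"
          by (rule sum.cong) (auto simp: l_def w'_def algebra_simps)
        also have "\<dots> = (\<Sum>j\<in>J-{i}. k j * (c j / c i)) * w i"
          using k(3) by (simp add: sum.distrib sum_distrib_right)
        finally show ?thesis unfolding l_def by simp
      qed
      ultimately show ?thesis by blast
    qed
  qed
  thus ?thesis using that by blast
qed

text \<open>The card S + 1 powers z^0, ..., z^(card S) are dependent. The bound on the degree is
  later played against the lower bound \<open>radical_degree\<close>.\<close>

lemma alg_of_kspan:
  assumes "finite S" "\<And>i. z ^ i \<in> kspan S"
  obtains f where "polyover K f" "f \<noteq> 0" "degree f \<le> card S" "poly f z = 0"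
proof -
  obtain k where k: "\<And>j. k j \<in> K" "\<exists>j\<in>{..card S}. k j \<noteq> 0" "(\<Sum>j\<in>{..card S}. k j * z ^ j) = 0"
    using kspan_dependent[of S "{..card S}" "\<lambda>i. z ^ i"] assms by auto
  define f where "f = (\<Sum>j\<in>{..card S}. monom (k j) j)"
  have cf: "coeff f i = (if i \<le> card S then k i else 0)" for i
    unfolding f_def by (simp add: coeff_sum)
  have "polyover K f" unfolding f_def using k by (intro po_sum po_monom) auto
  moreover have "f \<noteq> 0" using k(2) cf by (metis atMost_iff coeff_0)
  moreover have "degree f \<le> card S" using cf by (intro degree_le) auto
  moreover have "poly f z = 0" using k(3) unfolding f_def by (simp add: poly_sum poly_monom)
  ultimately show ?thesis using that by blast
qed

text \<open>The ring K[y]; for algebraic y it is the field K(y), by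
  \<open>adj_subfield\<close>.\<close>

definition adj :: "'c \<Rightarrow> 'c set" where
  "adj y = {poly f y | f. polyover K f}"

lemma adj_poly: "polyover K f \<Longrightarrow> poly f y \<in> adj y"
  unfolding adj_def by auto

lemma adj_self: "y \<in> adj y"
  using adj_poly[OF po_X, of y] by simp

lemma adj_superset: "K \<subseteq> adj y"
  using adj_poly[OF po_const] by fastforce

lemma adj_poly_degree:
  assumes g: "polyover K g" "g \<noteq> 0" "poly g y = 0" and x: "x \<in> adj y"
  obtains f where "polyover K f" "x = poly f y" "f = 0 \<or> degree f < degree g"
proof -
  obtain h where h: "polyover K h" "x = poly h y" using x unfolding adj_def by auto
  obtain q r where "polyover K q" "polyover K r" "h = q * g + r" "r = 0 \<or> degree r < degree g"
    using po_divmod[OF g(1,2) h(1)] by blast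
  thus ?thesis using that[of r] g h by auto
qed

lemma adj_kspan:
  assumes g: "polyover K g" "g \<noteq> 0" "poly g y = 0"
  shows "adj y \<subseteq> kspan ((\<lambda>i. y ^ i) ` {..<degree g})"
proof
  fix x assume "x \<in> adj y"
  then obtain f where f: "polyover K f" "x = poly f y" "f = 0 \<or> degree f < degree g"
    using adj_poly_degree[OF g] by blast
  show "x \<in> kspan ((\<lambda>i. y ^ i) ` {..<degree g})"
  proof (cases "f = 0")
    case True thus ?thesis using f kspan_0 by simp
  next
    case False
    have "x = (\<Sum>i\<le>degree f. coeff f i * y ^ i)" using f by (simp add: poly_altdef)
    also have "\<dots> \<in> kspan ((\<lambda>i. y ^ i) ` {..<degree g})"
      by (intro kspan_sum kspan_scale kspan_base) (use f False in \<open>auto simp: po_coeff\<close>)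
    finally show ?thesis .
  qed
qed

lemma adj_subfield:
  assumes "alg_over y"
  shows "is_subfield (adj y)"
proof (rule sf_of_algebraic[OF adj_superset])
  obtain g where g: "polyover K g" "g \<noteq> 0" "poly g y = 0" using assms unfolding alg_over_def by auto
  show ad: "u + v \<in> adj y" "u * v \<in> adj y" if uv: "u \<in> adj y" "v \<in> adj y" for u v
  proof -
    obtain f h where "polyover K f" "u = poly f y" "polyover K h" "v = poly h y"
      using uv unfolding adj_def by auto
    thus "u + v \<in> adj y" "u * v \<in> adj y"
      using adj_poly[OF po_add[of f h], of y] adj_poly[OF po_mult[of f h], of y] by auto
  qed
  show "alg_over x" if "x \<in> adj y" for x
  proof -
    have "x ^ i \<in> adj y" for i
      by (induction i) (use adj_superset sf_1[OF K] that ad in auto)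
    hence "x ^ i \<in> kspan ((\<lambda>i. y ^ i) ` {..<degree g})" for i using adj_kspan[OF g] by auto
    from alg_of_kspan[OF _ this] show ?thesis unfolding alg_over_def by (metis finite_imageI finite_lessThan)
  qed
qed

lemma adj_least: "is_subfield M \<Longrightarrow> K \<subseteq> M \<Longrightarrow> y \<in> M \<Longrightarrow> adj y \<subseteq> M"
  unfolding adj_def using po_mono po_poly Submission.po_poly by blast

lemma adj_eq_gen:
  assumes "alg_over y"
  shows "adj y = subfield_gen (insert y K)"
proof
  show "subfield_gen (insert y K) \<subseteq> adj y"
    using adj_subfield[OF assms] adj_self adj_superset by (intro sf_gen_least) auto
  show "adj y \<subseteq> subfield_gen (insert y K)"
    using sf_gen_superset[of "insert y K"] by (intro adj_least sf_gen) auto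
qed

end

lemma kspan_tower:
  assumes K: "is_subfield K" and M: "is_subfield M" and S: "finite S" "M \<subseteq> kspan K S"
    and T: "finite T" and x: "x \<in> kspan M T"
  shows "x \<in> kspan K ((\<lambda>(a, b). a * b) ` (S \<times> T))"
proof (rule kspan_least[OF M x])
  let ?V = "kspan K ((\<lambda>(a, b). a * b) ` (S \<times> T))"
  show "0 \<in> ?V" by (rule kspan_0[OF K])
  show "a + b \<in> ?V" if "a \<in> ?V" "b \<in> ?V" for a b using that by (rule kspan_add[OF K])
  show "c * s \<in> ?V" if "c \<in> M" "s \<in> T" for c s
    using kspan_mult[OF K S(1) T _ kspan_base[OF K T that(2)]] S(2) that(1) by blast
qed

section \<open>Finite extensions\<close>

definition finext :: "'c::field set \<Rightarrow> 'c set \<Rightarrow> bool" where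
  "finext K E \<longleftrightarrow> is_subfield K \<and> is_subfield E \<and> K \<subseteq> E \<and> (\<exists>S. finite S \<and> S \<subseteq> E \<and> E \<subseteq> kspan K S)"

lemma finext_refl: "is_subfield K \<Longrightarrow> finext K K"
  unfolding finext_def using kspan_scale[of K _ 1 "{1}"] kspan_base[of K "{1}" 1] sf_1[of K]
  by (auto intro!: exI[of _ "{1}"])

lemma finext_trans:
  assumes "finext K M" "finext M E"
  shows "finext K E"
proof -
  obtain S T where ST: "finite S" "S \<subseteq> M" "M \<subseteq> kspan K S" "finite T" "T \<subseteq> E" "E \<subseteq> kspan M T"
    and KM: "is_subfield K" "is_subfield M" "is_subfield E" "K \<subseteq> M" "M \<subseteq> E"
    using assms unfolding finext_def by blast
  let ?U = "(\<lambda>(a, b). a * b) ` (S \<times> T)"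
  have "E \<subseteq> kspan K ?U"
    using kspan_tower[OF KM(1,2) ST(1,3,4)] ST(6) by auto
  moreover have "?U \<subseteq> E" using ST KM sf_mult[OF KM(3)] by (auto simp: subset_iff)
  moreover have "finite ?U" using ST by auto
  moreover have "K \<subseteq> E" using KM by auto
  ultimately show ?thesis using KM unfolding finext_def by blast
qed

lemma finext_adj:
  assumes K: "is_subfield K" and y: "alg_over K y"
  shows "finext K (adj K y)"
proof -
  obtain g where g: "polyover K g" "g \<noteq> 0" "poly g y = 0" using y unfolding alg_over_def[OF K] by auto
  have "(\<lambda>i. y ^ i) ` {..<degree g} \<subseteq> adj K y"
    using sf_power[OF adj_subfield[OF K y] adj_self[OF K]] by auto
  thus ?thesis unfolding finext_def
    using K adj_subfield[OF K y] adj_superset[OF K] adj_kspan[OF K g]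
    by (intro conjI exI[of _ "(\<lambda>i. y ^ i) ` {..<degree g}"]) auto
qed

lemma finext_alg:
  assumes "finext K E" "y \<in> E"
  shows "alg_over K y"
proof -
  obtain S where S: "finite S" "S \<subseteq> E" "E \<subseteq> kspan K S" and K: "is_subfield K" and E: "is_subfield E"
    using assms unfolding finext_def by auto
  show ?thesis unfolding alg_over_def[OF K]
    using alg_of_kspan[OF K S(1), of y] S(3) sf_power[OF E assms(2)] by blast
qed

section \<open>Independence of radicals\<close>

definition pinum :: "nat set \<Rightarrow> nat \<Rightarrow> bool" where
  "pinum \<pi> m \<longleftrightarrow> m > 0 \<and> (\<forall>p. prime p \<longrightarrow> p dvd m \<longrightarrow> p \<in> \<pi>)"

lemma pinum_dvd: "pinum \<pi> m \<Longrightarrow> n dvd m \<Longrightarrow> pinum \<pi> n"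
  unfolding pinum_def by (auto intro: dvd_trans Nat.gr0I)

lemma pinum_mult: "pinum \<pi> m \<Longrightarrow> pinum \<pi> n \<Longrightarrow> pinum \<pi> (m * n)"
  unfolding pinum_def by (auto simp: prime_dvd_mult_iff)

lemma radical_alg: "is_subfield K \<Longrightarrow> b ^ p \<in> K \<Longrightarrow> p > 0 \<Longrightarrow>
  polyover K (monom 1 p - [:b ^ p:]) \<and> monom 1 p - [:b ^ p:] \<noteq> 0 \<and> poly (monom 1 p - [:b ^ p:]) b = 0
    \<and> degree (monom 1 p - [:b ^ p:]) = p"
proof -
  assume a: "is_subfield K" "b ^ p \<in> K" "p > 0"
  have "coeff (monom 1 p - [:b ^ p:]) p = 1" using a by (auto simp: coeff_pCons split: nat.splits)
  moreover have "degree (monom 1 p - [:b ^ p:]) \<le> p"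
    by (intro degree_diff_le) (auto simp: degree_monom_le)
  ultimately have "monom 1 p - [:b ^ p:] \<noteq> 0" "degree (monom 1 p - [:b ^ p:]) = p"
    by (metis coeff_0 zero_neq_one, metis le_antisym le_degree zero_neq_one)
  thus ?thesis using a sf_1[OF a(1)] by (auto simp: poly_monom intro!: po_diff po_monom po_const)
qed

lemma radical_alg_over: "is_subfield K \<Longrightarrow> b ^ p \<in> K \<Longrightarrow> p > 0 \<Longrightarrow> alg_over K b"
  using radical_alg unfolding alg_over_def by blast

section \<open>Roots of unity and radicals in an algebraically closed field of characteristic
  zero\<close>

locale closed_field0 =
  fixes ty :: "'c::field itself"
  assumes closed: "alg_closed TYPE('c)"
    and char0: "\<And>n. n > 0 \<Longrightarrow> of_nat n \<noteq> (0::'c)"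
begin

lemma root_ex: "degree (q::'c poly) > 0 \<Longrightarrow> \<exists>x. poly q x = 0"
  using closed unfolding alg_closed_def by auto

text \<open>Split q into linear factors X - r. Each root satisfies r^m = x^m, so it is x times an
  m-th root of unity, and the constant term is the leading coefficient times the product of the
  -r.\<close>

lemma const_term_dvd:
  fixes q :: "'c poly"
  assumes "q dvd monom 1 m - [:x ^ m:]" "x \<noteq> 0" "m > 0"
  shows "\<exists>e. e ^ m = 1 \<and> coeff q 0 = lead_coeff q * e * (- x) ^ degree q"
  using assms(1)
proof (induction "degree q" arbitrary: q)
  case 0
  thus ?case using assms by (intro exI[of _ 1]) simp
next
  case (Suc n)
  then obtain r where r: "poly q r = 0" using root_ex[of q] by auto
  then obtain q' where q': "q = [:- r, 1:] * q'" by (metis dvdE poly_eq_0_iff_dvd)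
  have "q \<noteq> 0" using Suc by auto
  hence q'0: "q' \<noteq> 0" using q' by auto
  have "poly (monom 1 m - [:x ^ m:]) r = 0" using Suc.prems r by (metis dvdE mult_zero_left poly_mult)
  hence rm: "r ^ m = x ^ m" by (simp add: poly_monom)
  have d: "degree q = Suc (degree q')" unfolding q' using q'0 by (subst degree_mult_eq) auto
  have "q' dvd monom 1 m - [:x ^ m:]" using Suc.prems q' by (metis dvd_mult_right)
  then obtain e where e: "e ^ m = 1" "coeff q' 0 = lead_coeff q' * e * (- x) ^ degree q'"
    using Suc.hyps d by force
  have "lead_coeff q = lead_coeff q'" unfolding q' by (simp only: lead_coeff_mult) simp
  moreover have "coeff q 0 = - r * coeff q' 0" unfolding q' by (simp add: coeff_mult)
  ultimately have "coeff q 0 = lead_coeff q * (r / x * e) * (- x) ^ degree q"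
    using e d assms by (simp add: field_simps)
  moreover have "(r / x * e) ^ m = 1" using e rm assms by (simp add: field_simps)
  ultimately show ?case by blast
qed

text \<open>A substitute for the norm: the constant term of the minimal polynomial of x lies in K
  and is a power of x up to sign, leading coefficient and a root of unity.\<close>

lemma const_term:
  fixes x :: 'c
  assumes K: "is_subfield K" and x: "x \<noteq> 0" "x ^ m \<in> K" "m > 0"
    and g: "polyover K g" "g \<noteq> 0" "poly g x = 0"
  obtains n e where "1 \<le> n" "n \<le> degree g" "e ^ m = 1" "e * x ^ n \<in> K"
proof -
  obtain q where q: "polyover K q" "q \<noteq> 0" "poly q x = 0"
    "\<And>f. polyover K f \<Longrightarrow> poly f x = 0 \<Longrightarrow> q dvd f"
    using min_poly_ex[OF K g] by blast
  have "polyover K (monom 1 m - [:x ^ m:])"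
    by (intro po_diff[OF K] po_monom[OF K] po_const[OF K] x sf_1[OF K])
  hence "q dvd monom 1 m - [:x ^ m:]" by (rule q(4)) (simp add: poly_monom)
  from const_term_dvd[OF this x(1,3)] obtain e
    where e: "e ^ m = 1" "coeff q 0 = lead_coeff q * e * (- x) ^ degree q" by auto
  have "degree q \<ge> 1"
  proof (rule ccontr)
    assume "\<not> ?thesis"
    hence "degree q = 0" by simp
    then obtain a where "q = [:a:]" by (rule degree_eq_zeroE)
    thus False using q(2,3) by simp
  qed
  moreover have "degree q \<le> degree g" using q(4)[OF g(1,3)] g(2) by (rule dvd_imp_degree_le)
  moreover have "e * x ^ degree q \<in> K"
  proof -
    have "e * x ^ degree q = coeff q 0 * (- 1) ^ degree q / lead_coeff q"
    proof -
      have "(- x) ^ degree q * (- 1) ^ degree q = x ^ degree q"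
        by (simp add: power_mult_distrib[symmetric])
      thus ?thesis using e(2) q(2) by (simp add: mult.assoc)
    qed
    also have "\<dots> \<in> K" using q(1)
      by (intro sf_divide[OF K] sf_mult[OF K] sf_power[OF K] sf_minus[OF K] sf_1[OF K] po_coeff)
    finally show ?thesis .
  qed
  ultimately show ?thesis using e(1) that by blast
qed

text \<open>A zero of 1 + X + ... + X^(p-1). It differs from 1, where the value is p, which is
  nonzero in characteristic zero.\<close>

lemma prime_root_ex:
  assumes "prime p"
  obtains z :: 'c where "z \<noteq> 1" "z ^ p = 1"
proof -
  define q :: "'c poly" where "q = (\<Sum>i<p. monom 1 i)"
  have cq: "coeff q i = (if i < p then 1 else 0)" for i unfolding q_def by (simp add: coeff_sum)
  have p2: "p \<ge> 2" using assms prime_ge_2_nat by blast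
  have "degree q \<ge> 1" using le_degree[of q 1] cq p2 by auto
  then obtain z where z: "poly q z = 0" using root_ex[of q] by auto
  have pq: "poly q y = (\<Sum>i<p. y ^ i)" for y unfolding q_def by (simp add: poly_sum poly_monom)
  have "z \<noteq> 1" using z pq[of 1] char0[of p] p2 by auto
  moreover have "z ^ p = 1"
    using power_diff_1_eq[of z p] z pq p2 by simp
  ultimately show ?thesis using that by blast
qed

text \<open>The powers z^0, ..., z^(p-1) are distinct, so they exhaust the at most p roots of X^p -
  1.\<close>

lemma prime_root_powers:
  fixes z :: 'c
  assumes p: "prime p" and z: "z \<noteq> 1" "z ^ p = 1" and y: "y ^ p = 1"
  obtains e where "e < p" "y = z ^ e"
proof -
  define f :: "'c poly" where "f = monom 1 p - 1"
  have p0: "p > 1" using p prime_gt_1_nat by blast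
  have f0: "f \<noteq> 0"
  proof
    assume "f = 0"
    hence "coeff f p = 0" by simp
    thus False unfolding f_def using p0 by simp
  qed
  have df: "degree f \<le> p" unfolding f_def by (intro degree_diff_le) (auto simp: degree_monom_le)
  have sub: "(\<lambda>e. z ^ e) ` {..<p} \<subseteq> {x. poly f x = 0}"
    using z by (auto simp: f_def poly_monom power_mult[symmetric] mult.commute) (metis power_mult power_one mult.commute)
  have z0: "z \<noteq> 0" using z p0 by (metis power_0_left zero_neq_one not_one_less_zero)
  have inj: "inj_on (\<lambda>e. z ^ e) {..<p}"
  proof (rule linorder_inj_onI)
    fix a b assume ab: "a < b" "a \<in> {..<p}" "b \<in> {..<p}"
    show "z ^ a \<noteq> z ^ b"
    proof
      assume "z ^ a = z ^ b"
      hence "z ^ a * z ^ (b - a) = z ^ a" using ab by (metis le_add_diff_inverse less_imp_le power_add)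
      hence "z ^ (b - a) = 1" using z0 by simp
      moreover have "coprime (b - a) p" using p ab
        by (metis coprime_commute diff_less_mono2 less_imp_diff_less lessThan_iff nat_dvd_not_less
            prime_imp_coprime_nat zero_less_diff)
      ultimately have "z ^ gcd (b - a) p \<in> {1}" 
      proof -
        obtain u v where uv: "u * int (b - a) + v * int p = gcd (int (b - a)) (int p)"
          using bezout_int by blast
        have "z powi (gcd (int (b - a)) (int p)) = z powi (int (b - a) * u) * z powi (int p * v)"
          unfolding uv[symmetric] by (subst power_int_add) (use z0 in \<open>simp_all add: mult.commute\<close>)
        also have "\<dots> = (z ^ (b - a)) powi u * (z ^ p) powi v"
          by (simp only: power_int_mult power_int_of_nat)
        finally show ?thesis using \<open>z ^ (b - a) = 1\<close> z by (simp add: gcd_int_int_eq)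
      qed
      thus False using z \<open>coprime (b - a) p\<close> by simp
    qed
  qed (simp_all add: linear)
  have "card {x. poly f x = 0} \<le> p" using card_poly_roots_bound[OF f0] df by simp
  moreover have "card ((\<lambda>e. z ^ e) ` {..<p}) = p" using card_image[OF inj] by simp
  ultimately have "(\<lambda>e. z ^ e) ` {..<p} = {x. poly f x = 0}"
    using sub poly_roots_finite[OF f0] by (metis card_seteq)
  moreover have "y \<in> {x. poly f x = 0}" using y by (simp add: f_def poly_monom)
  ultimately show ?thesis using that by auto
qed

text \<open>The hypothesis of Kummer theory, relative to L. It is used with L the whole field and
  with L = s. The square root of -1 serves the prime 2.\<close>

definition kum :: "nat set \<Rightarrow> 'c set \<Rightarrow> 'c set \<Rightarrow> bool" where
  "kum \<pi> K L \<longleftrightarrow> is_subfield K \<and> is_subfield L \<and> K \<subseteq> L \<and> (\<exists>i\<in>K. i ^ 2 = -1)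
     \<and> (\<forall>p\<in>\<pi>. prime p \<longrightarrow> (\<forall>z\<in>L. z ^ p = 1 \<longrightarrow> z \<in> K))"

lemma kum_root: "kum \<pi> K L \<Longrightarrow> p \<in> \<pi> \<Longrightarrow> prime p \<Longrightarrow> z \<in> L \<Longrightarrow> z ^ p = 1 \<Longrightarrow> z \<in> K"
  unfolding kum_def by blast

lemma kum_up: "kum \<pi> K L \<Longrightarrow> is_subfield M \<Longrightarrow> K \<subseteq> M \<Longrightarrow> M \<subseteq> L \<Longrightarrow> kum \<pi> M L"
  unfolding kum_def by blast

text \<open>Irreducibility of X^p - b^p, in the form of a degree bound. A relation of degree below p
  would give e b^n in K with 0 < n < p and e^p = 1. Then e lies in L, hence in K, and b^n and b^p in
  K with n prime to p force b into K.\<close>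

lemma radical_degree:
  assumes kum: "kum \<pi> K L" and p: "prime p" "p \<in> \<pi>" and b: "b \<in> L" "b ^ p \<in> K" "b \<notin> K"
    and g: "polyover K g" "g \<noteq> 0" "poly g b = 0"
  shows "degree g \<ge> p"
proof (rule ccontr)
  assume lt: "\<not> ?thesis"
  have K: "is_subfield K" and L: "is_subfield L" and KL: "K \<subseteq> L" using kum unfolding kum_def by auto
  have b0: "b \<noteq> 0" using b sf_0[OF K] by auto
  have p0: "p > 0" using p prime_gt_0_nat by blast
  obtain n e where ne: "1 \<le> n" "n \<le> degree g" "e ^ p = 1" "e * b ^ n \<in> K"
    using const_term[OF K b0 b(2) p0 g] by blast
  have "b ^ n \<in> L" "b ^ n * e \<in> L" using b ne KL sf_power[OF L] by (auto simp: mult.commute)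
  hence "e \<in> L" using sf_mult_cancel[OF L, of "b ^ n" e] b0 by auto
  hence "e \<in> K" using kum_root[OF kum p(2,1)] ne by auto
  moreover have "e \<noteq> 0" using ne p0 by (metis power_0_left zero_neq_one not_gr_zero)
  ultimately have "b ^ n \<in> K" using sf_mult_cancel[OF K] ne by blast
  moreover have "coprime n p" using ne lt p
    by (metis coprime_commute le_trans nat_dvd_not_less not_le not_less_eq_eq One_nat_def prime_imp_coprime_nat zero_less_Suc less_le_trans)
  ultimately show False using sf_pow_coprime[OF K b0 _ b(2)] b by blast
qed

text \<open>The conjugation taking b to w b over K. No automorphism is available, since w need not lie in
  K(b); it is replaced by the transfer of polynomial relations from b to w b.\<close>

lemma radical_conj:
  assumes kum: "kum \<pi> K L" and p: "prime p" "p \<in> \<pi>" and b: "b \<in> L" "b ^ p \<in> K" "b \<notin> K"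
    and F: "polyover K F" "poly F b = 0" and w: "w ^ p = 1"
  shows "poly F (w * b) = 0"
proof -
  have K: "is_subfield K" using kum unfolding kum_def by auto
  have p0: "p > 0" using p prime_gt_0_nat by blast
  let ?g = "monom 1 p - [:b ^ p:]"
  have g: "polyover K ?g" "?g \<noteq> 0" "poly ?g b = 0" "degree ?g = p"
    using radical_alg[OF K b(2) p0] by auto
  obtain q r where qr: "polyover K q" "polyover K r" "F = q * ?g + r" "r = 0 \<or> degree r < degree ?g"
    using po_divmod[OF K g(1,2) F(1)] by blast
  have "poly r b = 0" using F qr g by auto
  hence "r \<noteq> 0 \<Longrightarrow> p \<le> degree r" using radical_degree[OF kum p b qr(2)] by auto
  hence "r = 0" using qr(4) g(4) by (cases "r = 0") auto
  moreover have "poly ?g (w * b) = 0" using w by (simp add: poly_monom power_mult_distrib)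
  ultimately show ?thesis using qr(3) by simp
qed

lemma adj_sub:
  assumes "kum \<pi> K L" "b \<in> L"
  shows "adj K b \<subseteq> L"
  using assms adj_least[of K L b] unfolding kum_def by auto

text \<open>If conjugation multiplies x by z^e, then y = x / b^e is fixed (up to the factor b^p in K).
  Were y not in K, then b would be a polynomial in y, hence fixed as well.\<close>

lemma radical_adj_same:
  assumes kum: "kum \<pi> K L" and p: "prime p" "p \<in> \<pi>" and b: "b \<in> L" "b ^ p \<in> K" "b \<notin> K"
    and x: "x \<in> adj K b" "x ^ p \<in> K" "x \<noteq> 0"
  obtains k e where "k \<in> K" "x = k * b ^ e"
proof -
  have K: "is_subfield K" using kum unfolding kum_def by auto
  have p0: "p > 0" using p prime_gt_0_nat by blast
  have b0: "b \<noteq> 0" using b sf_0[OF K] by auto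
  obtain f where f: "polyover K f" "x = poly f b" using x unfolding adj_def[OF K] by auto
  obtain z :: 'c where z: "z \<noteq> 1" "z ^ p = 1" using prime_root_ex[OF p(1)] by blast
  have "poly (f ^ p - [:x ^ p:]) (z * b) = 0"
    by (rule radical_conj[OF kum p b _ _ z(2)])
      (use f x in \<open>auto intro!: po_diff[OF K] po_power[OF K] po_const[OF K]\<close>)
  hence "(poly f (z * b) / x) ^ p = 1" using x by (simp add: field_simps)
  then obtain e where e: "e < p" "poly f (z * b) / x = z ^ e"
    using prime_root_powers[OF p(1) z] by blast
  define y where "y = x * b ^ (p - e)"
  define f' where "f' = f * monom 1 (p - e)"
  have f': "polyover K f'" unfolding f'_def
    by (intro po_mult[OF K] f po_monom[OF K] sf_1[OF K])
  have y1: "poly f' b = y" unfolding f'_def y_def using f by (simp add: poly_monom)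
  have "poly f' (z * b) = (z ^ e * x) * (z ^ (p - e) * b ^ (p - e))"
    unfolding f'_def using e(2) x by (simp add: poly_monom power_mult_distrib field_simps)
  also have "\<dots> = (z ^ e * z ^ (p - e)) * y" unfolding y_def by (simp add: algebra_simps)
  also have "z ^ e * z ^ (p - e) = 1" using e z by (simp add: power_add[symmetric])
  finally have y2: "poly f' (z * b) = y" by simp
  have y0: "y \<noteq> 0" unfolding y_def using x b0 by simp
  have "y ^ p = x ^ p * (b ^ p) ^ (p - e)"
    unfolding y_def by (simp add: power_mult_distrib power_mult[symmetric] mult.commute)
  hence yp: "y ^ p \<in> K" using x b by (auto intro!: sf_mult[OF K] sf_power[OF K])
  have yadj: "y \<in> adj K b" using adj_poly[OF K f', of b] y1 by simp
  have "y \<in> K"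
  proof (rule ccontr)
    assume yK: "y \<notin> K"
    have yL: "y \<in> L" using yadj adj_sub[OF kum b(1)] by auto
    have sa: "is_subfield (adj K b)"
      by (intro adj_subfield[OF K] radical_alg_over[OF K b(2) p0])
    let ?S = "(\<lambda>i. b ^ i) ` {..<p}"
    have asp: "adj K b \<subseteq> kspan K ?S"
      using adj_kspan[OF K, of "monom 1 p - [:b ^ p:]" b] radical_alg[OF K b(2) p0] by auto
    have "card ?S < card {..p}" using card_image_le[of "{..<p}" "\<lambda>i. b ^ i"] by simp
    \<comment> \<open>The index p is a slot for b: with y^0, ..., y^(p-1) this makes p + 1 vectors
      in a space with p generators.\<close>
    moreover have "(if j = p then b else y ^ j) \<in> kspan K ?S" for j
      using asp adj_self[OF K, of b] sf_power[OF sa yadj, of j] by auto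
    ultimately obtain k where k: "\<And>j. k j \<in> K" "\<exists>j\<in>{..p}. k j \<noteq> 0"
      "(\<Sum>j\<in>{..p}. k j * (if j = p then b else y ^ j)) = 0"
      using kspan_dependent[OF K, of ?S "{..p}" "\<lambda>j. if j = p then b else y ^ j"] by auto
    define g where "g = (\<Sum>j<p. monom (k j) j)"
    have g: "polyover K g" unfolding g_def using k by (intro po_sum[OF K] po_monom[OF K])
    have cg: "coeff g i = (if i < p then k i else 0)" for i unfolding g_def by (simp add: coeff_sum)
    have dg: "degree g < p" using p0 cg by (metis degree_0 leading_coeff_0_iff)
    have "(\<Sum>j\<in>{..p}. k j * (if j = p then b else y ^ j)) = poly g y + k p * b"
      unfolding g_def lessThan_Suc_atMost[symmetric] by (simp add: poly_sum poly_monom)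
    hence rel: "poly g y + k p * b = 0" using k(3) by simp
    \<comment> \<open>Otherwise y would satisfy a relation of degree below p, which
      \<open>radical_degree\<close> excludes for y just as for b.\<close>
    have kp: "k p \<noteq> 0"
    proof
      assume kp: "k p = 0"
      then obtain j where "j < p" "k j \<noteq> 0" using k(2) by (metis atMost_iff le_neq_implies_less)
      hence "g \<noteq> 0" using cg by (metis coeff_0)
      thus False using radical_degree[OF kum p yL yp yK g] rel kp dg by auto
    qed
    define h where "h = Polynomial.smult (- inverse (k p)) g"
    have h: "polyover K h" unfolding h_def
      by (intro po_smult[OF K] sf_minus[OF K] sf_inverse[OF K] k g)
    have hy: "poly h y = b" using rel kp unfolding h_def by (simp add: field_simps add_eq_0_iff)
    \<comment> \<open>The relation h(f'(b)) = b passes to z b; as f' takes the same value y at both,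
      it follows that b = z b.\<close>
    have "poly (pcompose h f' - [:0, 1:]) (z * b) = 0"
      by (rule radical_conj[OF kum p b _ _ z(2)])
        (use h f' hy y1 in \<open>auto simp: poly_pcompose intro!: po_diff[OF K] po_pcompose[OF K] po_X[OF K]\<close>)
    thus False using hy y2 b0 z by (simp add: poly_pcompose)
  qed
  hence "y / b ^ p \<in> K" using b sf_divide[OF K] by auto
  moreover have "x = (y / b ^ p) * b ^ e"
  proof -
    have "b ^ p = b ^ (p - e) * b ^ e" using e by (simp add: power_add[symmetric])
    thus ?thesis unfolding y_def using b0 by simp
  qed
  ultimately show ?thesis using that by blast
qed

text \<open>The degrees p and q are incompatible. If b lies in K(x), comparing degrees both ways
  gives p = q. Otherwise b still has degree p over K(x), where f(X) - x is a relation for b of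
  degree below p; so f is constant and x lies in K.\<close>

lemma radical_adj_other:
  assumes kum: "kum \<pi> K L" and p: "prime p" "p \<in> \<pi>" and b: "b \<in> L" "b ^ p \<in> K" "b \<notin> K"
    and q: "prime q" "q \<in> \<pi>" "q \<noteq> p" and x: "x \<in> adj K b" "x ^ q \<in> K"
  shows "x \<in> K"
proof (rule ccontr)
  assume xK: "x \<notin> K"
  have K: "is_subfield K" using kum unfolding kum_def by auto
  have p0: "p > 0" "q > 0" using p q prime_gt_0_nat by auto
  have xL: "x \<in> L" using x adj_sub[OF kum b(1)] by auto
  note xx = xL x(2) xK
  \<comment> \<open>K(x2) is spanned by q2 elements over K, so b2 has degree at most q2.\<close>
  have bound: "p2 \<le> q2" if "prime p2" "p2 \<in> \<pi>" "prime q2" "b2 \<in> L" "b2 ^ p2 \<in> K" "b2 \<notin> K"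
    "x2 ^ q2 \<in> K" "b2 \<in> adj K x2" for p2 q2 b2 x2
  proof -
    note rx = radical_alg[OF K that(7) prime_gt_0_nat[OF that(3)]]
    have sa: "is_subfield (adj K x2)"
      by (intro adj_subfield[OF K] radical_alg_over[OF K that(7) prime_gt_0_nat[OF that(3)]])
    let ?S = "(\<lambda>i. x2 ^ i) ` {..<q2}"
    have "b2 ^ i \<in> kspan K ?S" for i
      using adj_kspan[OF K, of "monom 1 q2 - [:x2 ^ q2:]" x2] rx sf_power[OF sa that(8), of i] by auto
    from alg_of_kspan[OF K _ this] obtain f where "polyover K f" "f \<noteq> 0" "degree f \<le> card ?S" "poly f b2 = 0"
      by (metis finite_imageI finite_lessThan)
    thus ?thesis using radical_degree[OF kum that(1,2,4-6), of f] card_image_le[of "{..<q2}" "\<lambda>i. x2 ^ i"] by simp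
  qed
  show False
  proof (cases "b \<in> adj K x")
    case True
    have "p \<le> q" using bound[of p q b x] p q b x True by auto
    moreover have "q \<le> p" using bound[of q p x b] p q b x xL xK by auto
    ultimately show False using q by auto
  next
    case False
    have M: "is_subfield (adj K x)"
      by (intro adj_subfield[OF K] radical_alg_over[OF K x(2) p0(2)])
    have KM: "K \<subseteq> adj K x" using adj_superset[OF K] .
    have kM: "kum \<pi> (adj K x) L" by (rule kum_up[OF kum M KM adj_sub[OF kum xL]])
    obtain f where f: "polyover K f" "x = poly f b" "f = 0 \<or> degree f < degree (monom 1 p - [:b ^ p:])"
      using adj_poly_degree[OF K _ _ _ x(1), of "monom 1 p - [:b ^ p:]"] radical_alg[OF K b(2) p0(1)] by auto
    have df: "degree f < p" using f(3) radical_alg[OF K b(2) p0(1)] p0 by auto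
    define g where "g = f - [:x:]"
    have g: "polyover (adj K x) g" unfolding g_def
      using f KM by (intro po_diff[OF M] po_const[OF M] adj_self[OF K]) (auto intro: po_mono)
    have dg: "degree g < p" unfolding g_def using df p0 by (intro degree_diff_less) auto
    have "b ^ p \<in> adj K x" "poly g b = 0" using b(2) KM f(2) unfolding g_def by auto
    hence "g = 0" using radical_degree[OF kM p b(1) _ False g] dg by (metis not_le)
    hence "x = coeff f 0" unfolding g_def by simp
    thus False using xK po_coeff[OF f(1)] by auto
  qed
qed

text \<open>If L contains a primitive p-th root of unity z, going once around the conjugates z^l b
  would multiply x by z. If 1 is the only p-th root of unity in L, the constant term of a relation
  for x of degree at most p already puts x^p = b into K.\<close>

lemma radical_adj_root:
  assumes kum: "kum \<pi> K L" and p: "prime p" "p \<in> \<pi>" and b: "b \<in> L" "b ^ p \<in> K" "b \<notin> K"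
    and x: "x \<in> adj K b" "x ^ p = b"
  shows False
proof -
  have K: "is_subfield K" and L: "is_subfield L" and KL: "K \<subseteq> L" using kum unfolding kum_def by auto
  have p0: "p > 0" "p > 1" using p prime_gt_0_nat prime_gt_1_nat by auto
  have b0: "b \<noteq> 0" using b sf_0[OF K] by auto
  have x0: "x \<noteq> 0" using x b0 p0 by (auto simp: power_0_left)
  have xL: "x \<in> L" using x adj_sub[OF kum b(1)] by auto
  have sa: "is_subfield (adj K b)"
    by (intro adj_subfield[OF K] radical_alg_over[OF K b(2) p0(1)])
  obtain z :: 'c where z: "z \<noteq> 1" "z ^ p = 1" using prime_root_ex[OF p(1)] by blast
  show False
  proof (cases "z \<in> L")
    case True
    hence zK: "z \<in> K" using kum_root[OF kum p(2,1)] z by blast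
    obtain f where f: "polyover K f" "x = poly f b" using x unfolding adj_def[OF K] by auto
    have "poly (f ^ p - [:0, 1:]) (z * b) = 0"
      by (rule radical_conj[OF kum p b _ _ z(2)])
        (use f x in \<open>auto intro!: po_diff[OF K] po_power[OF K] po_X[OF K]\<close>)
    hence fz: "poly f (z * b) ^ p = z * b" by simp
    \<comment> \<open>The factor by which the substitution of z b for b changes x.\<close>
    define d where "d = poly f (z * b) / x"
    have dp: "d ^ p = z" unfolding d_def using fz x b0 by (simp add: power_divide)
    have fzb: "poly (pcompose f [:0, z:]) b = poly f (z * b)" by (simp add: poly_pcompose mult.commute)
    have po: "polyover K (pcompose f [:0, z:])"
      using f zK sf_0[OF K] po_0[OF K] by (intro po_pcompose[OF K]) (auto simp: po_pCons[OF K])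
    have dadj: "d \<in> adj K b" unfolding d_def
      using adj_poly[OF K po, of b] fzb x by (intro sf_divide[OF sa]) auto
    \<comment> \<open>For odd p the power of z is 1 because p divides p choose 2. For p = 2 this
      argument fails; there z = -1, so d is i or -i and lies in K, which allows c = 0.\<close>
    have "\<exists>k c. k \<in> K \<and> d = k * b ^ c \<and> z ^ (c * (p choose 2)) = 1"
    proof (cases "p = 2")
      case True
      hence "(z - 1) * (z + 1) = 0" using z(2) by (simp add: power2_eq_square algebra_simps)
      hence z1: "z = - 1" using z(1) by (auto simp: add_eq_0_iff2)
      obtain i where i: "i \<in> K" "i ^ 2 = - 1" using kum unfolding kum_def by auto
      have "(d - i) * (d + i) = d ^ 2 - i ^ 2" by (simp add: power2_eq_square algebra_simps)
      hence "(d - i) * (d + i) = 0" using dp True z1 i by simp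
      hence "d = i \<or> d = - i" by (auto simp: eq_neg_iff_add_eq_0)
      hence "d \<in> K" using i sf_minus[OF K] by auto
      thus ?thesis by (intro exI[of _ d] exI[of _ 0]) auto
    next
      case False
      hence "odd p" using p(1) prime_odd_nat p0 by (metis prime_ge_2_nat le_neq_implies_less)
      then obtain h where h: "p = 2 * h + 1" by (auto elim: oddE)
      have pc: "p choose 2 = p * h" unfolding choose_two h by simp
      obtain k c where kc: "k \<in> K" "d = k * b ^ c"
        using radical_adj_same[OF kum p b dadj] dp zK z p0 by (metis power_0_left zero_neq_one not_gr_zero)
      have "z ^ (c * (p choose 2)) = (z ^ p) ^ (c * h)" unfolding pc power_mult[symmetric]
        by (simp add: ac_simps)
      thus ?thesis using kc z by auto
    qed
    then obtain k c where kc: "k \<in> K" "d = k * b ^ c" "z ^ (c * (p choose 2)) = 1" by auto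
    \<comment> \<open>States f(z b) = d f(b) as a polynomial relation for b over K, so that it can
      be transferred to every conjugate z^l b.\<close>
    define F where "F = pcompose f [:0, z:] - Polynomial.smult k (monom 1 c * f)"
    have F: "polyover K F" unfolding F_def
      by (intro po_diff[OF K] po po_smult[OF K] po_mult[OF K] po_monom[OF K] f kc sf_1[OF K])
    have F0: "poly F b = 0" unfolding F_def using fzb kc f x0 unfolding d_def
      by (simp add: poly_monom field_simps)
    have iter: "poly f (z ^ l * b) = z ^ (c * (l choose 2)) * d ^ l * x" for l
    proof (induction l)
      case 0 thus ?case using f by (simp add: numeral_2_eq_2)
    next
      case (Suc l)
      have "(z ^ l) ^ p = 1" using z by (metis power_mult mult.commute power_one)
      from radical_conj[OF kum p b F F0 this]
      have "poly f (z * (z ^ l * b)) = k * (z ^ l * b) ^ c * poly f (z ^ l * b)"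
        unfolding F_def by (simp add: poly_pcompose poly_monom mult.commute)
      also have "\<dots> = (k * b ^ c) * z ^ (c * l) * (z ^ (c * (l choose 2)) * d ^ l * x)"
        unfolding Suc by (simp add: power_mult_distrib power_mult[symmetric] mult_ac)
      also have "\<dots> = z ^ (c * (Suc l choose 2)) * d ^ Suc l * x"
        unfolding kc(2)[symmetric]
        by (simp add: numeral_2_eq_2 power_add algebra_simps)
      finally show ?case by (simp add: mult_ac)
    qed
    \<comment> \<open>At l = p the conjugate is b again, while the accumulated factor is d^p =
      z.\<close>
    have "x = z * x" using iter[of p] kc(3) dp z f by simp
    thus False using z x0 by simp
  next
    case False
    \<comment> \<open>A p-th root of unity other than 1 in L would have z among its powers.\<close>
    have triv: "u = 1" if u: "u \<in> L" "u ^ p = 1" for u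
    proof (rule ccontr)
      assume "u \<noteq> 1"
      then obtain e where "z = u ^ e" using prime_root_powers[OF p(1) _ u(2) z(2)] by blast
      thus False using sf_power[OF L u(1)] False by auto
    qed
    let ?S = "(\<lambda>i. b ^ i) ` {..<p}"
    have "x ^ i \<in> kspan K ?S" for i
      using adj_kspan[OF K, of "monom 1 p - [:b ^ p:]" b] radical_alg[OF K b(2) p0(1)]
        sf_power[OF sa x(1), of i] by auto
    from alg_of_kspan[OF K _ this] obtain g where g: "polyover K g" "g \<noteq> 0" "degree g \<le> card ?S" "poly g x = 0"
      by (metis finite_imageI finite_lessThan)
    have xpp: "x ^ (p * p) \<in> K" using x(2) b(2) by (simp add: power_mult)
    obtain n e where ne: "1 \<le> n" "n \<le> degree g" "e ^ (p * p) = 1" "e * x ^ n \<in> K"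
      using const_term[OF K x0 xpp _ g(1,2,4)] p0 by auto
    have np: "n \<le> p" using ne(2) g(3) card_image_le[of "{..<p}" "\<lambda>i. b ^ i"] by simp
    have "x ^ n * e \<in> L" using ne KL by (auto simp: mult.commute)
    hence eL: "e \<in> L" using sf_mult_cancel[OF L sf_power[OF L xL]] x0 by auto
    have "e ^ p = 1" using triv[of "e ^ p"] sf_power[OF L eL] ne by (simp add: power_mult)
    hence "e = 1" using triv eL by blast
    hence "x ^ n \<in> K" using ne by simp
    hence gK: "x ^ gcd n (p * p) \<in> K" using sf_pow_gcd[OF K x0 _ xpp] by blast
    \<comment> \<open>The gcd is 1, p or p^2, and n \<le> p < p^2 excludes the last; so it divides
      p, which brings x^p = b into K.\<close>
    have "gcd n (p * p) dvd p ^ 2" by (simp add: power2_eq_square)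
    then obtain i where i: "i \<le> 2" "gcd n (p * p) = p ^ i" using divides_primepow_nat[OF p(1)] by blast
    have "i \<noteq> 2"
    proof
      assume "i = 2"
      hence "p * p \<le> n" using i ne(1) by (metis gcd_le1_nat not_one_le_zero power2_eq_square)
      moreover have "p < p * p" using p0 by simp
      ultimately show False using np by linarith
    qed
    hence "i = 0 \<or> i = 1" using i by auto
    hence "gcd n (p * p) dvd p" using i by auto
    then obtain j where "p = gcd n (p * p) * j" by auto
    hence "x ^ p = (x ^ gcd n (p * p)) ^ j" by (metis power_mult)
    hence "b \<in> K" using x(2) gK sf_power[OF K] by simp
    thus False using b by simp
  qed
qed

text \<open>Descent on m through a prime factor q, with x^q = k b^j by induction. For q = p, either
  x^p lies in K, or a power of x is a p-th root of some c b with c in K, although c b generates the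
  same field as b. For q different from p, a power of b corrects x so that its q-th power lies in
  K.\<close>

lemma radical_adj_key:
  assumes kum: "kum \<pi> K L" and p: "prime p" "p \<in> \<pi>" and b: "b \<in> L" "b ^ p \<in> K" "b \<notin> K"
    and x: "x \<in> adj K b" "x \<noteq> 0" "pinum \<pi> m" "x ^ m \<in> K"
  shows "\<exists>k\<in>K. \<exists>j. x = k * b ^ j"
  using x
proof (induction m arbitrary: x rule: less_induct)
  case (less m)
  have K: "is_subfield K" using kum unfolding kum_def by auto
  have p0: "p > 0" "p > 1" using p prime_gt_0_nat prime_gt_1_nat by auto
  have b0: "b \<noteq> 0" using b sf_0[OF K] by auto
  have sa: "is_subfield (adj K b)"
    by (intro adj_subfield[OF K] radical_alg_over[OF K b(2) p0(1)])
  show ?case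
  proof (cases "m = 1")
    case True
    thus ?thesis using less.prems by (intro bexI[of _ x] exI[of _ 0]) auto
  next
    case False
    then obtain q where q: "prime q" "q dvd m" using prime_factor_nat by blast
    have q\<pi>: "q \<in> \<pi>" using less.prems q unfolding pinum_def by auto
    obtain m' where m': "m = q * m'" using q by auto
    have mp: "pinum \<pi> m'" using pinum_dvd[OF less.prems(3), of m'] m' by simp
    hence "m' > 0" unfolding pinum_def by simp
    hence mm: "m' < m" "pinum \<pi> m'" using mp m' prime_gt_1_nat[OF q(1)] by auto
    have "x ^ q \<in> adj K b" "x ^ q \<noteq> 0" "(x ^ q) ^ m' \<in> K"
      using less.prems sf_power[OF sa] m' by (auto simp: power_mult)
    from less.IH[OF mm(1) this(1,2) mm(2) this(3)] obtain k j where kj: "k \<in> K" "x ^ q = k * b ^ j"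
      by auto
    have k0: "k \<noteq> 0" using kj less.prems by auto
    have bK: "b ^ i \<in> K" if "p dvd i" for i
      using that b(2) sf_power[OF K] by (auto simp: dvd_def power_mult)
    show ?thesis
    proof (cases "q = p")
      case True
      show ?thesis
      proof (cases "p dvd j")
        case True
        hence "x ^ p \<in> K" using kj bK \<open>q = p\<close> sf_mult[OF K] by auto
        thus ?thesis using radical_adj_same[OF kum p b less.prems(1) _ less.prems(2)] by metis
      next
        case False
        hence "coprime j p" using p by (metis coprime_commute prime_imp_coprime_nat)
        \<comment> \<open>With j' inverse to j modulo p, the p-th power of x^j' is b up to a factor
          in K.\<close>
        then obtain j' where j': "[j * j' = 1] (mod p)" using cong_solve_coprime_nat by auto
        have jj: "j * j' = p * (j * j' div p) + 1"
          using j' p0 unfolding cong_def by (metis mod_less mult_div_mod_eq)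
        define c where "c = k ^ j' * b ^ (p * (j * j' div p))"
        have c: "c \<in> K" unfolding c_def using kj bK by (intro sf_mult[OF K] sf_power[OF K, of k]) auto
        have c0: "c \<noteq> 0" unfolding c_def using k0 b0 by simp
        have "(x ^ j') ^ p = (x ^ q) ^ j'" using \<open>q = p\<close> by (simp add: power_mult[symmetric] mult.commute)
        also have "\<dots> = k ^ j' * b ^ (j * j')" unfolding kj(2) by (simp add: power_mult_distrib power_mult)
        also have "\<dots> = c * b" unfolding c_def by (subst jj) (simp add: power_add)
        finally have xc: "(x ^ j') ^ p = c * b" .
        have alg: "alg_over K b" by (rule radical_alg_over[OF K b(2) p0(1)])
        have cbp: "(c * b) ^ p \<in> K" using c b by (auto simp: power_mult_distrib intro!: sf_mult[OF K] sf_power[OF K])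
        have alg': "alg_over K (c * b)" by (rule radical_alg_over[OF K cbp p0(1)])
        have cb: "c * b \<in> L" using b c kum sf_mult[of L] unfolding kum_def by auto
        have cbK: "c * b \<notin> K" using b(3) sf_mult_cancel[OF K c c0] by auto
        have "b \<in> adj K (c * b)"
          using sf_mult_cancel[OF adj_subfield[OF K alg'] _ c0 adj_self[OF K]] c adj_superset[OF K] by blast
        hence "adj K b \<subseteq> adj K (c * b)"
          by (intro adj_least[OF K] adj_subfield[OF K alg'] adj_superset[OF K])
        hence "x ^ j' \<in> adj K (c * b)" using less.prems sf_power[OF sa] by auto
        from radical_adj_root[OF kum p cb cbp cbK this xc] show ?thesis by blast
      qed
    next
      case False
      have "coprime q p" using False q p by (simp add: primes_coprime)
      then obtain q' where q': "[q * q' = 1] (mod p)" using cong_solve_coprime_nat by auto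
      \<comment> \<open>Here p - 1 stands for -1 modulo p, so that p divides q i + j.\<close>
      define i where "i = q' * (p - 1) * j"
      have "[q * i + j = 1 * ((p - 1) * j) + j] (mod p)"
        unfolding i_def using q' by (metis cong_add_rcancel_nat cong_scalar_right mult.assoc)
      also have "1 * ((p - 1) * j) + j = p * j" using p0 by (metis add.commute mult_1 mult_Suc Suc_diff_1)
      finally have dv: "p dvd q * i + j" by (metis cong_dvd_iff dvd_triv_left)
      have "(x * b ^ i) ^ q = k * b ^ (q * i + j)"
        using kj by (simp add: power_mult_distrib power_mult[symmetric] power_add mult_ac)
      hence "(x * b ^ i) ^ q \<in> K" using dv bK kj sf_mult[OF K] by auto
      moreover have "x * b ^ i \<in> adj K b"
        using less.prems adj_self[OF K] by (intro sf_mult[OF sa] sf_power[OF sa]) auto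
      ultimately have xb: "x * b ^ i \<in> K"
        using radical_adj_other[OF kum p b q(1) q\<pi> False] by blast
      have "b ^ i * b ^ ((p - 1) * i) \<in> K"
      proof -
        have "i + (p - 1) * i = p * i" using p0 by (metis Suc_diff_1 mult_Suc)
        thus ?thesis using bK[of "p * i"] by (simp only: power_add[symmetric]) simp
      qed
      hence "x * b ^ i / (b ^ i * b ^ ((p - 1) * i)) \<in> K" using xb sf_divide[OF K] by blast
      moreover have "x = x * b ^ i / (b ^ i * b ^ ((p - 1) * i)) * b ^ ((p - 1) * i)" using b0 by simp
      ultimately show ?thesis by metis
    qed
  qed
qed

text \<open>Induction on the sum of the orders, for all base fields at once: adjoin a radical b of prime order
  and group the terms by proportionality over K(b). By the preceding lemma each group is a
  combination of distinct powers of b.\<close>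

theorem radical_independent:
  assumes "kum \<pi> K L" "finite I"
    "\<And>i. i \<in> I \<Longrightarrow> x i \<in> L" "\<And>i. i \<in> I \<Longrightarrow> x i \<noteq> 0"
    "\<And>i. i \<in> I \<Longrightarrow> pinum \<pi> (m i)" "\<And>i. i \<in> I \<Longrightarrow> x i ^ m i \<in> K"
    "\<And>i j. i \<in> I \<Longrightarrow> j \<in> I \<Longrightarrow> i \<noteq> j \<Longrightarrow> x i / x j \<notin> K"
    "\<And>i. i \<in> I \<Longrightarrow> c i \<in> K" "(\<Sum>i\<in>I. c i * x i) = 0"
  shows "\<forall>i\<in>I. c i = 0"
  using assms
proof (induction "sum m I" arbitrary: K I m c rule: less_induct)
  case less
  note kum = less.prems(1)
  have K: "is_subfield K" and L: "is_subfield L" and KL: "K \<subseteq> L" using kum unfolding kum_def by auto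
  show ?case
  proof (cases "\<forall>i\<in>I. x i \<in> K")
    case True
    hence "i = j" if "i \<in> I" "j \<in> I" for i j using less.prems(7) sf_divide[OF K] that by blast
    hence "I = {} \<or> (\<exists>i. I = {i})" by blast
    thus ?thesis using less.prems(4,9) by auto
  next
    case False
    then obtain l where l: "l \<in> I" "x l \<notin> K" by auto
    \<comment> \<open>The exact order of x l modulo K. Dividing it by a prime p yields b = x l ^ e
      outside K with b^p in K.\<close>
    define e0 where "e0 = (LEAST e. e > 0 \<and> x l ^ e \<in> K)"
    have ml: "m l > 0" "x l ^ m l \<in> K" using less.prems(5,6) l unfolding pinum_def by auto
    hence e0: "e0 > 0" "x l ^ e0 \<in> K"
      using LeastI[of "\<lambda>e. e > 0 \<and> x l ^ e \<in> K" "m l"] unfolding e0_def by auto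
    have e0_least: "e0 \<le> e" if "e > 0" "x l ^ e \<in> K" for e
      using that unfolding e0_def by (intro Least_le) auto
    have "gcd e0 (m l) \<ge> e0" using sf_pow_gcd[OF K _ e0(2) ml(2)] less.prems(4) l e0 by (intro e0_least) auto
    hence "gcd e0 (m l) = e0" using e0 by (metis gcd_le1_nat le_antisym not_gr_zero)
    hence e0m: "e0 dvd m l" by (metis gcd_dvd2)
    have "e0 \<noteq> 1" using e0 l by auto
    then obtain p where p: "prime p" "p dvd e0" using prime_factor_nat by blast
    have p\<pi>: "p \<in> \<pi>" using p e0m less.prems(5)[OF l(1)] unfolding pinum_def by (metis dvd_trans)
    obtain e where e: "e0 = p * e" using p by auto
    have ee: "e > 0" "e < e0" using e e0 prime_gt_1_nat[OF p(1)] by auto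
    define b where "b = x l ^ e"
    have b: "b \<in> L" "b ^ p \<in> K" "b \<notin> K"
      using sf_power[OF L] less.prems(3) l e e0 e0_least[of e] ee unfolding b_def
      by (auto simp: power_mult[symmetric] mult.commute)
    have b0: "b \<noteq> 0" using b sf_0[OF K] by auto
    have p0: "p > 0" using p prime_gt_0_nat by blast
    define M where "M = adj K b"
    have M: "is_subfield M" unfolding M_def
      by (intro adj_subfield[OF K] radical_alg_over[OF K b(2) p0])
    have KM: "K \<subseteq> M" and bM: "b \<in> M" unfolding M_def using adj_superset[OF K] adj_self[OF K] by auto
    have kM: "kum \<pi> M L" by (rule kum_up[OF kum M KM]) (simp add: M_def adj_sub[OF kum b(1)])
    \<comment> \<open>The condition under SOME depends only on the class of x i up to factors in M,
      so R picks one representative per class.\<close>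
    define R where "R = (\<lambda>i. SOME j. j \<in> I \<and> x i / x j \<in> M)"
    have R: "R i \<in> I" "x i / x (R i) \<in> M" if "i \<in> I" for i
    proof -
      have "i \<in> I \<and> x i / x i \<in> M" using that less.prems(4) sf_1[OF M] by auto
      hence "R i \<in> I \<and> x i / x (R i) \<in> M" unfolding R_def by (rule someI)
      thus "R i \<in> I" "x i / x (R i) \<in> M" by auto
    qed
    have Req: "R i = R j" if ij: "i \<in> I" "j \<in> I" "x i / x j \<in> M" for i j
    proof -
      have "x i / x k \<in> M \<longleftrightarrow> x j / x k \<in> M" for k
      proof -
        have nz: "x i \<noteq> 0" "x j \<noteq> 0" using ij less.prems(4) by auto
        have "x i / x k = x i / x j * (x j / x k)" using nz by simp
        thus ?thesis using ij(3) nz sf_mult[OF M] sf_mult_cancel[OF M, of "x i / x j" "x j / x k"]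
          by (metis divide_eq_0_iff)
      qed
      thus ?thesis unfolding R_def by simp
    qed
    define J where "J = R ` I"
    have J: "J \<subseteq> I" "finite J" unfolding J_def using R less.prems(2) by auto
    \<comment> \<open>Over M the exponent of x l can be lowered to e. The sum over J is smaller than
      the sum over I even if l is not a representative.\<close>
    define m' where "m' i = (if i = l then e else m i)" for i
    have RR: "R (R i) = R i" if "i \<in> I" for i using Req[of i "R i"] R that by auto
    have yrep: "\<exists>k j. k \<in> K \<and> x i / x (R i) = k * b ^ j" if "i \<in> I" for i
    proof -
      have nz: "x i \<noteq> 0" "x (R i) \<noteq> 0" using that R less.prems(4) by auto
      have "pinum \<pi> (m i * m (R i))" using pinum_mult less.prems(5) R that by auto
      moreover have "(x i / x (R i)) ^ (m i * m (R i)) \<in> K"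
      proof -
        have "(x i / x (R i)) ^ (m i * m (R i)) = (x i ^ m i) ^ m (R i) / (x (R i) ^ m (R i)) ^ m i"
          by (simp add: power_divide power_mult[symmetric] mult.commute)
        moreover have "x i ^ m i \<in> K" "x (R i) ^ m (R i) \<in> K" using less.prems(6) R that by auto
        ultimately show ?thesis using sf_divide[OF K] sf_power[OF K] by metis
      qed
      ultimately show ?thesis
        using radical_adj_key[OF kum p(1) p\<pi> b, of "x i / x (R i)" "m i * m (R i)"] R(2)[OF that] nz
        unfolding M_def by auto
    qed
    then obtain k jj where kj: "\<And>i. i \<in> I \<Longrightarrow> k i \<in> K" "\<And>i. i \<in> I \<Longrightarrow> x i / x (R i) = k i * b ^ jj i"
      by metis
    \<comment> \<open>The coefficient in M of x r after the terms of its class are collected; the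
      induction hypothesis makes it vanish.\<close>
    define d where "d r = (\<Sum>i\<in>{i\<in>I. R i = r}. c i * (x i / x r))" for r
    have dM: "d r \<in> M" for r unfolding d_def
      using less.prems(8) KM R by (intro sf_sum[OF M] sf_mult[OF M]) auto
    have "(\<Sum>r\<in>J. d r * x r) = (\<Sum>r\<in>J. \<Sum>i\<in>{i\<in>I. R i = r}. c i * x i)"
      unfolding d_def sum_distrib_right
      by (intro sum.cong refl) (use J less.prems(4) in auto)
    also have "\<dots> = (\<Sum>i\<in>I. c i * x i)"
      unfolding J_def by (rule sum.image_gen[symmetric]) (rule less.prems(2))
    finally have dsum: "(\<Sum>r\<in>J. d r * x r) = 0" using less.prems(9) by simp
    have m'pos: "pinum \<pi> (m' i)" "x i ^ m' i \<in> M" if "i \<in> I" for i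
      using that less.prems(5,6) pinum_dvd[OF less.prems(5)[OF l(1)], of e] e0m e bM KM
      unfolding m'_def b_def by (auto intro: dvd_trans)
    have "sum m' J < sum m I"
    proof -
      have "sum m' J \<le> sum m' I" by (rule sum_mono2) (use J less.prems(2) in auto)
      also have "sum m' I < sum m I"
      proof (rule sum_strict_mono_ex1[OF less.prems(2)])
        have "e < m l" using ee e0m ml by (meson dvd_imp_le le_trans not_le)
        thus "\<forall>x\<in>I. m' x \<le> m x" "\<exists>a\<in>I. m' a < m a" using l unfolding m'_def by auto
      qed
      finally show ?thesis .
    qed
    hence dz: "\<forall>r\<in>J. d r = 0"
    proof (rule less.hyps[OF _ kM J(2) _ _ _ _ _ _ dsum])
      show "x i \<in> L" "x i \<noteq> 0" "pinum \<pi> (m' i)" "x i ^ m' i \<in> M" if "i \<in> J" for i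
        using that J less.prems(3,4) m'pos by auto
      show "d i \<in> M" for i by (rule dM)
      show "x i / x j \<notin> M" if ij: "i \<in> J" "j \<in> J" "i \<noteq> j" for i j
      proof
        assume "x i / x j \<in> M"
        hence "R i = R j" using Req J ij by auto
        moreover have "R i = i" "R j = j" using ij RR unfolding J_def by auto
        ultimately show False using ij by simp
      qed
    qed
    show ?thesis
    proof
      fix i assume i: "i \<in> I"
      define r where "r = R i"
      define Ir where "Ir = {i\<in>I. R i = r}"
      have finr: "finite Ir" unfolding Ir_def using less.prems(2) by auto
      have xr: "x r \<noteq> 0" using R(1)[OF i] less.prems(4) unfolding r_def by auto
      have kj': "x a = k a * b ^ jj a * x r" "k a \<in> K" "k a \<noteq> 0" if "a \<in> Ir" for a
      proof -
        have "a \<in> I" "R a = r" using that unfolding Ir_def by auto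
        thus "x a = k a * b ^ jj a * x r" "k a \<in> K" "k a \<noteq> 0"
          using kj[of a] xr less.prems(4)[of a] by (auto simp: field_simps)
      qed
      \<comment> \<open>Equal exponents modulo p differ by a multiple of p, and b^p lies in K; two
        of the given radicals would be proportional over K.\<close>
      have jinj: "a = a'" if "a \<in> Ir" "a' \<in> Ir" "jj a mod p = jj a' mod p" for a a'
      proof (rule ccontr)
        assume "a \<noteq> a'"
        hence n: "x a / x a' \<notin> K" using less.prems(7) that unfolding Ir_def by auto
        have bm: "b ^ jj a = (b ^ p) ^ (jj a div p) * b ^ (jj a mod p)" for a
          by (simp add: power_mult[symmetric] power_add[symmetric])
        have "x a / x a' = (k a * (b ^ p) ^ (jj a div p)) / (k a' * (b ^ p) ^ (jj a' div p))"
          unfolding kj'(1)[OF that(1)] kj'(1)[OF that(2)] bm that(3) using xr b0 by simp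
        also have "\<dots> \<in> K" 
          by (intro sf_divide[OF K] sf_mult[OF K] sf_power[OF K b(2)] kj'(2) that)
        finally show False using n by simp
      qed
      \<comment> \<open>Writes d r as a polynomial in b over K of degree below p. It must be zero,
        and by \<open>jinj\<close> each of its coefficients involves a single c a.\<close>
      define g where "g = (\<Sum>a\<in>Ir. monom (c a * k a * (b ^ p) ^ (jj a div p)) (jj a mod p))"
      have gK: "polyover K g" unfolding g_def
        using less.prems(8) kj'(2) unfolding Ir_def
        by (intro po_sum[OF K] po_monom[OF K] sf_mult[OF K] sf_power[OF K b(2)]) auto
      have "coeff g n = 0" if "n > p - 1" for n
      proof -
        have "jj a mod p \<noteq> n" for a using that mod_less_divisor[OF p0, of "jj a"] by linarith
        thus ?thesis unfolding g_def coeff_sum by (intro sum.neutral) auto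
      qed
      hence "degree g \<le> p - 1" by (intro degree_le) auto
      hence dg: "degree g < p" using p0 by linarith
      have "poly g b = (\<Sum>a\<in>Ir. c a * (k a * b ^ jj a))" unfolding g_def
        by (simp add: poly_sum poly_monom mult.assoc power_mult[symmetric] power_add[symmetric])
      also have "\<dots> = (\<Sum>a\<in>Ir. c a * (x a / x r))"
        by (intro sum.cong refl) (use kj'(1) xr in auto)
      also have "\<dots> = d r" unfolding d_def Ir_def ..
      also have "\<dots> = 0" using dz i unfolding J_def r_def by auto
      finally have "poly g b = 0" .
      hence "g = 0" using radical_degree[OF kum p(1) p\<pi> b gK] dg by (metis leD)
      hence "0 = coeff g (jj i mod p)" by simp
      also have "\<dots> = (\<Sum>a\<in>Ir. if a = i then c a * k a * (b ^ p) ^ (jj a div p) else 0)"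
        unfolding g_def coeff_sum
      proof (intro sum.cong refl)
        fix a assume "a \<in> Ir"
        moreover have "i \<in> Ir" using i by (simp add: Ir_def r_def)
        ultimately have "jj a mod p = jj i mod p \<longleftrightarrow> a = i" using jinj by auto
        thus "coeff (monom (c a * k a * (b ^ p) ^ (jj a div p)) (jj a mod p)) (jj i mod p)
            = (if a = i then c a * k a * (b ^ p) ^ (jj a div p) else 0)" by simp
      qed
      also have "\<dots> = c i * k i * (b ^ p) ^ (jj i div p)"
        using finr i by (simp add: Ir_def r_def)
      finally show "c i = 0" using kj'(3)[of i] b0 i unfolding Ir_def r_def by auto
    qed
  qed
qed

end

section \<open>Small exponents in number fields\<close>

text \<open>If b is the reduced denominator of q, then b^l divides d for every l, which is
  impossible for b \<ge> 2 because d < b^d.\<close>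

lemma rat_int_of_bounded_denominators:
  fixes q :: rat
  assumes "d > 0" "\<And>l. of_int d * q ^ l \<in> \<int>"
  shows "q \<in> \<int>"
proof -
  obtain a b where ab: "quotient_of q = (a, b)" by (cases "quotient_of q")
  have b: "b > 0" "coprime a b" "q = of_int a / of_int b"
    using quotient_of_denom_pos[OF ab] quotient_of_coprime[OF ab] quotient_of_div[OF ab] by auto
  have "b ^ l \<le> d" for l
  proof -
    obtain k where "of_int d * q ^ l = (of_int k :: rat)" using assms(2)[of l] by (auto elim: Ints_cases)
    hence "of_int (d * a ^ l) = (of_int (k * b ^ l) :: rat)"
      using b by (simp add: field_simps power_divide)
    hence "d * a ^ l = k * b ^ l" by (simp only: of_int_eq_iff)
    hence "b ^ l dvd d * a ^ l" by simp
    hence "b ^ l dvd d" using b by (simp add: coprime_commute coprime_dvd_mult_left_iff)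
    thus ?thesis using assms(1) by (rule zdvd_imp_le)
  qed
  moreover have "b = 1 \<or> b \<ge> 2" using b by auto
  moreover have "d < b ^ nat d" if "b \<ge> 2"
  proof -
    have "int (nat d) < 2 ^ nat d" by (metis less_exp of_nat_less_iff of_nat_numeral of_nat_power)
    also have "\<dots> \<le> b ^ nat d" using that by (intro power_mono) auto
    finally show ?thesis using assms by simp
  qed
  ultimately have "b = 1" by (metis not_le)
  thus ?thesis using b by simp
qed

text \<open>Constants disappear under l-th roots: the powers of q / t stay below A.\<close>

lemma growth_le:
  fixes q t A :: real
  assumes "t > 0" "\<And>l. q ^ l \<le> A * t ^ l"
  shows "q \<le> t"
proof (rule ccontr)
  assume "\<not> ?thesis"
  hence "1 < q / t" using assms by simp
  then obtain n where "A < (q / t) ^ n" using real_arch_pow by blast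
  hence "A * t ^ n < q ^ n" using assms(1) by (simp add: power_divide pos_less_divide_eq)
  thus False using assms(2)[of n] by simp
qed

definition tors :: "'c::field \<Rightarrow> bool" where
  "tors x \<longleftrightarrow> (\<exists>n>0. x ^ n = 1)"

lemma tors_mult: "tors x \<Longrightarrow> tors y \<Longrightarrow> tors (x * y)"
proof -
  assume "tors x" "tors y"
  then obtain m n where "m > 0" "n > 0" "x ^ m = 1" "y ^ n = 1" unfolding tors_def by auto
  hence "m * n > 0 \<and> (x * y) ^ (m * n) = 1"
    by (simp add: power_mult_distrib power_mult) (metis power_commutes power_mult power_one mult.commute)
  thus ?thesis unfolding tors_def by blast
qed

lemma tors_power: "tors x \<Longrightarrow> tors (x ^ n)"
  unfolding tors_def by (metis power_mult mult.commute power_one)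

lemma tors_inverse: "tors x \<Longrightarrow> tors (inverse x)"
  unfolding tors_def by (auto simp: power_inverse)

text \<open>An element u of E whose m-th power is, up to a root of unity, a monomial in the c i with
  exponents small relative to m, is itself a root of unity. For finite-rank subgroups of the
  multiplicative group of E this discreteness amounts to finite generation modulo torsion.\<close>

definition disc :: "'c::field set \<Rightarrow> bool" where
  "disc E \<longleftrightarrow> (\<forall>r (c :: nat \<Rightarrow> 'c). (\<forall>i<r. c i \<in> E \<and> c i \<noteq> 0) \<longrightarrow>
     (\<exists>D::nat. \<forall>u m z e. u \<in> E \<longrightarrow> m > 0 \<longrightarrow> tors z \<longrightarrow>
        u ^ m = z * (\<Prod>i<r. c i powi e i) \<longrightarrow> (\<forall>i<r. int D * \<bar>e i\<bar> \<le> int m) \<longrightarrow> tors u))"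

section \<open>The rational numbers inside a field of characteristic zero\<close>

context closed_field0
begin

lemma of_int_0_iff: "(of_int k :: 'c) = 0 \<longleftrightarrow> k = 0"
proof
  assume a: "(of_int k :: 'c) = 0"
  hence "(of_nat (nat \<bar>k\<bar>) :: 'c) = 0" by (cases "k \<ge> 0") (auto simp: of_nat_nat)
  thus "k = 0" using char0[of "nat \<bar>k\<bar>"] by (cases "k = 0") auto
qed simp

text \<open>Characteristic zero is an assumption of the locale, not a property of the type class of
  'c; so the embedding is written out through reduced numerator and denominator.\<close>

definition rat_emb :: "rat \<Rightarrow> 'c" where
  "rat_emb q = of_int (fst (quotient_of q)) / of_int (snd (quotient_of q))"

lemma rat_emb_frac:
  assumes "b \<noteq> 0"
  shows "rat_emb (of_int a / of_int b) = of_int a / of_int b"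
proof -
  obtain n d where nd: "quotient_of (of_int a / of_int b) = (n, d)" by (cases "quotient_of (of_int a / of_int b)")
  have d: "d > 0" using quotient_of_denom_pos[OF nd] .
  have "(of_int a / of_int b :: rat) = of_int n / of_int d" using quotient_of_div[OF nd] .
  hence "(of_int (a * d) :: rat) = of_int (n * b)" using assms d by (simp add: field_simps)
  hence "a * d = n * b" by (simp only: of_int_eq_iff)
  hence "(of_int a * of_int d :: 'c) = of_int n * of_int b" by (metis of_int_mult)
  thus ?thesis unfolding rat_emb_def nd using assms d
    by (simp add: frac_eq_eq of_int_0_iff)
qed

lemma rat_fracE:
  fixes q :: rat
  obtains a b where "b \<noteq> 0" "q = of_int a / of_int b"
  by (metis quotient_of_denom_pos quotient_of_div surj_pair less_irrefl)

lemma rat_emb_int: "rat_emb (of_int a) = of_int a"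
  using rat_emb_frac[of 1 a] by simp

lemma rat_emb_add: "rat_emb (p + q) = rat_emb p + rat_emb q"
proof -
  obtain a b where p: "b \<noteq> 0" "p = of_int a / of_int b" by (rule rat_fracE)
  obtain c d where q: "d \<noteq> 0" "q = of_int c / of_int d" by (rule rat_fracE)
  have "p + q = of_int (a * d + c * b) / of_int (b * d)" using p q by (simp add: field_simps)
  hence "rat_emb (p + q) = of_int (a * d + c * b) / of_int (b * d)"
    using rat_emb_frac[of "b * d" "a * d + c * b"] p q by (simp only: mult_eq_0_iff) simp
  moreover have "rat_emb p = of_int a / of_int b" "rat_emb q = of_int c / of_int d"
    using p q rat_emb_frac by auto
  ultimately show ?thesis using p q by (simp add: add_frac_eq of_int_0_iff)
qed

lemma rat_emb_mult: "rat_emb (p * q) = rat_emb p * rat_emb q"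
proof -
  obtain a b where p: "b \<noteq> 0" "p = of_int a / of_int b" by (rule rat_fracE)
  obtain c d where q: "d \<noteq> 0" "q = of_int c / of_int d" by (rule rat_fracE)
  have "p * q = of_int (a * c) / of_int (b * d)" using p q by (simp add: field_simps)
  hence "rat_emb (p * q) = of_int (a * c) / of_int (b * d)"
    using rat_emb_frac[of "b * d" "a * c"] p q by (simp only: mult_eq_0_iff) simp
  thus ?thesis using p q by (simp add: rat_emb_frac)
qed

lemma rat_emb_0: "rat_emb 0 = 0" and rat_emb_1: "rat_emb 1 = 1"
  using rat_emb_int[of 0] rat_emb_int[of 1] by simp_all

sublocale rat_emb: field_hom rat_emb
  by unfold_locales (auto simp: rat_emb_0 rat_emb_1 rat_emb_add rat_emb_mult)

lemma range_rat_emb: "range rat_emb = subfield_gen {}"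
proof
  have S: "is_subfield (subfield_gen {} :: 'c set)" by (rule sf_gen)
  show "range rat_emb \<subseteq> subfield_gen {}"
    unfolding rat_emb_def by (auto intro!: sf_divide[OF S] sf_of_int[OF S])
  have "is_subfield (range rat_emb)"
    unfolding is_subfield_def
    by (auto simp: image_iff rat_emb.hom_add[symmetric] rat_emb.hom_mult[symmetric]
        rat_emb.hom_uminus[symmetric] rat_emb.hom_inverse[symmetric]
        intro: exI[of _ 0] exI[of _ 1] rat_emb_0[symmetric] rat_emb_1[symmetric])
  thus "subfield_gen {} \<subseteq> range rat_emb" by (rule sf_gen_least) auto
qed

end

section \<open>Number fields through the regular representation\<close>

locale rat_basis = closed_field0 ty for ty :: "'c::field itself" +
  fixes E :: "'c set" and v :: "nat \<Rightarrow> 'c" and N :: nat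
  assumes E: "is_subfield E"
    and vE: "\<And>i. i < N \<Longrightarrow> v i \<in> E"
    and span: "\<And>y. y \<in> E \<Longrightarrow> \<exists>f. y = (\<Sum>i<N. rat_emb (f i) * v i)"
    and indep: "\<And>f i. (\<Sum>i<N. rat_emb (f i) * v i) = 0 \<Longrightarrow> i < N \<Longrightarrow> f i = 0"
begin

lemma N_pos: "N > 0"
proof (rule ccontr)
  assume "\<not> ?thesis"
  thus False using span[OF sf_1[OF E]] by simp
qed

lemma coord_unique:
  assumes "(\<Sum>i<N. rat_emb (f i) * v i) = (\<Sum>i<N. rat_emb (g i) * v i)" "i < N"
  shows "f i = g i"
proof -
  have "(\<Sum>i<N. rat_emb (f i - g i) * v i) = 0"
    using assms by (simp add: rat_emb.hom_minus sum_subtractf left_diff_distrib)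
  thus ?thesis using indep[of "\<lambda>i. f i - g i"] assms(2) by simp
qed

text \<open>Row i holds the coordinates of y v i, so the column of the v i is an eigenvector of Y
  with eigenvalue y. This makes y a root of the characteristic polynomial.\<close>

definition rep :: "rat mat \<Rightarrow> 'c \<Rightarrow> bool" where
  "rep Y y \<longleftrightarrow> Y \<in> carrier_mat N N \<and> (\<forall>i<N. y * v i = (\<Sum>j<N. rat_emb (Y $$ (i, j)) * v j))"

lemma rep_ex:
  assumes "y \<in> E"
  shows "\<exists>Y. rep Y y"
proof -
  have "\<exists>f. y * v i = (\<Sum>j<N. rat_emb (f j) * v j)" if "i < N" for i
    using span[of "y * v i"] sf_mult[OF E assms vE[OF that]] by auto
  then obtain f where "\<And>i. i < N \<Longrightarrow> y * v i = (\<Sum>j<N. rat_emb (f i j) * v j)" by metis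
  thus ?thesis unfolding rep_def by (intro exI[of _ "mat N N (\<lambda>(i, j). f i j)"]) auto
qed

lemma rep_unique:
  assumes "rep X y" "rep Y y"
  shows "X = Y"
proof (rule eq_matI)
  show "dim_row X = dim_row Y" "dim_col X = dim_col Y" using assms unfolding rep_def by auto
  fix i j assume "i < dim_row Y" "j < dim_col Y"
  hence ij: "i < N" "j < N" using assms unfolding rep_def by auto
  show "X $$ (i, j) = Y $$ (i, j)"
    using coord_unique[of "\<lambda>j. X $$ (i, j)" "\<lambda>j. Y $$ (i, j)" j] assms ij unfolding rep_def by metis
qed

definition L :: "'c \<Rightarrow> rat mat" where "L y = (SOME Y. rep Y y)"

lemma L_rep: "y \<in> E \<Longrightarrow> rep (L y) y"
  unfolding L_def using rep_ex by (rule someI_ex)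

lemma L_eq: "y \<in> E \<Longrightarrow> rep Y y \<Longrightarrow> L y = Y"
  using L_rep rep_unique by blast

lemma L_carrier: "y \<in> E \<Longrightarrow> L y \<in> carrier_mat N N"
  using L_rep unfolding rep_def by blast

lemma L_mult:
  assumes "x \<in> E" "y \<in> E"
  shows "L (x * y) = L x * L y"
proof (rule L_eq)
  show "x * y \<in> E" using assms by (rule sf_mult[OF E])
  show "rep (L x * L y) (x * y)"
    unfolding rep_def
  proof safe
    show "L x * L y \<in> carrier_mat N N" using L_carrier assms by (meson mult_carrier_mat)
    fix i assume i: "i < N"
    have "x * y * v i = y * (\<Sum>j<N. rat_emb (L x $$ (i, j)) * v j)"
      using L_rep[OF assms(1)] i unfolding rep_def by (simp add: mult_ac)
    also have "\<dots> = (\<Sum>j<N. rat_emb (L x $$ (i, j)) * (y * v j))"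
      by (simp add: sum_distrib_left mult_ac)
    also have "\<dots> = (\<Sum>j<N. rat_emb (L x $$ (i, j)) * (\<Sum>k<N. rat_emb (L y $$ (j, k)) * v k))"
      using L_rep[OF assms(2)] unfolding rep_def by (intro sum.cong refl) auto
    also have "\<dots> = (\<Sum>k<N. \<Sum>j<N. rat_emb (L x $$ (i, j) * L y $$ (j, k)) * v k)"
      unfolding sum_distrib_left by (subst sum.swap) (simp add: rat_emb_mult mult_ac)
    also have "\<dots> = (\<Sum>k<N. rat_emb ((L x * L y) $$ (i, k)) * v k)"
    proof (intro sum.cong refl)
      fix k assume "k \<in> {..<N}"
      hence "(L x * L y) $$ (i, k) = (\<Sum>j<N. L x $$ (i, j) * L y $$ (j, k))"
        using i L_carrier[OF assms(1)] L_carrier[OF assms(2)]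
        by (auto simp: scalar_prod_def atLeast0LessThan intro!: sum.cong)
      thus "(\<Sum>j<N. rat_emb (L x $$ (i, j) * L y $$ (j, k)) * v k) = rat_emb ((L x * L y) $$ (i, k)) * v k"
        by (simp add: rat_emb.hom_sum sum_distrib_right)
    qed
    finally show "x * y * v i = (\<Sum>k<N. rat_emb ((L x * L y) $$ (i, k)) * v k)" .
  qed
qed

lemma L_add:
  assumes "x \<in> E" "y \<in> E"
  shows "L (x + y) = L x + L y"
proof (rule L_eq)
  show "x + y \<in> E" using assms by (rule sf_add[OF E])
  show "rep (L x + L y) (x + y)"
    using L_rep[OF assms(1)] L_rep[OF assms(2)] unfolding rep_def
    by (auto simp: rat_emb_add distrib_right sum.distrib)
qed

lemma L_int: "L (of_int k) = of_int k \<cdot>\<^sub>m 1\<^sub>m N"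
proof (rule L_eq)
  show "of_int k \<in> E" by (rule sf_of_int[OF E])
  have "(\<Sum>j<N. rat_emb ((of_int k \<cdot>\<^sub>m 1\<^sub>m N) $$ (i, j)) * v j) = of_int k * v i" if "i < N" for i
  proof -
    have "(\<Sum>j<N. rat_emb ((of_int k \<cdot>\<^sub>m 1\<^sub>m N) $$ (i, j)) * v j)
        = (\<Sum>j<N. if j = i then of_int k * v i else 0)"
      using that by (intro sum.cong refl) (auto simp: rat_emb_int rat_emb_0)
    thus ?thesis using that by simp
  qed
  thus "rep (of_int k \<cdot>\<^sub>m 1\<^sub>m N) (of_int k)" unfolding rep_def by auto
qed

definition nrm :: "'c \<Rightarrow> rat" where "nrm y = det (L y)"

text \<open>In isI and isW, I stands for integral and W for weight; the factor N makes the weight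
  submultiplicative.\<close>

definition isI :: "'c \<Rightarrow> bool" where
  "isI y \<longleftrightarrow> y \<in> E \<and> (\<forall>i<N. \<forall>j<N. L y $$ (i, j) \<in> \<int>)"

definition isW :: "'c \<Rightarrow> real \<Rightarrow> bool" where
  "isW y b \<longleftrightarrow> y \<in> E \<and> (\<forall>i<N. \<forall>j<N. real N * \<bar>real_of_rat (L y $$ (i, j))\<bar> \<le> b)"

lemma L_mult_entry:
  assumes "x \<in> E" "y \<in> E" "i < N" "j < N"
  shows "L (x * y) $$ (i, j) = (\<Sum>k<N. L x $$ (i, k) * L y $$ (k, j))"
  using assms(3,4) L_carrier[OF assms(1)] L_carrier[OF assms(2)] L_mult[OF assms(1,2)]
  by (auto simp: scalar_prod_def atLeast0LessThan intro!: sum.cong)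

lemma L_add_entry:
  assumes "x \<in> E" "y \<in> E" "i < N" "j < N"
  shows "L (x + y) $$ (i, j) = L x $$ (i, j) + L y $$ (i, j)"
  using assms(3,4) L_carrier[OF assms(1)] L_carrier[OF assms(2)] L_add[OF assms(1,2)] by auto

lemma isI_mult: "isI x \<Longrightarrow> isI y \<Longrightarrow> isI (x * y)"
  unfolding isI_def by (auto simp: L_mult_entry sf_mult[OF E] intro!: Ints_sum Ints_mult)

lemma isI_add: "isI x \<Longrightarrow> isI y \<Longrightarrow> isI (x + y)"
  unfolding isI_def by (auto simp: L_add_entry sf_add[OF E] intro!: Ints_add)

lemma isI_int: "isI (of_int k)"
  unfolding isI_def by (auto simp: L_int sf_of_int[OF E])

lemma isI_power: "isI x \<Longrightarrow> isI (x ^ n)"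
  by (induction n) (use isI_int[of 1] isI_mult in auto)

lemma isI_sum: "(\<And>i. i \<in> I \<Longrightarrow> isI (f i)) \<Longrightarrow> isI (sum f I)"
  by (induction I rule: infinite_finite_induct) (use isI_int[of 0] isI_add in auto)

lemma isW_ge0: "isW x b \<Longrightarrow> b \<ge> 0"
proof -
  assume "isW x b"
  hence "real N * \<bar>real_of_rat (L x $$ (0, 0))\<bar> \<le> b" unfolding isW_def using N_pos by blast
  moreover have "0 \<le> real N * \<bar>real_of_rat (L x $$ (0, 0))\<bar>" by simp
  ultimately show ?thesis by linarith
qed

lemma isW_mono: "isW x b \<Longrightarrow> b \<le> c \<Longrightarrow> isW x c"
  unfolding isW_def by (auto intro: order.trans)

lemma isW_mult:
  assumes "isW x b" "isW y c"
  shows "isW (x * y) (b * c)"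
proof -
  have xy: "x \<in> E" "y \<in> E" using assms unfolding isW_def by auto
  have "real N * \<bar>real_of_rat (L (x * y) $$ (i, j))\<bar> \<le> b * c" if ij: "i < N" "j < N" for i j
  proof -
    have "real N * \<bar>real_of_rat (L (x * y) $$ (i, j))\<bar>
        \<le> real N * (\<Sum>k<N. \<bar>real_of_rat (L x $$ (i, k)) * real_of_rat (L y $$ (k, j))\<bar>)"
      unfolding L_mult_entry[OF xy ij] of_rat_sum of_rat_mult
      by (intro mult_left_mono sum_abs) auto
    also have "\<dots> \<le> real N * (\<Sum>k<N. (b / N) * (c / N))"
      unfolding abs_mult using assms ij N_pos unfolding isW_def
      by (intro mult_left_mono sum_mono mult_mono) (auto simp: field_simps intro!: divide_nonneg_nonneg isW_ge0[OF assms(1)])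
    also have "\<dots> = b * c" using N_pos by simp
    finally show ?thesis .
  qed
  thus ?thesis unfolding isW_def using sf_mult[OF E xy] by auto
qed

lemma isW_add:
  assumes "isW x b" "isW y c"
  shows "isW (x + y) (b + c)"
proof -
  have xy: "x \<in> E" "y \<in> E" using assms unfolding isW_def by auto
  have "real N * \<bar>real_of_rat (L (x + y) $$ (i, j))\<bar> \<le> b + c" if ij: "i < N" "j < N" for i j
  proof -
    have "real N * \<bar>real_of_rat (L (x + y) $$ (i, j))\<bar>
       \<le> real N * (\<bar>real_of_rat (L x $$ (i, j))\<bar> + \<bar>real_of_rat (L y $$ (i, j))\<bar>)"
      unfolding L_add_entry[OF xy ij] of_rat_add by (intro mult_left_mono abs_triangle_ineq) auto
    also have "\<dots> \<le> b + c" using assms ij unfolding isW_def distrib_left by (intro add_mono) auto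
    finally show ?thesis .
  qed
  thus ?thesis unfolding isW_def using sf_add[OF E xy] by auto
qed

lemma isW_int: "isW (of_int k) (real N * \<bar>of_int k\<bar>)"
  unfolding isW_def by (auto simp: L_int sf_of_int[OF E] simp flip: of_int_abs)

text \<open>An integer factor costs only its absolute value here; treating it as a field element
  through \<open>isW_int\<close> would cost a further factor N.\<close>

lemma isW_scale:
  assumes "isW x b"
  shows "isW (of_int k * x) (\<bar>of_int k\<bar> * b)"
proof -
  have x: "x \<in> E" using assms unfolding isW_def by auto
  have "L (of_int k * x) $$ (i, j) = of_int k * L x $$ (i, j)" if ij: "i < N" "j < N" for i j
  proof -
    have "L (of_int k * x) $$ (i, j) = (\<Sum>l<N. if l = i then of_int k * L x $$ (i, j) else 0)"
      unfolding L_mult_entry[OF sf_of_int[OF E] x ij] L_int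
      using ij by (intro sum.cong refl) auto
    thus ?thesis using ij by simp
  qed
  moreover have "real N * (\<bar>real_of_int k\<bar> * \<bar>real_of_rat (L x $$ (i, j))\<bar>) \<le> \<bar>of_int k\<bar> * b"
    if "i < N" "j < N" for i j
  proof -
    have "real N * \<bar>real_of_rat (L x $$ (i, j))\<bar> \<le> b" using assms that unfolding isW_def by auto
    hence "\<bar>real_of_int k\<bar> * (real N * \<bar>real_of_rat (L x $$ (i, j))\<bar>) \<le> \<bar>of_int k\<bar> * b"
      by (rule mult_left_mono) simp
    thus ?thesis by (simp add: mult_ac)
  qed
  ultimately show ?thesis using sf_mult[OF E sf_of_int[OF E] x] unfolding isW_def
    by (auto simp: of_rat_mult abs_mult)
qed

lemma isW_sum: "finite I \<Longrightarrow> (\<And>i. i \<in> I \<Longrightarrow> isW (f i) (b i)) \<Longrightarrow> isW (sum f I) (sum b I)"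
  by (induction I rule: finite_induct) (use isW_int[of 0] isW_add in auto)

lemma isI_ex:
  assumes "x \<in> E"
  obtains k :: int where "k > 0" "isI (of_int k * x)"
proof -
  define k where "k = (\<Prod>i<N. \<Prod>j<N. snd (quotient_of (L x $$ (i, j))))"
  have pos: "snd (quotient_of q) > 0" for q :: rat using quotient_of_denom_pos' .
  have kpos: "k > 0" unfolding k_def by (intro prod_pos) (auto intro: pos)
  have "L (of_int k * x) $$ (i, j) \<in> \<int>" if ij: "i < N" "j < N" for i j
  proof -
    have "L (of_int k * x) $$ (i, j) = (\<Sum>l<N. if l = i then of_int k * L x $$ (i, j) else 0)"
      unfolding L_mult_entry[OF sf_of_int[OF E] assms ij] L_int
      using ij by (intro sum.cong refl) auto
    hence e: "L (of_int k * x) $$ (i, j) = of_int k * L x $$ (i, j)" using ij by simp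
    define q where "q = L x $$ (i, j)"
    have "snd (quotient_of q) dvd (\<Prod>j<N. snd (quotient_of (L x $$ (i, j))))"
      unfolding q_def using ij by (intro dvd_prodI) auto
    also have "\<dots> dvd k" unfolding k_def using ij
      by (intro dvd_prodI[of _ _ "\<lambda>i. \<Prod>j<N. snd (quotient_of (L x $$ (i, j)))"]) auto
    finally obtain h where h: "k = snd (quotient_of q) * h" by auto
    have "q = of_int (fst (quotient_of q)) / of_int (snd (quotient_of q))"
      by (rule quotient_of_div) simp
    hence "of_int k * q = of_int (h * fst (quotient_of q))"
      unfolding h using pos[of q] by (simp add: field_simps)
    thus ?thesis unfolding e q_def by simp
  qed
  thus ?thesis using that[OF kpos] sf_mult[OF E sf_of_int[OF E] assms] unfolding isI_def by blast
qed

lemma isI_ex_finite: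
  assumes "finite X" "X \<subseteq> E"
  obtains k :: int where "k > 0" "\<And>x. x \<in> X \<Longrightarrow> isI (of_int k * x)"
proof -
  have "\<exists>k::int. k > 0 \<and> (\<forall>x\<in>X. isI (of_int k * x))" using assms
  proof (induction X rule: finite_induct)
    case (insert x X)
    then obtain k where k: "k > 0" "\<forall>x\<in>X. isI (of_int k * x)" by auto
    obtain l where l: "l > 0" "isI (of_int l * x)" using isI_ex insert.prems by blast
    have "isI (of_int (k * l) * y)" if "y \<in> insert x X" for y
      using that isI_mult[OF isI_int[of l], of "of_int k * y"] isI_mult[OF isI_int[of k] l(2)] k
      by (auto simp: mult_ac)
    thus ?case using k l by (intro exI[of _ "k * l"]) auto
  qed (auto intro: exI[of _ 1])
  thus ?thesis using that by blast
qed

lemma isW_ex: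
  assumes "x \<in> E"
  obtains b where "isW x b"
proof -
  define S where "S = (\<lambda>(i, j). real N * \<bar>real_of_rat (L x $$ (i, j))\<bar>) ` ({..<N} \<times> {..<N})"
  have "finite S" unfolding S_def by auto
  hence "isW x (Max S)" unfolding isW_def using assms by (auto intro!: Max_ge simp: S_def)
  thus ?thesis using that by blast
qed

lemma isW_ex_finite:
  assumes "finite X" "X \<subseteq> E"
  obtains b where "b \<ge> 1" "\<And>x. x \<in> X \<Longrightarrow> isW x b"
proof -
  have "\<forall>x\<in>X. \<exists>b. isW x b" using isW_ex assms(2) by (meson subsetD)
  then obtain f where f: "\<And>x. x \<in> X \<Longrightarrow> isW x (f x)" by (auto dest!: bchoice)
  define b where "b = Max (insert 1 (f ` X))"
  have "f x \<le> b" if "x \<in> X" for x unfolding b_def using that assms by (intro Max_ge) auto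
  moreover have "1 \<le> b" unfolding b_def using assms by (intro Max_ge) auto
  ultimately show ?thesis using that[of b] f isW_mono by blast
qed

lemma nrm_mult: "x \<in> E \<Longrightarrow> y \<in> E \<Longrightarrow> nrm (x * y) = nrm x * nrm y"
  unfolding nrm_def by (simp add: L_mult det_mult[OF L_carrier L_carrier])

lemma nrm_int: "nrm (of_int k) = of_int k ^ N"
  unfolding nrm_def L_int by simp

lemma nrm_power: "x \<in> E \<Longrightarrow> nrm (x ^ n) = nrm x ^ n"
  by (induction n) (use nrm_int[of 1] in \<open>auto simp: nrm_mult sf_power[OF E]\<close>)

lemma nrm_isI: "isI x \<Longrightarrow> nrm x \<in> \<int>"
proof -
  assume x: "isI x"
  hence c: "L x \<in> carrier_mat N N" unfolding isI_def using L_carrier by auto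
  have "L x $$ (i, p i) \<in> \<int>" if "p permutes {0..<N}" "i < N" for p i
    using x that permutes_in_image[OF that(1), of i] unfolding isI_def by auto
  thus ?thesis unfolding nrm_def det_def'[OF c]
    by (intro Ints_sum Ints_mult Ints_prod) (auto simp: sign_def)
qed

lemma nrm_isW:
  assumes "isW x b"
  shows "\<bar>real_of_rat (nrm x)\<bar> \<le> fact N * b ^ N"
proof -
  have c: "L x \<in> carrier_mat N N" using assms L_carrier unfolding isW_def by auto
  have le: "\<bar>real_of_rat (L x $$ (i, j))\<bar> \<le> b" if "i < N" "j < N" for i j
  proof -
    have "1 * \<bar>real_of_rat (L x $$ (i, j))\<bar> \<le> real N * \<bar>real_of_rat (L x $$ (i, j))\<bar>"
      using N_pos by (intro mult_right_mono) auto
    thus ?thesis using assms that unfolding isW_def by fastforce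
  qed
  have "\<bar>real_of_rat (nrm x)\<bar> \<le> (\<Sum>p\<in>{p. p permutes {0..<N}}.
      \<bar>real_of_rat (signof p * (\<Prod>i = 0..<N. L x $$ (i, p i)))\<bar>)"
    unfolding nrm_def det_def'[OF c] of_rat_sum by (rule sum_abs)
  also have "\<dots> \<le> (\<Sum>p\<in>{p. p permutes {0..<N}}. b ^ N)"
  proof (intro sum_mono)
    fix p assume "p \<in> {p. p permutes {0..<N}}"
    hence p: "p permutes {0..<N}" by simp
    have "\<bar>real_of_rat (signof p * (\<Prod>i = 0..<N. L x $$ (i, p i)))\<bar>
        = (\<Prod>i = 0..<N. \<bar>real_of_rat (L x $$ (i, p i))\<bar>)"
      by (simp add: sign_def of_rat_mult of_rat_prod abs_mult abs_prod)
    also have "\<dots> \<le> (\<Prod>i = 0..<N. b)"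
    proof (intro prod_mono conjI abs_ge_zero)
      fix i assume "i \<in> {0..<N}"
      thus "\<bar>real_of_rat (L x $$ (i, p i))\<bar> \<le> b" using permutes_in_image[OF p, of i] by (intro le) auto
    qed
    finally show "\<bar>real_of_rat (signof p * (\<Prod>i = 0..<N. L x $$ (i, p i)))\<bar> \<le> b ^ N" by simp
  qed
  also have "\<dots> = fact N * b ^ N" by (simp add: card_permutations)
  finally show ?thesis .
qed

text \<open>The values of the characteristic polynomial at integers are norms, hence open to
  estimates; this is how a bound on powers of y leads to a finite set containing y.\<close>

lemma char_poly_nrm:
  assumes "y \<in> E"
  obtains \<chi> :: "rat poly" where "degree \<chi> = N" "lead_coeff \<chi> = 1"
    "\<And>k. poly \<chi> (of_int k) = nrm (of_int k - y)" "poly (map_poly rat_emb \<chi>) y = 0"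
proof -
  have c: "L y \<in> carrier_mat N N" using assms by (rule L_carrier)
  let ?\<chi> = "char_poly (L y)"
  have ky: "of_int k - y = of_int k + of_int (-1) * y" for k :: int by simp
  have "poly ?\<chi> (of_int k) = nrm (of_int k - y)" for k
  proof -
    have my: "of_int (-1) * y \<in> E" using sf_mult[OF E sf_of_int[OF E] assms] .
    have "L (of_int k - y) = of_int k \<cdot>\<^sub>m 1\<^sub>m N + (of_int (-1) \<cdot>\<^sub>m 1\<^sub>m N) * L y"
      unfolding ky by (subst L_add) (use my assms sf_of_int[OF E] in \<open>auto simp del: of_int_minus simp: L_mult L_int\<close>)
    also have "(of_int (-1) \<cdot>\<^sub>m 1\<^sub>m N) * L y = (- 1) \<cdot>\<^sub>m L y"
      using c by (simp add: mult_smult_assoc_mat[of _ N N _ N])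
    finally have e: "L (of_int k - y) = of_int k \<cdot>\<^sub>m 1\<^sub>m N + (- 1) \<cdot>\<^sub>m L y" .
    have "poly ?\<chi> (of_int k) = det (- char_matrix (L y) (of_int k))"
      by (rule char_poly_matrix[OF c])
    also have "- char_matrix (L y) (of_int k) = L (of_int k - y)"
      unfolding e char_matrix_def using c by (intro eq_matI) auto
    finally show ?thesis unfolding nrm_def .
  qed
  moreover have "poly (map_poly rat_emb ?\<chi>) y = 0"
  proof -
    have c': "map_mat rat_emb (L y) \<in> carrier_mat N N" using c by simp
    define w where "w = vec N v"
    have "\<exists>i<N. v i \<noteq> 0"
    proof (rule ccontr)
      assume "\<not> ?thesis"
      thus False using span[OF sf_1[OF E]] by simp
    qed
    hence w0: "w \<noteq> 0\<^sub>v N" unfolding w_def by (metis index_vec index_zero_vec(1))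
    have "map_mat rat_emb (L y) *\<^sub>v w = y \<cdot>\<^sub>v w"
    proof (rule eq_vecI)
      fix i assume "i < dim_vec (y \<cdot>\<^sub>v w)"
      hence i: "i < N" unfolding w_def by simp
      have "(map_mat rat_emb (L y) *\<^sub>v w) $ i = (\<Sum>j<N. rat_emb (L y $$ (i, j)) * v j)"
        using i c unfolding w_def by (auto simp: scalar_prod_def atLeast0LessThan intro!: sum.cong)
      also have "\<dots> = y * v i" using L_rep[OF assms] i unfolding rep_def by simp
      finally show "(map_mat rat_emb (L y) *\<^sub>v w) $ i = (y \<cdot>\<^sub>v w) $ i" using i unfolding w_def by simp
    qed (use c in \<open>auto simp: w_def\<close>)
    hence "eigenvalue (map_mat rat_emb (L y)) y"
      unfolding eigenvalue_def eigenvector_def using w0 c by (intro exI[of _ w]) (auto simp: w_def)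
    hence "poly (char_poly (map_mat rat_emb (L y))) y = 0" using eigenvalue_root_char_poly[OF c'] by simp
    thus ?thesis using rat_emb.char_poly_hom[OF c] by simp
  qed
  ultimately show ?thesis using that[of ?\<chi>] degree_monic_char_poly[OF c] by simp
qed

end

section \<open>Finiteness and discreteness in number fields\<close>

context rat_basis
begin

text \<open>The dependence on h is purely exponential: (M^r)^h for denominators and (b^r)^h for
  weights. The remaining factor N^(r+1) stems from the weight N of the element 1 and does not grow
  with h.\<close>

lemma monomial_bounds:
  assumes c: "\<And>i. i < r \<Longrightarrow> isI (of_int M * c i) \<and> isI (of_int M * inverse (c i))"
    "\<And>i. i < r \<Longrightarrow> isW (c i) b \<and> isW (inverse (c i)) b" "b \<ge> 1"
    and f: "\<And>i. i < r \<Longrightarrow> \<bar>f i\<bar> \<le> int h"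
  shows "isI (of_int (M ^ (h * r)) * (\<Prod>i<r. c i powi f i)) \<and> isW (\<Prod>i<r. c i powi f i) (real N * (real N * b ^ h) ^ r)"
  using c(1,2) f
proof (induction r)
  case 0
  thus ?case using isI_int[of 1] isW_int[of 1] by simp
next
  case (Suc r)
  define x where "x = (if f r \<ge> 0 then c r else inverse (c r))"
  define n where "n = nat \<bar>f r\<bar>"
  have xn: "c r powi f r = x ^ n" unfolding x_def n_def power_int_def by (simp add: power_inverse)
  have nh: "n \<le> h" unfolding n_def using Suc.prems(3)[of r] by simp
  have x: "isI (of_int M * x)" "isW x b" using Suc.prems(1,2)[of r] unfolding x_def by auto
  have I: "isI (of_int (M ^ h) * x ^ n)"
  proof -
    have "of_int (M ^ h) * x ^ n = of_int (M ^ (h - n)) * (of_int M * x) ^ n"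
      using nh by (simp add: power_mult_distrib power_add[symmetric] mult.assoc[symmetric])
    thus ?thesis using isI_mult[OF isI_int isI_power[OF x(1)]] by metis
  qed
  have "isW (x ^ n) (real N * b ^ n)"
  proof (induction n)
    case 0 thus ?case using isW_int[of 1] by simp
  next
    case (Suc n)
    thus ?case using isW_mult[OF x(2) Suc] by (simp add: mult_ac)
  qed
  hence W: "isW (x ^ n) (real N * b ^ h)"
    by (rule isW_mono) (use assms(3) nh in \<open>auto intro!: mult_left_mono power_increasing\<close>)
  have IH: "isI (of_int (M ^ (h * r)) * (\<Prod>i<r. c i powi f i))" "isW (\<Prod>i<r. c i powi f i) (real N * (real N * b ^ h) ^ r)"
    using Suc.IH Suc.prems by auto
  have "of_int (M ^ (h * Suc r)) * (\<Prod>i<Suc r. c i powi f i)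
      = (of_int (M ^ (h * r)) * (\<Prod>i<r. c i powi f i)) * (of_int (M ^ h) * x ^ n)"
    by (simp add: xn power_add mult_ac)
  hence "isI (of_int (M ^ (h * Suc r)) * (\<Prod>i<Suc r. c i powi f i))"
    using isI_mult[OF IH(1) I] by metis
  moreover have "isW (\<Prod>i<Suc r. c i powi f i) (real N * (real N * b ^ h) ^ Suc r)"
    using isW_mult[OF IH(2) W] by (simp add: xn mult_ac)
  ultimately show ?case by blast
qed

text \<open>If the powers of y have bounded denominators and grow like T^l, then the values of the
  characteristic polynomial of y at natural numbers are integers of bounded size: taking l-th roots
  removes all constants.\<close>

lemma nrm_shift:
  assumes y: "y \<in> E" and d: "d > 0" "\<And>l. isI (of_int d * y ^ l)" and T: "T \<ge> 1" "\<And>l. isW (y ^ l) (C * T ^ l)"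
  shows "nrm (of_int (int k) - y) \<in> \<int> \<and> \<bar>real_of_rat (nrm (of_int (int k) - y))\<bar> \<le> (real k + T) ^ N"
proof -
  define z where "z = of_int (int k) - y"
  have z: "z \<in> E" unfolding z_def using sf_diff[OF E sf_of_int[OF E] y] .
  define co where "co l i = (int (l choose i) * (-1) ^ i * int k ^ (l - i))" for l i
  have zl: "z ^ l = (\<Sum>i\<le>l. of_int (co l i) * y ^ i)" for l
  proof -
    have "z ^ l = (- y + of_int (int k)) ^ l" unfolding z_def by simp
    also have "\<dots> = (\<Sum>i\<le>l. of_nat (l choose i) * (- y) ^ i * of_int (int k) ^ (l - i))"
      by (rule binomial_ring)
    also have "\<dots> = (\<Sum>i\<le>l. of_int (co l i) * y ^ i)"
      by (intro sum.cong refl) (simp add: co_def power_minus[of y] mult_ac)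
    finally show ?thesis .
  qed
  have I: "isI (of_int d * z ^ l)" for l
  proof -
    have "of_int d * z ^ l = (\<Sum>i\<le>l. of_int (co l i) * (of_int d * y ^ i))"
      unfolding zl by (simp add: sum_distrib_left mult_ac)
    thus ?thesis using isI_sum[of "{..l}"] isI_mult[OF isI_int d(2)] by simp
  qed
  have W: "isW (z ^ l) (C * (real k + T) ^ l)" for l
  proof -
    have "isW (z ^ l) (\<Sum>i\<le>l. \<bar>of_int (co l i)\<bar> * (C * T ^ i))"
      unfolding zl by (intro isW_sum isW_scale T) auto
    also have "(\<Sum>i\<le>l. \<bar>of_int (co l i)\<bar> * (C * T ^ i)) = C * (T + real k) ^ l"
      unfolding binomial_ring sum_distrib_left
      by (intro sum.cong refl) (simp add: co_def abs_mult power_abs mult_ac)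
    finally show ?thesis by (simp add: add.commute)
  qed
  have "nrm z \<in> \<int>"
  proof (rule rat_int_of_bounded_denominators)
    show "d ^ N > 0" using d by simp
    fix l
    have "nrm (of_int d * z ^ l) = of_int (d ^ N) * nrm z ^ l"
      using nrm_mult[OF sf_of_int[OF E] sf_power[OF E z]] nrm_int nrm_power[OF z] by simp
    thus "of_int (d ^ N) * nrm z ^ l \<in> \<int>" using nrm_isI[OF I] by metis
  qed
  moreover have "\<bar>real_of_rat (nrm z)\<bar> \<le> (real k + T) ^ N"
  proof (rule growth_le)
    show "(real k + T) ^ N > 0" using T by simp
    fix l
    have "\<bar>real_of_rat (nrm z)\<bar> ^ l = \<bar>real_of_rat (nrm (z ^ l))\<bar>"
      using nrm_power[OF z] by (simp add: of_rat_power power_abs)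
    also have "\<dots> \<le> fact N * (C * (real k + T) ^ l) ^ N" by (rule nrm_isW[OF W])
    also have "\<dots> = fact N * C ^ N * ((real k + T) ^ N) ^ l"
      by (simp add: power_mult_distrib power_mult[symmetric] mult.commute)
    finally show "\<bar>real_of_rat (nrm z)\<bar> ^ l \<le> fact N * C ^ N * ((real k + T) ^ N) ^ l" .
  qed
  ultimately show ?thesis unfolding z_def by blast
qed

text \<open>A polynomial of degree N is determined by its values at 0, ..., N, and each of these is
  one of finitely many integers.\<close>

lemma finite_monic_bounded:
  "finite {\<chi> :: rat poly. degree \<chi> = N \<and> lead_coeff \<chi> = 1 \<and>
      (\<forall>k\<le>N. poly \<chi> (of_nat k) \<in> \<int> \<and> \<bar>real_of_rat (poly \<chi> (of_nat k))\<bar> \<le> T)}" (is "finite ?A")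
proof -
  let ?V = "(of_int :: int \<Rightarrow> rat) ` {- \<lfloor>T\<rfloor>..\<lfloor>T\<rfloor>}"
  let ?f = "\<lambda>\<chi> :: rat poly. map (\<lambda>k. poly \<chi> (of_nat k)) [0..<Suc N]"
  have "?f ` ?A \<subseteq> {xs. set xs \<subseteq> ?V \<and> length xs = Suc N}"
  proof safe
    fix \<chi> :: "rat poly" and x
    assume a: "\<forall>k\<le>degree \<chi>. poly \<chi> (of_nat k) \<in> \<int> \<and> \<bar>real_of_rat (poly \<chi> (of_nat k))\<bar> \<le> T"
      "N = degree \<chi>" "x \<in> set (map (\<lambda>k. poly \<chi> (of_nat k)) [0..<Suc (degree \<chi>)])"
    have "\<exists>k\<le>degree \<chi>. x = poly \<chi> (of_nat k)" using a(3) by (force simp del: upt_Suc simp: less_Suc_eq_le)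
    then obtain k where k: "k \<le> degree \<chi>" "x = poly \<chi> (of_nat k)" by auto
    have "x \<in> \<int>" "\<bar>real_of_rat x\<bar> \<le> T" using a(1) k by auto
    then obtain j where j: "x = of_int j" "\<bar>real_of_rat x\<bar> \<le> T" by (metis Ints_cases)
    hence "\<bar>real_of_int j\<bar> \<le> T" by simp
    hence "j \<in> {- \<lfloor>T\<rfloor>..\<lfloor>T\<rfloor>}" by (auto simp: abs_le_iff le_floor_iff) linarith
    thus "x \<in> ?V" using j by auto
  qed auto
  moreover have "finite {xs. set xs \<subseteq> ?V \<and> length xs = Suc N}" by (rule finite_lists_length_eq) auto
  ultimately have "finite (?f ` ?A)" by (rule finite_subset)
  moreover have "inj_on ?f ?A"
  proof (rule inj_onI)
    fix p q assume pq: "p \<in> ?A" "q \<in> ?A" "?f p = ?f q"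
    have e: "poly p (of_nat k) = poly q (of_nat k)" if "k \<le> N" for k
      using arg_cong[OF pq(3), of "\<lambda>xs. xs ! k"] that by (simp del: upt_Suc)
    show "p = q"
    proof (rule poly_eqI_degree[of "of_nat ` {..N}"])
      show "\<And>x. x \<in> of_nat ` {..N} \<Longrightarrow> poly p x = poly q x" using e by auto
      have "card ((of_nat :: nat \<Rightarrow> rat) ` {..N}) = Suc N" by (subst card_image) (auto simp: inj_on_def)
      thus "degree p < card ((of_nat :: nat \<Rightarrow> rat) ` {..N})" "degree q < card ((of_nat :: nat \<Rightarrow> rat) ` {..N})"
        using pq by auto
    qed
  qed
  ultimately show ?thesis by (rule finite_imageD)
qed

text \<open>The bound D may depend on the c i only. All M^r u^j with j \<le> D lie in one finite set
  Y determined by the c i; with D = card Y, two of these D + 1 elements coincide, and u is a root of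
  unity.\<close>

theorem disc_number_field: "disc E"
  unfolding disc_def
proof (intro allI impI)
  fix r and c :: "nat \<Rightarrow> 'c"
  assume c: "\<forall>i<r. c i \<in> E \<and> c i \<noteq> 0"
  define X where "X = c ` {..<r} \<union> (\<lambda>i. inverse (c i)) ` {..<r}"
  have X: "finite X" "X \<subseteq> E" unfolding X_def using c sf_inverse[OF E] by auto
  obtain M :: int where M: "M > 0" "\<And>x. x \<in> X \<Longrightarrow> isI (of_int M * x)" using isI_ex_finite[OF X] by blast
  obtain b where b: "b \<ge> 1" "\<And>x. x \<in> X \<Longrightarrow> isW x b" using isW_ex_finite[OF X] by blast
  \<comment> \<open>Per unit of exponent, each of the r factors contributes at most b to the weight
    and one factor M to clear its denominator.\<close>
  define T where "T = (real_of_int M * b) ^ r"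
  have M1: "real_of_int M \<ge> 1" using M by linarith
  have T: "T \<ge> 1" unfolding T_def using mult_mono[OF M1 b(1)] M1 b by (intro one_le_power) auto
  define Q where "Q = {\<chi> :: rat poly. degree \<chi> = N \<and> lead_coeff \<chi> = 1 \<and>
      (\<forall>k\<le>N. poly \<chi> (of_nat k) \<in> \<int> \<and> \<bar>real_of_rat (poly \<chi> (of_nat k))\<bar> \<le> (real N + T) ^ N)}"
  define Y where "Y = (\<Union>\<chi>\<in>Q. {y. poly (map_poly rat_emb \<chi>) y = 0})"
  have finY: "finite Y" unfolding Y_def
  proof (intro finite_UN_I poly_roots_finite)
    show "finite Q" unfolding Q_def by (rule finite_monic_bounded)
    fix \<chi> assume "\<chi> \<in> Q"
    hence "\<chi> \<noteq> 0" unfolding Q_def by auto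
    thus "map_poly rat_emb \<chi> \<noteq> 0" by simp
  qed
  define D where "D = card Y"
  show "\<exists>D::nat. \<forall>u m z e. u \<in> E \<longrightarrow> m > 0 \<longrightarrow> tors z \<longrightarrow>
        u ^ m = z * (\<Prod>i<r. c i powi e i) \<longrightarrow> (\<forall>i<r. int D * \<bar>e i\<bar> \<le> int m) \<longrightarrow> tors u"
  proof (intro exI allI impI)
    fix u m z e
    assume u: "u \<in> E" and m: "m > (0::nat)" and z: "tors z" and eq: "u ^ m = z * (\<Prod>i<r. c i powi e i)"
      and small: "\<forall>i<r. int D * \<bar>e i\<bar> \<le> int m"
    obtain t where t: "t > 0" "z ^ t = 1" using z unfolding tors_def by auto
    have z0: "z \<noteq> 0" using t by (metis power_0_left zero_neq_one not_gr_zero)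
    have P0: "(\<Prod>i<r. c i powi e i) \<noteq> 0" "(\<Prod>i<r. c i powi e i) \<in> E"
      using c by (auto intro!: sf_prod[OF E] sf_power_int[OF E])
    have u0: "u \<noteq> 0" using eq z0 P0 m by (metis mult_eq_0_iff power_0_left not_gr_zero)
    have "z = u ^ m / (\<Prod>i<r. c i powi e i)" using eq P0 by simp
    hence zE: "z \<in> E" using sf_divide[OF E sf_power[OF E u] P0(2)] by simp
    have inY: "of_int M ^ r * u ^ j \<in> Y" if j: "j \<le> D" for j
    proof -
      define x where "x = u ^ j"
      define y where "y = of_int (M ^ r) * x"
      have x: "x \<in> E" unfolding x_def using u by (rule sf_power[OF E])
      have y: "y \<in> E" unfolding y_def using x by (intro sf_mult[OF E] sf_of_int[OF E])
      \<comment> \<open>The powers of z and the first m powers of y form finite sets. They affect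
        only the constants d and C, which may depend on u because \<open>nrm_shift\<close> removes
        them.\<close>
      define Z where "Z = (\<lambda>i. z ^ i) ` {..<t}"
      have Z: "finite Z" "Z \<subseteq> E" unfolding Z_def using sf_power[OF E zE] by auto
      have zZ: "z ^ i \<in> Z" for i
      proof -
        have "z ^ i = z ^ (t * (i div t) + i mod t)" by simp
        also have "\<dots> = z ^ (i mod t)" unfolding power_add power_mult t(2) by simp
        finally show ?thesis unfolding Z_def using t by auto
      qed
      define U where "U = (\<lambda>i. y ^ i) ` {..<m}"
      have U: "finite U" "U \<subseteq> E" unfolding U_def using sf_power[OF E y] by auto
      obtain k0 :: int where k0: "k0 > 0" "\<And>x. x \<in> Z \<Longrightarrow> isI (of_int k0 * x)" using isI_ex_finite[OF Z] by blast
      obtain b0 where b0: "b0 \<ge> 1" "\<And>x. x \<in> Z \<Longrightarrow> isW x b0" using isW_ex_finite[OF Z] by blast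
      obtain k1 :: int where k1: "k1 > 0" "\<And>x. x \<in> U \<Longrightarrow> isI (of_int k1 * x)" using isI_ex_finite[OF U] by blast
      obtain b1 where b1: "b1 \<ge> 1" "\<And>x. x \<in> U \<Longrightarrow> isW x b1" using isW_ex_finite[OF U] by blast
      define d where "d = k0 * k1"
      define C where "C = b0 * b1 * real N ^ Suc r"
      have yl: "isI (of_int d * y ^ l) \<and> isW (y ^ l) (C * T ^ l)" for l
      proof -
        define n where "n = l div m"
        define i where "i = l mod m"
        define h where "h = m * n"
        have l: "l = h + i" unfolding h_def n_def i_def by simp
        have im: "i < m" unfolding i_def using m by simp
        define f where "f q = int (j * n) * e q" for q
        define G where "G = (\<Prod>q<r. c q powi f q)"
        \<comment> \<open>Smallness of the exponents enters here: for every j \<le> D, the power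
          y^(m n) involves the c q with exponents at most m n.\<close>
        have fh: "\<bar>f q\<bar> \<le> int h" if "q < r" for q
        proof -
          have "int j * \<bar>e q\<bar> \<le> int D * \<bar>e q\<bar>" using j by (intro mult_right_mono) auto
          also have "\<dots> \<le> int m" using small that by auto
          finally have "int n * (int j * \<bar>e q\<bar>) \<le> int n * int m" by (intro mult_left_mono) auto
          thus ?thesis unfolding f_def h_def by (simp add: abs_mult mult_ac)
        qed
        have G: "isI (of_int (M ^ (h * r)) * G)" "isW G (real N * (real N * b ^ h) ^ r)"
          using monomial_bounds[of r M c b f h] M b fh unfolding G_def X_def by auto
        have "u ^ (m * (j * n)) = z ^ (j * n) * G"
        proof -
          have "u ^ (m * (j * n)) = z ^ (j * n) * (\<Prod>q<r. (c q powi e q) ^ (j * n))"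
            unfolding power_mult eq by (simp add: power_mult_distrib prod_power_distrib)
          also have "(\<Prod>q<r. (c q powi e q) ^ (j * n)) = G" unfolding G_def f_def
            by (intro prod.cong refl) (simp only: power_int_mult power_int_of_nat mult.commute[of "int (j * n)"])
          finally show ?thesis .
        qed
        hence xh: "x ^ h = z ^ (j * n) * G" unfolding x_def h_def by (simp add: power_mult[symmetric] mult_ac)
        have yl: "y ^ l = z ^ (j * n) * (of_int (M ^ (h * r)) * G) * y ^ i"
          unfolding l power_add
          by (simp add: y_def power_mult_distrib xh power_mult[symmetric] mult_ac)
        have "of_int d * y ^ l = (of_int k0 * z ^ (j * n)) * (of_int (M ^ (h * r)) * G) * (of_int k1 * y ^ i)"
          unfolding yl d_def by (simp add: mult_ac)
        moreover have "isI \<dots>" using zZ im by (intro isI_mult G k0 k1) (auto simp: U_def)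
        moreover have "isW (y ^ l) (b0 * (\<bar>of_int (M ^ (h * r))\<bar> * (real N * (real N * b ^ h) ^ r)) * b1)"
          unfolding yl using zZ im by (intro isW_mult isW_scale G b0 b1) (auto simp: U_def)
        moreover have "b0 * (\<bar>of_int (M ^ (h * r))\<bar> * (real N * (real N * b ^ h) ^ r)) * b1 = C * T ^ h"
          using M unfolding C_def T_def
          by (simp add: power_mult_distrib power_mult[symmetric] mult_ac power_abs)
        moreover have "C * T ^ h \<le> C * T ^ l" using T b0 b1 unfolding l C_def
          by (intro mult_left_mono power_increasing) auto
        ultimately show ?thesis using isW_mono by metis
      qed
      have dpos: "d > 0" unfolding d_def using k0 k1 by simp
      note shift = nrm_shift[OF y dpos _ T, of C]
      obtain \<chi> where \<chi>: "degree \<chi> = N" "lead_coeff \<chi> = 1"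
        "\<And>k. poly \<chi> (of_int k) = nrm (of_int k - y)" "poly (map_poly rat_emb \<chi>) y = 0"
        using char_poly_nrm[OF y] by blast
      have "poly \<chi> (of_nat k) \<in> \<int> \<and> \<bar>real_of_rat (poly \<chi> (of_nat k))\<bar> \<le> (real N + T) ^ N" if "k \<le> N" for k
      proof -
        have "poly \<chi> (of_nat k) = nrm (of_int (int k) - y)" using \<chi>(3)[of "int k"] by simp
        moreover have "(real k + T) ^ N \<le> (real N + T) ^ N" using that T by (intro power_mono) auto
        ultimately show ?thesis using shift[of k] yl by fastforce
      qed
      hence "\<chi> \<in> Q" unfolding Q_def using \<chi> by auto
      thus ?thesis unfolding Y_def using \<chi>(4) by (auto simp: y_def x_def)
    qed
    \<comment> \<open>Pigeonhole: D + 1 exponents, but only D elements in Y.\<close>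
    have "\<not> inj_on (\<lambda>j. of_int M ^ r * u ^ j) {..D}"
    proof
      assume "inj_on (\<lambda>j. of_int M ^ r * u ^ j) {..D}"
      hence "card {..D} \<le> card Y" using inY finY by (intro card_inj_on_le) auto
      thus False unfolding D_def by simp
    qed
    then obtain i j where ij: "i \<noteq> j" "of_int M ^ r * u ^ i = of_int M ^ r * u ^ j"
      by (auto simp: inj_on_def)
    have "(of_int M ^ r :: 'c) \<noteq> 0" using M(1) of_int_0_iff[of M] by simp
    hence uij: "u ^ i = u ^ j" using ij(2) by (metis mult_left_cancel)
    have "\<exists>n>0. u ^ n = 1" if "a < b'" "u ^ a = u ^ b'" for a b'
    proof -
      have "u ^ a * u ^ (b' - a) = u ^ a * 1"
        using that by (metis le_add_diff_inverse less_imp_le mult_1_right power_add)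
      hence "u ^ (b' - a) = 1" using u0 by simp
      thus ?thesis using that by (intro exI[of _ "b' - a"]) auto
    qed
    thus "tors u" unfolding tors_def using ij(1) uij by (metis nat_neq_iff)
  qed
qed

end

section \<open>Small exponents in finitely generated fields\<close>

definition indepK :: "'c::field set \<Rightarrow> 'c set \<Rightarrow> bool" where
  "indepK K S \<longleftrightarrow> finite S \<and> (\<forall>k. (\<forall>s. k s \<in> K) \<longrightarrow> (\<Sum>s\<in>S. k s * s) = 0 \<longrightarrow> (\<forall>s\<in>S. k s = 0))"

lemma indepKD: "indepK K S \<Longrightarrow> \<forall>s. k s \<in> K \<Longrightarrow> (\<Sum>s\<in>S. k s * s) = 0 \<Longrightarrow> s \<in> S \<Longrightarrow> k s = 0"
  unfolding indepK_def by auto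

lemma max_indep_spans:
  assumes K: "is_subfield K" and bound: "\<And>S. S \<subseteq> W \<Longrightarrow> indepK K S \<Longrightarrow> card S \<le> n"
  obtains S where "S \<subseteq> W" "indepK K S" "W \<subseteq> kspan K S"
proof -
  have e: "{} \<subseteq> W \<and> indepK K {}" unfolding indepK_def by auto
  have "\<forall>S. S \<subseteq> W \<and> indepK K S \<longrightarrow> card S < Suc n" using bound by (auto simp: less_Suc_eq_le)
  from ex_has_greatest_nat[of "\<lambda>S. S \<subseteq> W \<and> indepK K S", OF e this]
  obtain S where S: "S \<subseteq> W \<and> indepK K S" "\<And>S'. S' \<subseteq> W \<and> indepK K S' \<Longrightarrow> card S' \<le> card S"
    by blast
  have finS: "finite S" using S unfolding indepK_def by auto
  have "y \<in> kspan K S" if y: "y \<in> W" for y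
  proof (rule ccontr)
    assume ny: "y \<notin> kspan K S"
    hence yS: "y \<notin> S" using kspan_base[OF K finS] by auto
    have "indepK K (insert y S)" unfolding indepK_def
    proof (intro conjI allI impI)
      show "finite (insert y S)" using finS by simp
      fix k assume k: "\<forall>s. k s \<in> K" "(\<Sum>s\<in>insert y S. k s * s) = 0"
      hence eq: "k y * y + (\<Sum>s\<in>S. k s * s) = 0" using finS yS by simp
      have ky: "k y = 0"
      proof (rule ccontr)
        assume ky: "k y \<noteq> 0"
        have "y = (- inverse (k y)) * (\<Sum>s\<in>S. k s * s)" using eq ky by (simp add: field_simps add_eq_0_iff)
        moreover have "(\<Sum>s\<in>S. k s * s) \<in> kspan K S" using k by (intro kspanI[OF K refl]) auto
        ultimately have "y \<in> kspan K S"
          using kspan_scale[OF K sf_minus[OF K sf_inverse[OF K]]] k by metis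
        thus False using ny by simp
      qed
      hence "\<forall>s\<in>S. k s = 0" using S(1) eq k unfolding indepK_def by simp
      thus "\<forall>s\<in>insert y S. k s = 0" using ky by simp
    qed
    hence "card (insert y S) \<le> card S" using S y by auto
    thus False using finS yS by simp
  qed
  thus ?thesis using that S by blast
qed

lemma alg_over_base: "is_subfield K \<Longrightarrow> y \<in> K \<Longrightarrow> alg_over K y"
  unfolding alg_over_def by (intro exI[of _ "[:- y, 1:]"]) (simp add: po_pCons po_0 sf_minus sf_1)

lemma alg_over_mono: "is_subfield K \<Longrightarrow> is_subfield M \<Longrightarrow> K \<subseteq> M \<Longrightarrow> alg_over K y \<Longrightarrow> alg_over M y"
  unfolding alg_over_def using po_mono by blast

lemma finext_of_algebraic:
  assumes K: "is_subfield K" and "finite X" "\<And>x. x \<in> X \<Longrightarrow> alg_over K x"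
  obtains M where "finext K M" "X \<subseteq> M"
proof -
  have "\<exists>M. finext K M \<and> X \<subseteq> M" using assms(2,3)
  proof (induction X rule: finite_induct)
    case empty
    thus ?case using finext_refl[OF K] by auto
  next
    case (insert x X)
    then obtain M where M: "finext K M" "X \<subseteq> M" by auto
    have sM: "is_subfield M" "K \<subseteq> M" using M unfolding finext_def by auto
    have "finext M (adj M x)"
      using insert.prems by (intro finext_adj[OF sM(1)] alg_over_mono[OF K sM]) auto
    hence "finext K (adj M x)" using M finext_trans by blast
    thus ?case using M adj_superset[OF sM(1), of x] adj_self[OF sM(1), of x] by blast
  qed
  thus ?thesis using that by blast
qed

lemma alg_closure_subfield:
  assumes K: "is_subfield K" and E: "is_subfield E" "K \<subseteq> E"
  shows "is_subfield {y \<in> E. alg_over K y}"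
proof (rule sf_of_algebraic[OF K])
  show "K \<subseteq> {y \<in> E. alg_over K y}" using alg_over_base[OF K] E by auto
  have "x + y \<in> {y \<in> E. alg_over K y} \<and> x * y \<in> {y \<in> E. alg_over K y}"
    if xy: "x \<in> {y \<in> E. alg_over K y}" "y \<in> {y \<in> E. alg_over K y}" for x y
  proof -
    obtain M where M: "finext K M" "{x, y} \<subseteq> M"
      by (rule finext_of_algebraic[OF K, of "{x, y}"]) (use xy in auto)
    hence sM: "is_subfield M" unfolding finext_def by auto
    show ?thesis using M xy finext_alg[OF M(1)] sf_add[OF sM] sf_mult[OF sM] sf_add[OF E(1)] sf_mult[OF E(1)] by auto
  qed
  thus "\<And>x y. x \<in> {y \<in> E. alg_over K y} \<Longrightarrow> y \<in> {y \<in> E. alg_over K y} \<Longrightarrow> x + y \<in> {y \<in> E. alg_over K y}"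
    "\<And>x y. x \<in> {y \<in> E. alg_over K y} \<Longrightarrow> y \<in> {y \<in> E. alg_over K y} \<Longrightarrow> x * y \<in> {y \<in> E. alg_over K y}"
    by blast+
qed auto

text \<open>A subgroup of Z^r, given by a predicate, has generators in echelon form. The point is
  the last clause: the new coordinates are bounded linearly by the old exponents, so small exponents
  stay small after a change of generators.\<close>

lemma lattice_generators:
  fixes P :: "(nat \<Rightarrow> int) \<Rightarrow> bool"
  assumes "\<And>e f q. P e \<Longrightarrow> P f \<Longrightarrow> P (\<lambda>i. e i - q * f i)"
  shows "\<exists>(s::nat) g \<gamma>. \<gamma> \<ge> 0 \<and> (\<forall>k<s. P (g k)) \<and> (\<forall>e. P e \<longrightarrow> (\<forall>i\<ge>r. e i = 0) \<longrightarrow>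
     (\<exists>n. (\<forall>i. e i = (\<Sum>k<s. n k * g k i)) \<and> (\<forall>k<s. \<bar>n k\<bar> \<le> \<gamma> * (\<Sum>i<r. \<bar>e i\<bar>))))"
proof (induction r)
  case 0
  show ?case by (rule exI[of _ 0], rule exI[of _ "\<lambda>_ _. 0"], rule exI[of _ 0]) auto
next
  case (Suc r)
  then obtain s :: nat and g \<gamma> where IH0: "\<gamma> \<ge> 0 \<and> (\<forall>k<s. P (g k)) \<and> (\<forall>e. P e \<longrightarrow> (\<forall>i\<ge>r. e i = 0) \<longrightarrow>
     (\<exists>n. (\<forall>i. e i = (\<Sum>k<s. n k * g k i)) \<and> (\<forall>k<s. \<bar>n k\<bar> \<le> \<gamma> * (\<Sum>i<r. \<bar>e i\<bar>))))"
    by (elim exE)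
  have IH: "\<gamma> \<ge> 0" "\<And>k. k < s \<Longrightarrow> P (g k)"
    "\<And>e. P e \<Longrightarrow> \<forall>i\<ge>r. e i = 0 \<Longrightarrow>
     \<exists>n. (\<forall>i. e i = (\<Sum>k<s. n k * g k i)) \<and> (\<forall>k<s. \<bar>n k\<bar> \<le> \<gamma> * (\<Sum>i<r. \<bar>e i\<bar>))"
    using IH0 by simp_all
  define A where "A = {e. P e \<and> (\<forall>i\<ge>Suc r. e i = 0)}"
  show ?case
  proof (cases "\<forall>e\<in>A. e r = 0")
    case True
    have "\<forall>e. P e \<longrightarrow> (\<forall>i\<ge>Suc r. e i = 0) \<longrightarrow>
     (\<exists>n. (\<forall>i. e i = (\<Sum>k<s. n k * g k i)) \<and> (\<forall>k<s. \<bar>n k\<bar> \<le> \<gamma> * (\<Sum>i<Suc r. \<bar>e i\<bar>)))"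
    proof (intro allI impI)
      fix e assume e: "P e" "\<forall>i\<ge>Suc r. e i = 0"
      have er: "e r = 0" using True e unfolding A_def by auto
      hence "\<forall>i\<ge>r. e i = 0" using e(2) by (metis le_antisym not_less_eq_eq)
      from IH(3)[OF e(1) this] show "\<exists>n. (\<forall>i. e i = (\<Sum>k<s. n k * g k i)) \<and> (\<forall>k<s. \<bar>n k\<bar> \<le> \<gamma> * (\<Sum>i<Suc r. \<bar>e i\<bar>))"
        using er by simp
    qed
    thus ?thesis using IH by blast
  next
    case False
    then obtain v0 where v0: "v0 \<in> A" "v0 r \<noteq> 0" by auto
    \<comment> \<open>A last coordinate of least nonzero absolute value divides all others, by
      division with remainder.\<close>
    obtain v where v: "v \<in> A \<and> v r \<noteq> 0" "\<And>w. w \<in> A \<and> w r \<noteq> 0 \<Longrightarrow> nat \<bar>v r\<bar> \<le> nat \<bar>w r\<bar>"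
      using ex_has_least_nat[of "\<lambda>w. w \<in> A \<and> w r \<noteq> 0" v0 "\<lambda>w. nat \<bar>w r\<bar>"] v0 by blast
    define s' where "s' = Suc s"
    define g' where "g' = (\<lambda>k. if k < s then g k else v)"
    define V where "V = (\<Sum>i<r. \<bar>v i\<bar>)"
    \<comment> \<open>Since the absolute value of q is at most that of e r, subtracting q v enlarges
      the total size by a factor of at most 1 + V; the summand 1 pays for q itself.\<close>
    define \<gamma>' where "\<gamma>' = \<gamma> * (1 + V) + 1"
    have V0: "V \<ge> 0" unfolding V_def by (simp add: sum_nonneg)
    have "\<forall>e. P e \<longrightarrow> (\<forall>i\<ge>Suc r. e i = 0) \<longrightarrow>
     (\<exists>n. (\<forall>i. e i = (\<Sum>k<s'. n k * g' k i)) \<and> (\<forall>k<s'. \<bar>n k\<bar> \<le> \<gamma>' * (\<Sum>i<Suc r. \<bar>e i\<bar>)))"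
    proof (intro allI impI)
      fix e assume e: "P e" "\<forall>i\<ge>Suc r. e i = 0"
      define q where "q = e r div v r"
      define e' where "e' i = e i - q * v i" for i
      have Pe': "P e'" unfolding e'_def using assms e v unfolding A_def by auto
      have e'r: "e' r = e r mod v r" unfolding e'_def q_def by (simp add: minus_div_mult_eq_mod)
      have "e' \<in> A" unfolding A_def using Pe' e v by (auto simp: e'_def A_def)
      moreover have "\<bar>e' r\<bar> < \<bar>v r\<bar>" unfolding e'r using v(1) abs_mod_less by blast
      ultimately have "e' r = 0" using v(2)[of e'] by fastforce
      hence e'0: "\<forall>i\<ge>r. e' i = 0" using e(2) v(1) unfolding e'_def A_def
        by (metis (mono_tags, lifting) diff_self le_antisym mem_Collect_eq mult_zero_right not_less_eq_eq)
      from IH(3)[OF Pe' this] obtain n where n: "\<forall>i. e' i = (\<Sum>k<s. n k * g k i)"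
        "\<forall>k<s. \<bar>n k\<bar> \<le> \<gamma> * (\<Sum>i<r. \<bar>e' i\<bar>)" by (elim exE conjE)
      have "e r = q * v r" using \<open>e' r = 0\<close> unfolding e'_def by simp
      hence "\<bar>e r\<bar> = \<bar>q\<bar> * \<bar>v r\<bar>" by (simp add: abs_mult)
      moreover have "\<bar>v r\<bar> \<ge> 1" using v(1) by auto
      ultimately have qr: "\<bar>q\<bar> \<le> \<bar>e r\<bar>" using mult_left_mono[of 1 "\<bar>v r\<bar>" "\<bar>q\<bar>"] by simp
      define Se where "Se = (\<Sum>i<Suc r. \<bar>e i\<bar>)"
      have Se: "Se = (\<Sum>i<r. \<bar>e i\<bar>) + \<bar>e r\<bar>" unfolding Se_def by simp
      have Sr: "(\<Sum>i<r. \<bar>e i\<bar>) \<ge> 0" by (simp add: sum_nonneg)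
      have qS: "\<bar>q\<bar> \<le> Se" "(\<Sum>i<r. \<bar>e i\<bar>) \<le> Se" using qr Se Sr by linarith+
      have "(\<Sum>i<r. \<bar>e' i\<bar>) \<le> (\<Sum>i<r. \<bar>e i\<bar> + \<bar>q\<bar> * \<bar>v i\<bar>)"
        unfolding e'_def abs_mult[symmetric] by (intro sum_mono abs_triangle_ineq4)
      also have "\<dots> = (\<Sum>i<r. \<bar>e i\<bar>) + \<bar>q\<bar> * V" unfolding V_def by (simp add: sum.distrib sum_distrib_left)
      also have "\<dots> \<le> Se + Se * V" by (intro add_mono mult_right_mono qS V0)
      finally have "(\<Sum>i<r. \<bar>e' i\<bar>) \<le> (1 + V) * Se" by (simp add: algebra_simps)
      hence b1: "\<gamma> * (\<Sum>i<r. \<bar>e' i\<bar>) \<le> \<gamma> * ((1 + V) * Se)" using IH(1) by (rule mult_left_mono)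
      have Se0: "Se \<ge> 0" using Se Sr by simp
      have b2: "\<gamma>' * Se = \<gamma> * ((1 + V) * Se) + Se" unfolding \<gamma>'_def by (simp add: algebra_simps)
      have b3: "0 \<le> \<gamma> * ((1 + V) * Se)" using IH(1) V0 Se0 by simp
      define n' where "n' = (\<lambda>k. if k < s then n k else q)"
      have "\<forall>i. e i = (\<Sum>k<s'. n' k * g' k i)"
      proof
        fix i
        have "e i = e' i + q * v i" unfolding e'_def by simp
        thus "e i = (\<Sum>k<s'. n' k * g' k i)" unfolding s'_def n'_def g'_def using n(1) by simp
      qed
      moreover have "\<forall>k<s'. \<bar>n' k\<bar> \<le> \<gamma>' * Se"
      proof (intro allI impI)
        fix k assume "k < s'"
        show "\<bar>n' k\<bar> \<le> \<gamma>' * Se"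
        proof (cases "k < s")
          case True
          thus ?thesis using n(2) b1 b2 Se0 unfolding n'_def by fastforce
        next
          case False
          hence "n' k = q" unfolding n'_def by simp
          thus ?thesis using qS(1) b2 b3 by linarith
        qed
      qed
      ultimately show "\<exists>n. (\<forall>i. e i = (\<Sum>k<s'. n k * g' k i)) \<and> (\<forall>k<s'. \<bar>n k\<bar> \<le> \<gamma>' * (\<Sum>i<Suc r. \<bar>e i\<bar>))"
        unfolding Se_def by blast
    qed
    moreover have "\<forall>k<s'. P (g' k)" unfolding s'_def g'_def using IH(2) v(1) unfolding A_def by auto
    moreover have "\<gamma>' \<ge> 0" unfolding \<gamma>'_def using IH(1) V0 by simp
    ultimately show ?thesis by blast
  qed
qed

section \<open>Finite extensions of a rational function field K(t)\<close>

locale function_field =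
  fixes K E :: "'c::field set" and t :: 'c and V :: "'c set"
  assumes K: "is_subfield K" and t: "\<not> alg_over K t"
    and E: "is_subfield E" and KtE: "subfield_gen (insert t K) \<subseteq> E"
    and V: "finite V" "V \<subseteq> E" "E \<subseteq> kspan (subfield_gen (insert t K)) V"
begin

lemma KE: "K \<subseteq> E"
  using KtE sf_gen_superset[of "insert t K"] by auto

lemma pt_nz: "polyover K p \<Longrightarrow> p \<noteq> 0 \<Longrightarrow> poly p t \<noteq> 0"
  using t unfolding alg_over_def[OF K] by auto

lemma Kt_frac:
  assumes "y \<in> subfield_gen (insert t K)"
  obtains p q where "polyover K p" "polyover K q" "q \<noteq> 0" "y = poly p t / poly q t"
proof -
  define R where "R = {poly p t / poly q t | p q. polyover K p \<and> polyover K q \<and> q \<noteq> 0}"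
  have RI: "poly p t / poly q t \<in> R" if "polyover K p" "polyover K q" "q \<noteq> 0" for p q
    using that unfolding R_def by auto
  have "is_subfield R" unfolding is_subfield_def
  proof (intro conjI ballI)
    show "0 \<in> R" using RI[of 0 1] po_0[OF K] po_1[OF K] by simp
    show "1 \<in> R" using RI[of 1 1] po_1[OF K] by simp
    show "x + y \<in> R" "x * y \<in> R" if xy: "x \<in> R" "y \<in> R" for x y
    proof -
      obtain p q p' q' where x: "polyover K p" "polyover K q" "q \<noteq> 0" "x = poly p t / poly q t"
        and y: "polyover K p'" "polyover K q'" "q' \<noteq> 0" "y = poly p' t / poly q' t"
        using xy unfolding R_def by auto
      have "x + y = poly (p * q' + p' * q) t / poly (q * q') t"
        using x y pt_nz[OF x(2,3)] pt_nz[OF y(2,3)] by (simp add: add_frac_eq)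
      thus "x + y \<in> R" using RI[of "p * q' + p' * q" "q * q'"] x y
        by (auto intro!: po_add[OF K] po_mult[OF K])
      have "x * y = poly (p * p') t / poly (q * q') t" using x y by simp
      thus "x * y \<in> R" using RI[of "p * p'" "q * q'"] x y by (auto intro!: po_mult[OF K])
    qed
    show "- x \<in> R" "inverse x \<in> R" if xR: "x \<in> R" for x
    proof -
      obtain p q where x: "polyover K p" "polyover K q" "q \<noteq> 0" "x = poly p t / poly q t"
        using xR unfolding R_def by auto
      have "polyover K (- p)" using po_diff[OF K po_0[OF K] x(1)] by simp
      thus "- x \<in> R" using RI[of "- p" q] x by simp
      show "inverse x \<in> R"
      proof (cases "p = 0")
        case True thus ?thesis using x \<open>0 \<in> R\<close> by simp
      next
        case False thus ?thesis using RI[of q p] x by simp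
      qed
    qed
  qed
  moreover have "insert t K \<subseteq> R"
    using RI[OF po_X[OF K] po_1[OF K]] RI[OF po_const[OF K] po_1[OF K]] by auto
  ultimately have "y \<in> R" using sf_gen_least assms by blast
  thus ?thesis using that unfolding R_def by auto
qed

text \<open>Elements of degree at most a in t, a space of dimension at most card V * (a + 1) over K.
  The count below rests on this linear growth.\<close>

definition Lam :: "nat \<Rightarrow> 'c set" where
  "Lam a = kspan K ((\<lambda>(i, v). t ^ i * v) ` ({..a} \<times> V))"

lemma fin_gens: "finite ((\<lambda>(i, v). t ^ i * v) ` ({..a} \<times> V))"
  using V by auto

lemma Lam_add: "x \<in> Lam a \<Longrightarrow> y \<in> Lam a \<Longrightarrow> x + y \<in> Lam a"
  unfolding Lam_def by (rule kspan_add[OF K])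

lemma Lam_scale: "c \<in> K \<Longrightarrow> x \<in> Lam a \<Longrightarrow> c * x \<in> Lam a"
  unfolding Lam_def by (rule kspan_scale[OF K])

lemma Lam_sum: "(\<And>i. i \<in> I \<Longrightarrow> f i \<in> Lam a) \<Longrightarrow> sum f I \<in> Lam a"
  unfolding Lam_def by (rule kspan_sum[OF K])

lemma Lam_mono: "a \<le> b \<Longrightarrow> x \<in> Lam a \<Longrightarrow> x \<in> Lam b"
  unfolding Lam_def using kspan_mono[OF K fin_gens[of b], of "(\<lambda>(i, v). t ^ i * v) ` ({..a} \<times> V)"]
  by fastforce

lemma Lam_base: "v \<in> V \<Longrightarrow> i \<le> a \<Longrightarrow> t ^ i * v \<in> Lam a"
  unfolding Lam_def by (intro kspan_base[OF K fin_gens]) auto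

lemma Lam_poly:
  assumes p: "polyover K p" "degree p \<le> a" and x: "x \<in> Lam b"
  shows "poly p t * x \<in> Lam (a + b)"
  using x unfolding Lam_def[of b]
proof (rule kspan_least[OF K, of _ _ "{x. poly p t * x \<in> Lam (a + b)}", simplified])
  show "0 \<in> Lam (a + b)" unfolding Lam_def by (rule kspan_0[OF K])
  show "poly p t * (x + y) \<in> Lam (a + b)" if "poly p t * x \<in> Lam (a + b)" "poly p t * y \<in> Lam (a + b)" for x y
    using Lam_add[OF that] by (simp add: distrib_left)
  fix c s assume c: "c \<in> K" "s \<in> (\<lambda>(i, v). t ^ i * v) ` ({..b} \<times> V)"
  then obtain i v where s: "s = t ^ i * v" "i \<le> b" "v \<in> V" by auto
  have "poly p t * (c * s) = (\<Sum>j\<le>degree p. (coeff p j * c) * (t ^ (i + j) * v))"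
    by (simp add: poly_altdef s sum_distrib_left sum_distrib_right power_add mult_ac)
  also have "\<dots> \<in> Lam (a + b)"
    by (intro Lam_sum Lam_scale Lam_base sf_mult[OF K] po_coeff c) (use p s in auto)
  finally show "poly p t * (c * s) \<in> Lam (a + b)" .
qed

lemma in_Lam:
  assumes "y \<in> E"
  obtains p a where "polyover K p" "p \<noteq> 0" "poly p t * y \<in> Lam a"
proof -
  obtain k where k: "y = (\<Sum>v\<in>V. k v * v)" "\<forall>v. k v \<in> subfield_gen (insert t K)"
    using assms V(3) kspanE[OF sf_gen] by (metis subsetD)
  have "\<exists>p a. polyover K p \<and> p \<noteq> 0 \<and> poly p t * (\<Sum>v\<in>T. k v * v) \<in> Lam a" if "T \<subseteq> V" for T
    using finite_subset[OF that V(1)] that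
  proof (induction T rule: finite_induct)
    case empty
    show ?case using po_1[OF K] kspan_0[OF K] unfolding Lam_def by (intro exI[of _ 1] exI[of _ 0]) auto
  next
    case (insert v T)
    then obtain p a where p: "polyover K p" "p \<noteq> 0" "poly p t * (\<Sum>v\<in>T. k v * v) \<in> Lam a" by auto
    obtain f g where fg: "polyover K f" "polyover K g" "g \<noteq> 0" "k v = poly f t / poly g t"
      using Kt_frac k(2) by metis
    have "poly (p * g) t * (\<Sum>v\<in>insert v T. k v * v)
        = poly (p * f) t * (t ^ 0 * v) + poly g t * (poly p t * (\<Sum>v\<in>T. k v * v))"
      using insert.hyps fg pt_nz[OF fg(2,3)] by (simp add: algebra_simps)
    moreover have "poly (p * f) t * (t ^ 0 * v) \<in> Lam (degree (p * f) + 0)"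
      using insert.prems p fg by (intro Lam_poly Lam_base po_mult[OF K]) auto
    moreover have "poly g t * (poly p t * (\<Sum>v\<in>T. k v * v)) \<in> Lam (degree g + a)"
      using p fg by (intro Lam_poly) auto
    ultimately have "poly (p * g) t * (\<Sum>v\<in>insert v T. k v * v) \<in> Lam (degree (p * f) + (degree g + a))"
      by (auto intro!: Lam_add elim: Lam_mono[rotated])
    thus ?case using p fg po_mult[OF K p(1) fg(2)] by (metis mult_eq_0_iff)
  qed
  thus ?thesis using that k(1) by blast
qed

lemma in_Lam_finite:
  assumes "finite Y" "Y \<subseteq> E"
  obtains p a where "polyover K p" "p \<noteq> 0" "degree p \<le> a" "\<And>y. y \<in> Y \<Longrightarrow> poly p t * y \<in> Lam a"
proof -
  have "\<exists>p a. polyover K p \<and> p \<noteq> 0 \<and> (\<forall>y\<in>Y. poly p t * y \<in> Lam a)" using assms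
  proof (induction Y rule: finite_induct)
    case empty
    show ?case using po_1[OF K] by (intro exI[of _ 1]) auto
  next
    case (insert x Y)
    then obtain p a where p: "polyover K p" "p \<noteq> 0" "\<forall>y\<in>Y. poly p t * y \<in> Lam a" by auto
    obtain q b where q: "polyover K q" "q \<noteq> 0" "poly q t * x \<in> Lam b" using in_Lam insert.prems by blast
    have "poly (p * q) t * y \<in> Lam (degree p + degree q + a + b)" if "y \<in> insert x Y" for y
    proof (cases "y = x")
      case True
      have "poly p t * (poly q t * x) \<in> Lam (degree p + b)" using p q by (intro Lam_poly) auto
      thus ?thesis using True Lam_mono[of "degree p + b" "degree p + degree q + a + b"] by (simp add: mult.assoc)
    next
      case False
      have "poly q t * (poly p t * y) \<in> Lam (degree q + a)" using p q that False by (intro Lam_poly) auto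
      thus ?thesis using Lam_mono[of "degree q + a" "degree p + degree q + a + b"] by (simp add: mult_ac)
    qed
    thus ?case using p q po_mult[OF K p(1) q(1)] by (metis mult_eq_0_iff)
  qed
  then obtain p a where "polyover K p" "p \<noteq> 0" "\<forall>y\<in>Y. poly p t * y \<in> Lam a" by auto
  thus ?thesis using that[of p "max a (degree p)"] Lam_mono[of a "max a (degree p)"] by auto
qed

text \<open>One denominator and one shift a serve for all levels b: it suffices to clear the
  finitely many products c v, since a factor t^i only shifts the level by i.\<close>

lemma operator_bound:
  assumes "finite X" "X \<subseteq> E"
  obtains p a where "polyover K p" "p \<noteq> 0" "degree p \<le> a"
    "\<And>c b x. c \<in> X \<Longrightarrow> x \<in> Lam b \<Longrightarrow> poly p t * c * x \<in> Lam (b + a)"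
proof -
  define Y where "Y = (\<lambda>(c, v). c * v) ` (X \<times> V)"
  have Y: "finite Y" "Y \<subseteq> E" unfolding Y_def using assms V sf_mult[OF E] by (auto simp: subset_iff)
  obtain p a where p: "polyover K p" "p \<noteq> 0" "degree p \<le> a" "\<And>y. y \<in> Y \<Longrightarrow> poly p t * y \<in> Lam a"
    using in_Lam_finite[OF Y] by blast
  have "poly p t * c * x \<in> Lam (b + a)" if c: "c \<in> X" and x: "x \<in> Lam b" for c b x
    using x unfolding Lam_def[of b]
  proof (rule kspan_least[OF K, of _ _ "{x. poly p t * c * x \<in> Lam (b + a)}", simplified])
    show "0 \<in> Lam (b + a)" unfolding Lam_def by (rule kspan_0[OF K])
    show "poly p t * c * (x + y) \<in> Lam (b + a)" if "poly p t * c * x \<in> Lam (b + a)" "poly p t * c * y \<in> Lam (b + a)" for x y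
      using Lam_add[OF that] by (simp add: distrib_left)
    fix k s assume k: "k \<in> K" "s \<in> (\<lambda>(i, v). t ^ i * v) ` ({..b} \<times> V)"
    then obtain i v where s: "s = t ^ i * v" "i \<le> b" "v \<in> V" by auto
    have "poly p t * (c * v) \<in> Lam a" using p(4) c s unfolding Y_def by auto
    hence "poly (monom 1 i) t * (poly p t * (c * v)) \<in> Lam (b + a)"
      using s by (intro Lam_poly po_monom[OF K] sf_1[OF K]) (auto intro: order.trans[OF degree_monom_le])
    hence "k * (poly (monom 1 i) t * (poly p t * (c * v))) \<in> Lam (b + a)" by (rule Lam_scale[OF k(1)])
    thus "poly p t * c * (k * s) \<in> Lam (b + a)" by (simp add: s poly_monom mult_ac)
  qed
  thus ?thesis using that p(1-3) by blast
qed

text \<open>The elements w u^j are independent over K, so there are at most as many as generators of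
  \<open>Lam a\<close>.\<close>

lemma transcendental_powers:
  assumes u: "\<not> alg_over K u" and w: "w \<noteq> 0" "\<And>j. j < n \<Longrightarrow> w * u ^ j \<in> Lam a"
  shows "n \<le> card V * Suc a"
proof (rule ccontr)
  assume "\<not> ?thesis"
  moreover have "card ((\<lambda>(i, v). t ^ i * v) ` ({..a} \<times> V)) \<le> Suc a * card V"
    using card_image_le[of "{..a} \<times> V" "\<lambda>(i, v). t ^ i * v"] V by (simp add: card_cartesian_product)
  ultimately have "card ((\<lambda>(i, v). t ^ i * v) ` ({..a} \<times> V)) < card {..<n}" by (simp add: mult.commute)
  then obtain k where k: "\<And>j. k j \<in> K" "\<exists>j\<in>{..<n}. k j \<noteq> 0" "(\<Sum>j\<in>{..<n}. k j * (w * u ^ j)) = 0"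
    using kspan_dependent[OF K fin_gens, of "{..<n}" a "\<lambda>j. w * u ^ j"] w(2) unfolding Lam_def by auto
  define f where "f = (\<Sum>j<n. monom (k j) j)"
  have "polyover K f" unfolding f_def using k by (intro po_sum[OF K] po_monom[OF K])
  moreover have "f \<noteq> 0"
  proof
    assume "f = 0"
    obtain j where "j < n" "k j \<noteq> 0" using k(2) by auto
    hence "coeff f j \<noteq> 0" unfolding f_def by (simp add: coeff_sum)
    thus False using \<open>f = 0\<close> by simp
  qed
  moreover have "w * poly f u = 0" unfolding f_def using k(3)
    by (simp add: poly_sum poly_monom sum_distrib_left mult_ac)
  ultimately show False using u w(1) unfolding alg_over_def[OF K] by auto
qed

definition F :: "'c set" where "F = {y \<in> E. alg_over K y}"

lemma F_subfield: "is_subfield F"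
  unfolding F_def by (rule alg_closure_subfield[OF K E KE])

text \<open>Constants independent over K stay independent over K(t). After clearing denominators, a
  relation is a polynomial in t with coefficients algebraic over K, so it vanishes identically, and
  its coefficients are relations over K. This makes F finite over K.\<close>

lemma F_indep_card:
  assumes S: "S \<subseteq> F" "indepK K S"
  shows "card S \<le> card V"
proof (rule ccontr)
  assume "\<not> ?thesis"
  hence lt: "card V < card S" by simp
  have finS: "finite S" using S unfolding indepK_def by auto
  obtain r where r: "\<And>s. r s \<in> subfield_gen (insert t K)" "\<exists>s\<in>S. r s \<noteq> 0" "(\<Sum>s\<in>S. r s * s) = 0"
    using kspan_dependent[OF sf_gen V(1) finS lt, of "\<lambda>s. s" "insert t K"] V(3) S unfolding F_def by blast
  have "\<forall>s. \<exists>p q. polyover K p \<and> polyover K q \<and> q \<noteq> 0 \<and> r s = poly p t / poly q t"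
    using Kt_frac r(1) by metis
  then obtain p q where pq: "\<And>s. polyover K (p s)" "\<And>s. polyover K (q s)" "\<And>s. q s \<noteq> 0"
    "\<And>s. r s = poly (p s) t / poly (q s) t" by metis
  define P where "P s = p s * (\<Prod>s'\<in>S - {s}. q s')" for s
  have poprod: "polyover K (\<Prod>s'\<in>T. q s')" for T
    by (induction T rule: infinite_finite_induct) (auto simp: po_1[OF K] pq intro!: po_mult[OF K])
  have P: "polyover K (P s)" for s unfolding P_def by (intro po_mult[OF K] pq poprod)
  have Pt: "poly (P s) t = r s * poly (\<Prod>s'\<in>S. q s') t" if "s \<in> S" for s
    unfolding P_def pq(4) using finS that pt_nz[OF pq(2,3)] by (simp add: prod.remove[of S s])
  have sum0: "(\<Sum>s\<in>S. poly (P s) t * s) = 0"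
  proof -
    have "(\<Sum>s\<in>S. poly (P s) t * s) = (\<Sum>s\<in>S. r s * s) * poly (\<Prod>s'\<in>S. q s') t"
      unfolding sum_distrib_right by (intro sum.cong refl) (simp add: Pt mult_ac)
    thus ?thesis using r by simp
  qed
  obtain M where M: "finext K M" "S \<subseteq> M"
    using finext_of_algebraic[OF K finS] S unfolding F_def by auto
  have sM: "is_subfield M" "K \<subseteq> M" using M unfolding finext_def by auto
  \<comment> \<open>The relation as a polynomial in t over M; t stays transcendental over M because
    M is finite over K.\<close>
  define G where "G = (\<Sum>s\<in>S. Polynomial.smult s (P s))"
  have G: "polyover M G" unfolding G_def
    using P sM M by (intro po_sum[OF sM(1)] po_smult[OF sM(1)]) (auto intro: po_mono)
  have Gt: "poly G t = 0" unfolding G_def using sum0 by (simp add: poly_sum mult.commute)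
  have "G = 0"
  proof (rule ccontr)
    assume "G \<noteq> 0"
    hence "alg_over M t" using G Gt unfolding alg_over_def[OF sM(1)] by auto
    from finext_trans[OF M(1) finext_adj[OF sM(1) this]] have "finext K (adj M t)" .
    from finext_alg[OF this adj_self[OF sM(1)]] show False using t by simp
  qed
  obtain s where s: "s \<in> S" "r s \<noteq> 0" using r by auto
  have "P s \<noteq> 0"
  proof
    assume "P s = 0"
    hence "r s * poly (\<Prod>s'\<in>S. q s') t = 0" using Pt[OF s(1)] by simp
    thus False using s pt_nz[OF poprod[of S]] pq(3) finS by auto
  qed
  then obtain i where i: "coeff (P s) i \<noteq> 0" by (metis leading_coeff_0_iff)
  have "(\<Sum>s\<in>S. coeff (P s) i * s) = coeff G i" unfolding G_def by (simp add: coeff_sum mult.commute)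
  hence "(\<Sum>s\<in>S. coeff (P s) i * s) = 0" using \<open>G = 0\<close> by simp
  moreover have "\<forall>s. coeff (P s) i \<in> K" using P po_coeff by blast
  ultimately have "coeff (P s) i = 0" using indepKD[OF S(2), of "\<lambda>s. coeff (P s) i"] s(1) by blast
  thus False using i by auto
qed

lemma F_finext: "finext K F"
proof -
  obtain S where "S \<subseteq> F" "indepK K S" "F \<subseteq> kspan K S"
    using max_indep_spans[OF K F_indep_card] by blast
  thus ?thesis unfolding finext_def using K F_subfield KE alg_over_base[OF K]
    by (auto simp: F_def indepK_def)
qed

end

lemma prod_powi: "(prod f I :: 'c::field) powi q = (\<Prod>i\<in>I. f i powi q)"
  by (induction I rule: infinite_finite_induct) (auto simp: power_int_mult_distrib)

context function_field
begin

text \<open>The cost of a monomial is its total exponent: that many factors q and that many shifts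
  by a.\<close>

lemma monomial_operator:
  fixes c :: "nat \<Rightarrow> 'c"
  assumes op: "\<And>c b x. c \<in> X \<Longrightarrow> x \<in> Lam b \<Longrightarrow> q * c * x \<in> Lam (b + a)"
    and c: "\<And>i. i < r \<Longrightarrow> c i \<in> X" "\<And>i. i < r \<Longrightarrow> inverse (c i) \<in> X" and x: "x \<in> Lam b"
  shows "q ^ (\<Sum>i<r. nat \<bar>f i\<bar>) * (\<Prod>i<r. c i powi f i) * x \<in> Lam (b + a * (\<Sum>i<r. nat \<bar>f i\<bar>))"
  using c
proof (induction r)
  case 0 thus ?case using x by simp
next
  case (Suc r)
  define y where "y = (if f r \<ge> 0 then c r else inverse (c r))"
  define n where "n = nat \<bar>f r\<bar>"
  have xn: "c r powi f r = y ^ n" unfolding y_def n_def power_int_def by (simp add: power_inverse)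
  have y: "y \<in> X" unfolding y_def using Suc.prems by auto
  have it: "q ^ n * y ^ n * z \<in> Lam (b' + a * n)" if "z \<in> Lam b'" for z b'
  proof (induction n)
    case 0 thus ?case using that by simp
  next
    case (Suc n)
    from op[OF y Suc] show ?case by (simp add: mult_ac add_ac)
  qed
  have "q ^ n * y ^ n * (q ^ (\<Sum>i<r. nat \<bar>f i\<bar>) * (\<Prod>i<r. c i powi f i) * x) \<in> Lam ((b + a * (\<Sum>i<r. nat \<bar>f i\<bar>)) + a * n)"
    using Suc by (intro it) auto
  thus ?case by (simp add: xn n_def[symmetric] power_add distrib_left mult_ac add_ac)
qed

text \<open>If u were transcendental, m n independent elements w u^j would lie in a space of
  dimension at most card V * (b + 1 + a n H), with H the total exponent. Small exponents mean card V
  * a * H < m, so for large n the space is too small.\<close>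

lemma small_exponents_algebraic:
  fixes c :: "nat \<Rightarrow> 'c"
  assumes c: "\<And>i. i < r \<Longrightarrow> c i \<in> E \<and> c i \<noteq> 0"
  obtains D :: nat where "\<And>u m f e. u \<in> E \<Longrightarrow> m > 0 \<Longrightarrow> f \<in> F \<Longrightarrow>
    u ^ m = f * (\<Prod>i<r. c i powi e i) \<Longrightarrow> (\<And>i. i < r \<Longrightarrow> int D * \<bar>e i\<bar> \<le> int m) \<Longrightarrow> alg_over K u"
proof -
  define X where "X = c ` {..<r} \<union> (\<lambda>i. inverse (c i)) ` {..<r}"
  have X: "finite X" "X \<subseteq> E" unfolding X_def using c sf_inverse[OF E] by auto
  obtain p a where p: "polyover K p" "p \<noteq> 0" "degree p \<le> a"
    "\<And>c b x. c \<in> X \<Longrightarrow> x \<in> Lam b \<Longrightarrow> poly p t * c * x \<in> Lam (b + a)"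
    using operator_bound[OF X] by blast
  \<comment> \<open>Chosen to give card V * a * H < m; the summand 1 makes the inequality
    strict.\<close>
  define D where "D = card V * a * r + 1"
  show ?thesis
  proof (rule that[of D], rule ccontr)
    fix u m f e
    assume u: "u \<in> E" and m: "m > (0::nat)" and f: "f \<in> F" and eq: "u ^ m = f * (\<Prod>i<r. c i powi e i)"
      and small: "\<And>i. i < r \<Longrightarrow> int D * \<bar>e i\<bar> \<le> int m" and nalg: "\<not> alg_over K u"
    define H where "H = (\<Sum>i<r. nat \<bar>e i\<bar>)"
    have "D * H \<le> r * m"
    proof -
      have "D * H = (\<Sum>i<r. D * nat \<bar>e i\<bar>)" unfolding H_def by (simp add: sum_distrib_left)
      also have "\<dots> \<le> (\<Sum>i<r. m)"
      proof (rule sum_mono)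
        fix i assume "i \<in> {..<r}"
        hence "int (D * nat \<bar>e i\<bar>) \<le> int m" using small[of i] by simp
        thus "D * nat \<bar>e i\<bar> \<le> m" by (simp only: of_nat_le_iff)
      qed
      finally show ?thesis by simp
    qed
    hence DH: "card V * a * H * r + H \<le> r * m" unfolding D_def by (simp add: algebra_simps)
    have Hm: "card V * a * H < m"
    proof (rule ccontr)
      assume nl: "\<not> ?thesis"
      hence "m * r \<le> card V * a * H * r" by (intro mult_le_mono1) simp
      hence "H = 0" using DH unfolding mult.commute[of r m] by linarith
      thus False using nl m by simp
    qed
    obtain S where S: "finite S" "S \<subseteq> F" "F \<subseteq> kspan K S" using F_finext unfolding finext_def by auto
    define Y where "Y = (\<lambda>(i, s). u ^ i * s) ` ({..<m} \<times> S)"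
    have Y: "finite Y" "Y \<subseteq> E" unfolding Y_def using S u sf_power[OF E u] sf_mult[OF E]
      by (auto simp: F_def subset_iff)
    obtain p' b where p': "polyover K p'" "p' \<noteq> 0" "\<And>y. y \<in> Y \<Longrightarrow> poly p' t * y \<in> Lam b"
      using in_Lam_finite[OF Y] by blast
    \<comment> \<open>All powers of f stay in F, which is finite over K; hence one denominator p'
      and one level b serve for all of them.\<close>
    have start: "poly p' t * (u ^ i * g) \<in> Lam b" if ig: "i < m" "g \<in> F" for i g
    proof -
      obtain k where k: "g = (\<Sum>s\<in>S. k s * s)" "\<forall>s. k s \<in> K" using S(3) ig(2) kspanE[OF K] by (metis subsetD)
      have "poly p' t * (u ^ i * g) = (\<Sum>s\<in>S. k s * (poly p' t * (u ^ i * s)))"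
        unfolding k(1) by (simp add: sum_distrib_left mult_ac)
      also have "\<dots> \<in> Lam b" using k(2) ig(1) by (intro Lam_sum Lam_scale p') (auto simp: Y_def)
      finally show ?thesis .
    qed
    \<comment> \<open>The level b does not depend on n, so n can be taken larger than card V * (b +
      1).\<close>
    define n where "n = card V * Suc b + 1"
    define w where "w = poly p' t * poly p t ^ (n * H)"
    have w0: "w \<noteq> 0" unfolding w_def using pt_nz p p' by simp
    have wu: "w * u ^ j \<in> Lam (b + a * (n * H))" if j: "j < m * n" for j
    proof -
      define n' where "n' = j div m"
      define i where "i = j mod m"
      have ij: "j = m * n' + i" "i < m" unfolding n'_def i_def using m by auto
      have n'n: "n' < n" unfolding n'_def using j by (simp add: less_mult_imp_div_less mult.commute)
      have "u ^ (m * n') = f ^ n' * (\<Prod>q<r. (c q powi e q) ^ n')"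
        unfolding power_mult eq by (simp add: power_mult_distrib prod_power_distrib)
      also have "(\<Prod>q<r. (c q powi e q) ^ n') = (\<Prod>q<r. c q powi (int n' * e q))"
        by (intro prod.cong refl) (simp only: power_int_mult power_int_of_nat mult.commute[of "int n'"])
      finally have un: "u ^ (m * n') = f ^ n' * (\<Prod>q<r. c q powi (int n' * e q))" .
      have Hs: "(\<Sum>q<r. nat \<bar>int n' * e q\<bar>) = n' * H"
        unfolding H_def by (simp add: abs_mult nat_mult_distrib sum_distrib_left)
      have "f ^ n' \<in> F" using f sf_power[OF F_subfield] by auto
      from start[OF ij(2) this]
      have "poly p t ^ (n' * H) * (\<Prod>q<r. c q powi (int n' * e q)) * (poly p' t * (u ^ i * f ^ n'))
          \<in> Lam (b + a * (n' * H))"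
        using monomial_operator[of X "poly p t" a r c "poly p' t * (u ^ i * f ^ n')" b "\<lambda>q. int n' * e q"] p(4)
        unfolding Hs X_def by auto
      \<comment> \<open>Additional factors p make the multiplier w the same for all j.\<close>
      hence "poly (p ^ ((n - n') * H)) t * (poly p t ^ (n' * H) * (\<Prod>q<r. c q powi (int n' * e q)) * (poly p' t * (u ^ i * f ^ n')))
          \<in> Lam (a * ((n - n') * H) + (b + a * (n' * H)))"
        by (intro Lam_poly po_power[OF K] p order.trans[OF degree_power_le]) (use p(3) in auto)
      moreover have "a * ((n - n') * H) + (b + a * (n' * H)) = b + a * (n * H)"
      proof -
        have "n * H = (n - n') * H + n' * H" using n'n by (simp add: add_mult_distrib[symmetric])
        thus ?thesis by (simp only: distrib_left)
      qed
      moreover have "poly (p ^ ((n - n') * H)) t * (poly p t ^ (n' * H) * (\<Prod>q<r. c q powi (int n' * e q)) * (poly p' t * (u ^ i * f ^ n')))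
         = w * u ^ j"
      proof -
        have "n * H = (n - n') * H + n' * H" using n'n by (simp add: add_mult_distrib[symmetric])
        thus ?thesis unfolding w_def ij(1) power_add un by (simp add: power_add mult_ac)
      qed
      ultimately show ?thesis by simp
    qed
    have "m * n \<le> card V * Suc (b + a * (n * H))" by (rule transcendental_powers[OF nalg w0 wu])
    also have "\<dots> = card V * Suc b + card V * a * H * n" by (simp add: algebra_simps)
    also have "\<dots> < n + card V * a * H * n" unfolding n_def by simp
    also have "\<dots> = Suc (card V * a * H) * n" by simp
    also have "\<dots> \<le> m * n" using Hm by (intro mult_right_mono) auto
    finally show False by simp
  qed
qed

text \<open>Small exponents force u into F, and then the monomial lies in F too. The exponents whose
  monomial lies in F form a lattice; its generators give elements d k of F, to which the hypothesis
  on F applies.\<close>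

theorem disc_function_field:
  assumes "disc F"
  shows "disc E"
  unfolding disc_def
proof (intro allI impI)
  fix r and c :: "nat \<Rightarrow> 'c"
  assume c: "\<forall>i<r. c i \<in> E \<and> c i \<noteq> 0"
  obtain D1 :: nat where D1: "\<And>u m f e. u \<in> E \<Longrightarrow> m > 0 \<Longrightarrow> f \<in> F \<Longrightarrow>
    u ^ m = f * (\<Prod>i<r. c i powi e i) \<Longrightarrow> (\<And>i. i < r \<Longrightarrow> int D1 * \<bar>e i\<bar> \<le> int m) \<Longrightarrow> alg_over K u"
    by (rule small_exponents_algebraic[of r c]) (use c in \<open>simp, blast\<close>)
  define P where "P e \<longleftrightarrow> (\<Prod>i<r. c i powi e i) \<in> F" for e :: "nat \<Rightarrow> int"
  have Pcomb: "P (\<lambda>i. e i - q * f i)" if "P e" "P f" for e f q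
  proof -
    have "(\<Prod>i<r. c i powi (e i - q * f i)) = (\<Prod>i<r. c i powi e i) / (\<Prod>i<r. c i powi f i) powi q"
      using c by (simp add: power_int_diff prod_dividef prod_powi power_int_mult mult.commute[of q])
    thus ?thesis using that unfolding P_def
      by (auto intro!: sf_divide[OF F_subfield] sf_power_int[OF F_subfield])
  qed
  obtain s :: nat and g \<gamma> where G: "\<gamma> \<ge> 0 \<and> (\<forall>k<s. P (g k)) \<and> (\<forall>e. P e \<longrightarrow> (\<forall>i\<ge>r. e i = 0) \<longrightarrow>
     (\<exists>n. (\<forall>i. e i = (\<Sum>k<s. n k * g k i)) \<and> (\<forall>k<s. \<bar>n k\<bar> \<le> \<gamma> * (\<Sum>i<r. \<bar>e i\<bar>))))"
    using lattice_generators[of P r] Pcomb by auto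
  define d where "d k = (\<Prod>i<r. c i powi g k i)" for k
  have d: "\<forall>k<s. d k \<in> F \<and> d k \<noteq> 0" using G c unfolding d_def P_def by auto
  obtain D2 :: nat where D2: "\<And>u m z e. u \<in> F \<Longrightarrow> m > 0 \<Longrightarrow> tors z \<Longrightarrow>
        u ^ m = z * (\<Prod>i<s. d i powi e i) \<Longrightarrow> (\<forall>i<s. int D2 * \<bar>e i\<bar> \<le> int m) \<Longrightarrow> tors u"
    using assms[unfolded disc_def, rule_format, of s d] d by blast
  \<comment> \<open>D1 makes u algebraic. The other summand keeps the new exponents small: each is
    at most \<gamma> times a sum of r old ones.\<close>
  define D where "D = D1 + D2 * nat \<gamma> * r"
  show "\<exists>D::nat. \<forall>u m z e. u \<in> E \<longrightarrow> m > 0 \<longrightarrow> tors z \<longrightarrow>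
        u ^ m = z * (\<Prod>i<r. c i powi e i) \<longrightarrow> (\<forall>i<r. int D * \<bar>e i\<bar> \<le> int m) \<longrightarrow> tors u"
  proof (intro exI allI impI)
    fix u m z e0
    assume u: "u \<in> E" and m: "m > (0::nat)" and z: "tors z" and eq0: "u ^ m = z * (\<Prod>i<r. c i powi e0 i)"
      and small0: "\<forall>i<r. int D * \<bar>e0 i\<bar> \<le> int m"
    \<comment> \<open>The given exponents are arbitrary from r on, while
      \<open>lattice_generators\<close> describes vectors that vanish there.\<close>
    define e where "e i = (if i < r then e0 i else 0)" for i
    have eq: "u ^ m = z * (\<Prod>i<r. c i powi e i)" unfolding eq0 e_def by simp
    have small: "int D * \<bar>e i\<bar> \<le> int m" if "i < r" for i using small0 that unfolding e_def by simp
    obtain t0 where t0: "t0 > 0" "z ^ t0 = 1" using z unfolding tors_def by auto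
    have P0: "(\<Prod>i<r. c i powi e i) \<noteq> 0" "(\<Prod>i<r. c i powi e i) \<in> E"
      using c by (auto intro!: sf_prod[OF E] sf_power_int[OF E])
    have "z = u ^ m / (\<Prod>i<r. c i powi e i)" using eq P0 by simp
    hence zE: "z \<in> E" using sf_divide[OF E sf_power[OF E u] P0(2)] by simp
    have z0: "z \<noteq> 0" using t0 by (metis power_0_left zero_neq_one not_gr_zero)
    have "alg_over K z" using radical_alg_over[OF K _ t0(1), of z] t0(2) sf_1[OF K] by simp
    hence zF: "z \<in> F" unfolding F_def using zE by simp
    have "int D1 * \<bar>e i\<bar> \<le> int m" if "i < r" for i
    proof -
      have "int D1 * \<bar>e i\<bar> \<le> int D * \<bar>e i\<bar>" unfolding D_def by (intro mult_right_mono) auto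
      thus ?thesis using small[OF that] by linarith
    qed
    hence "alg_over K u" using D1[OF u m zF eq] by blast
    hence uF: "u \<in> F" unfolding F_def using u by simp
    have "(\<Prod>i<r. c i powi e i) = u ^ m / z" using eq z0 by simp
    hence "P e" unfolding P_def using sf_divide[OF F_subfield sf_power[OF F_subfield uF] zF] by simp
    moreover have "\<forall>i\<ge>r. e i = 0" unfolding e_def by simp
    ultimately obtain n where n: "\<forall>i. e i = (\<Sum>k<s. n k * g k i)" "\<forall>k<s. \<bar>n k\<bar> \<le> \<gamma> * (\<Sum>i<r. \<bar>e i\<bar>)"
      using G by blast
    have "(\<Prod>i<r. c i powi e i) = (\<Prod>i<r. \<Prod>k<s. c i powi (n k * g k i))"
    proof (intro prod.cong refl)
      fix i assume "i \<in> {..<r}"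
      hence ci: "c i \<noteq> 0" using c by auto
      have "c i powi (\<Sum>k<l. n k * g k i) = (\<Prod>k<l. c i powi (n k * g k i))" for l
        by (induction l) (use ci in \<open>auto simp: power_int_add\<close>)
      thus "c i powi e i = (\<Prod>k<s. c i powi (n k * g k i))" using n(1) by metis
    qed
    also have "\<dots> = (\<Prod>k<s. \<Prod>i<r. c i powi (n k * g k i))" by (rule prod.swap)
    also have "\<dots> = (\<Prod>k<s. d k powi n k)"
      unfolding d_def by (simp add: prod_powi power_int_mult mult.commute[of "n _"])
    finally have eq2: "u ^ m = z * (\<Prod>k<s. d k powi n k)" using eq by simp
    have sum_small: "int (D2 * nat \<gamma>) * (\<Sum>i<r. \<bar>e i\<bar>) \<le> int m"
    proof (cases "r = 0")
      case False
      have "int D * (\<Sum>i<r. \<bar>e i\<bar>) \<le> int r * int m"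
        using sum_mono[of "{..<r}" "\<lambda>i. int D * \<bar>e i\<bar>" "\<lambda>_. int m"] small by (simp add: sum_distrib_left)
      moreover have "int (D2 * nat \<gamma> * r) * (\<Sum>i<r. \<bar>e i\<bar>) \<le> int D * (\<Sum>i<r. \<bar>e i\<bar>)"
        unfolding D_def by (intro mult_right_mono sum_nonneg) auto
      ultimately have "int r * (int (D2 * nat \<gamma>) * (\<Sum>i<r. \<bar>e i\<bar>)) \<le> int r * int m"
        by (simp add: mult_ac)
      thus ?thesis using False by simp
    qed simp
    have "int D2 * \<bar>n k\<bar> \<le> int m" if "k < s" for k
    proof -
      have "int D2 * \<bar>n k\<bar> \<le> int D2 * (\<gamma> * (\<Sum>i<r. \<bar>e i\<bar>))" using n(2) that by (intro mult_left_mono) auto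
      also have "\<dots> = int (D2 * nat \<gamma>) * (\<Sum>i<r. \<bar>e i\<bar>)" using G by simp
      finally show ?thesis using sum_small by linarith
    qed
    thus "tors u" using D2[OF uF m z eq2] by blast
  qed
qed

end

section \<open>Discreteness by induction on the generators of the field\<close>

context closed_field0
begin

text \<open>The property carried by the induction. An algebraic generator only enlarges the finite
  extension, and for a transcendental one the field of constants is a finite extension of K,
  possibly larger than K.\<close>

definition findisc :: "'c set \<Rightarrow> bool" where
  "findisc K \<longleftrightarrow> (\<forall>E. finext K E \<longrightarrow> disc E)"

lemma findisc_prime: "findisc (subfield_gen {})"
  unfolding findisc_def
proof (intro allI impI)
  fix E :: "'c set" assume fe: "finext (subfield_gen {}) E"
  let ?Q = "subfield_gen {} :: 'c set"
  have Q: "is_subfield ?Q" by (rule sf_gen)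
  have E: "is_subfield E" using fe unfolding finext_def by auto
  obtain T where T: "finite T" "E \<subseteq> kspan ?Q T" using fe unfolding finext_def by auto
  have bound: "card S \<le> card T" if S: "S \<subseteq> E" "indepK ?Q S" for S
  proof (rule ccontr)
    assume "\<not> ?thesis"
    hence lt: "card T < card S" by simp
    have "finite S" using S unfolding indepK_def by auto
    from kspan_dependent[OF Q T(1) this lt, of "\<lambda>s. s"] obtain k
      where k: "\<And>s. k s \<in> ?Q" "\<exists>s\<in>S. k s \<noteq> 0" "(\<Sum>s\<in>S. k s * s) = 0" using S(1) T(2) by blast
    have "\<forall>s\<in>S. k s = 0" using indepKD[OF S(2), of k] k by auto
    thus False using k(2) by auto
  qed
  obtain S where S: "S \<subseteq> E" "indepK ?Q S" "E \<subseteq> kspan ?Q S"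
    using max_indep_spans[OF Q bound] by blast
  have finS: "finite S" using S unfolding indepK_def by auto
  obtain v where v: "bij_betw v {..<card S} S"
    using ex_bij_betw_nat_finite[OF finS] by (auto simp: atLeast0LessThan)
  have reindex: "(\<Sum>i<card S. h (v i)) = sum h S" for h :: "'c \<Rightarrow> 'c"
    using sum.reindex_bij_betw[OF v] by simp
  have "rat_basis E v (card S)"
  proof unfold_locales
    show "is_subfield E" by (rule E)
    show "v i \<in> E" if "i < card S" for i using v S(1) that unfolding bij_betw_def by auto
    show "\<exists>f. y = (\<Sum>i<card S. rat_emb (f i) * v i)" if "y \<in> E" for y
    proof -
      obtain k where k: "y = (\<Sum>s\<in>S. k s * s)" "\<forall>s. k s \<in> ?Q" using S(3) \<open>y \<in> E\<close> kspanE[OF Q] by (metis subsetD)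
      have "\<forall>s. \<exists>q. k s = rat_emb q" using k(2) range_rat_emb by blast
      then obtain f where f: "\<And>s. k s = rat_emb (f s)" by metis
      thus ?thesis unfolding k(1) reindex[symmetric] by (intro exI[of _ "\<lambda>i. f (v i)"]) simp
    qed
    show "f i = 0" if f: "(\<Sum>i<card S. rat_emb (f i) * v i) = 0" "i < card S" for f i
    proof -
      define k where "k s = rat_emb (f (the_inv_into {..<card S} v s))" for s
      have vi: "the_inv_into {..<card S} v (v i) = i" if "i < card S" for i
        using v that unfolding bij_betw_def by (auto intro: the_inv_into_f_f)
      have "(\<Sum>s\<in>S. k s * s) = (\<Sum>i<card S. rat_emb (f i) * v i)"
        unfolding reindex[symmetric] k_def by (intro sum.cong refl) (simp add: vi)
      hence "(\<Sum>s\<in>S. k s * s) = 0" using f by simp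
      moreover have "\<forall>s. k s \<in> ?Q" unfolding k_def using range_rat_emb by blast
      moreover have "v i \<in> S" using v f(2) unfolding bij_betw_def by auto
      ultimately have "k (v i) = 0" using indepKD[OF S(2)] by blast
      thus ?thesis unfolding k_def using vi[OF f(2)] by simp
    qed
  qed
  thus "disc E" by (rule rat_basis.disc_number_field)
qed

lemma findisc_adjoin:
  assumes K: "is_subfield K" and fd: "findisc K"
  shows "findisc (subfield_gen (insert t K))"
  unfolding findisc_def
proof (intro allI impI)
  fix E assume fe: "finext (subfield_gen (insert t K)) E"
  show "disc E"
  proof (cases "alg_over K t")
    case True
    have "finext K E"
      using finext_trans[OF finext_adj[OF K True]] fe unfolding adj_eq_gen[OF K True] by blast
    thus ?thesis using fd unfolding findisc_def by blast
  next
    case False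
    obtain V where V: "finite V" "V \<subseteq> E" "E \<subseteq> kspan (subfield_gen (insert t K)) V"
      and E: "is_subfield E" "subfield_gen (insert t K) \<subseteq> E" using fe unfolding finext_def by auto
    interpret function_field K E t V by unfold_locales (use K False V E in auto)
    have "disc F" using fd F_finext unfolding findisc_def by blast
    thus ?thesis by (rule disc_function_field)
  qed
qed

theorem disc_fin_gen:
  assumes "finite (S :: 'c set)"
  shows "disc (subfield_gen S)"
proof -
  have "findisc (subfield_gen S)" using assms
  proof (induction S rule: finite_induct)
    case empty show ?case by (rule findisc_prime)
  next
    case (insert x S)
    have "subfield_gen (insert x (subfield_gen S)) = subfield_gen (insert x S)"
    proof
      show "subfield_gen (insert x (subfield_gen S)) \<subseteq> subfield_gen (insert x S)"
        using sf_gen_superset[of "insert x S"] sf_gen_mono[of S "insert x S"]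
        by (intro sf_gen_least sf_gen) auto
      show "subfield_gen (insert x S) \<subseteq> subfield_gen (insert x (subfield_gen S))"
        using sf_gen_superset[of S] by (intro sf_gen_mono) auto
    qed
    thus ?case using findisc_adjoin[OF sf_gen insert.IH, of x] by simp
  qed
  thus ?thesis using finext_refl[OF sf_gen] unfolding findisc_def by blast
qed

end

section \<open>Abelian groups\<close>

lemma nmul_add: "nmul (m + n) x = nmul m x + nmul n (x::'a::ab_group_add)"
  by (induction m) (auto simp: add.assoc)

lemma nmul_mult: "nmul (m * n) x = nmul m (nmul n (x::'a::ab_group_add))"
  by (induction m) (auto simp: nmul_add)

lemma nmul_distrib: "nmul n (x + y) = nmul n x + nmul n (y::'a::ab_group_add)"
  by (induction n) (auto simp: algebra_simps)

lemma nmul_0: "nmul n (0::'a::ab_group_add) = 0"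
  by (induction n) auto

lemma zmul_diff_nat: "zmul (int a - int b) x = nmul a x - nmul b (x::'a::ab_group_add)"
proof (cases "b \<le> a")
  case True
  then obtain k where "a = b + k" using le_Suc_ex by blast
  thus ?thesis by (simp add: zmul_def nmul_add)
next
  case False
  then obtain k where "b = a + k" by (metis le_Suc_ex nat_le_linear)
  thus ?thesis using False by (simp add: zmul_def nmul_add)
qed

lemma zmul_int: "zmul (int n) x = nmul n x"
  by (simp add: zmul_def)

lemma zmul_add: "zmul (m + n) x = zmul m x + zmul n x"
proof -
  obtain a b where m: "m = int a - int b" by (rule int_diff_cases)
  obtain c d where n: "n = int c - int d" by (rule int_diff_cases)
  have "m + n = int (a + c) - int (b + d)" unfolding m n by simp
  thus ?thesis unfolding m n by (simp only: zmul_diff_nat nmul_add) (simp add: algebra_simps)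
qed

lemma zmul_distrib: "zmul m (x + y) = zmul m x + zmul m y"
proof -
  obtain a b where m: "m = int a - int b" by (rule int_diff_cases)
  show ?thesis unfolding m zmul_diff_nat nmul_distrib by (simp add: algebra_simps)
qed

lemma zmul_zero: "zmul m (0::'a::ab_group_add) = 0" and zmul_0: "zmul 0 x = 0" and zmul_1: "zmul 1 x = x"
  by (auto simp: zmul_def nmul_0)

lemma zmul_minus_right: "zmul m (- x) = - zmul m x"
  using zmul_distrib[of m x "- x"] by (simp add: zmul_zero eq_neg_iff_add_eq_0 add.commute)

lemma zmul_minus_left: "zmul (- m) x = - zmul m x"
  using zmul_add[of m "- m" x] by (simp add: zmul_0 eq_neg_iff_add_eq_0 add.commute)

lemma zmul_diff: "zmul (m - n) x = zmul m x - zmul n x"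
  using zmul_add[of m "- n" x] by (simp add: zmul_minus_left)

lemma zmul_diff_right: "zmul m (x - y) = zmul m x - zmul m y"
  using zmul_distrib[of m x "- y"] by (simp add: zmul_minus_right)

lemma zmul_mult: "zmul (m * n) x = zmul m (zmul n x)"
proof -
  have pos: "zmul (int k * n) x = zmul (int k) (zmul n x)" for k
  proof (induction k)
    case 0 show ?case by (simp add: zmul_0)
  next
    case (Suc k)
    have "zmul (int (Suc k) * n) x = zmul n x + zmul (int k * n) x"
      by (simp add: zmul_add distrib_right)
    also have "\<dots> = zmul (1 + int k) (zmul n x)" unfolding Suc zmul_add zmul_1 ..
    finally show ?case by simp
  qed
  show ?thesis
    by (cases m) (use pos pos[of "Suc _"] in \<open>simp_all del: of_nat_Suc add: zmul_minus_left\<close>)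
qed

lemma zmul_sum: "zmul m (sum f I) = (\<Sum>i\<in>I. zmul m (f i))"
  by (induction I rule: infinite_finite_induct) (auto simp: zmul_zero zmul_distrib)

lemma zmul_sum_left: "zmul (sum f I) x = (\<Sum>i\<in>I. zmul (f i) x)"
  by (induction I rule: infinite_finite_induct) (auto simp: zmul_0 zmul_add)

lemma sg_0: "is_subgroup G \<Longrightarrow> 0 \<in> G"
  and sg_add: "is_subgroup G \<Longrightarrow> x \<in> G \<Longrightarrow> y \<in> G \<Longrightarrow> x + y \<in> G"
  and sg_minus: "is_subgroup G \<Longrightarrow> x \<in> G \<Longrightarrow> - x \<in> G"
  unfolding is_subgroup_def by auto

lemma sg_diff: "is_subgroup G \<Longrightarrow> x \<in> G \<Longrightarrow> y \<in> G \<Longrightarrow> x - y \<in> G"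
  using sg_add[of G x "- y"] sg_minus[of G y] by simp

lemma sg_nmul: "is_subgroup G \<Longrightarrow> x \<in> G \<Longrightarrow> nmul n x \<in> G"
  by (induction n) (auto simp: sg_0 sg_add)

lemma sg_zmul: "is_subgroup G \<Longrightarrow> x \<in> G \<Longrightarrow> zmul n x \<in> G"
  unfolding zmul_def by (auto simp: sg_nmul sg_minus)

lemma sg_sum: "is_subgroup G \<Longrightarrow> (\<And>i. i \<in> I \<Longrightarrow> f i \<in> G) \<Longrightarrow> sum f I \<in> G"
  by (induction I rule: infinite_finite_induct) (auto simp: sg_0 sg_add)

lemma sg_gen: "is_subgroup (subgroup_gen S)"
  unfolding subgroup_gen_def is_subgroup_def by auto

lemma sg_gen_superset: "S \<subseteq> subgroup_gen S"
  unfolding subgroup_gen_def by auto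

lemma sg_gen_least: "is_subgroup G \<Longrightarrow> S \<subseteq> G \<Longrightarrow> subgroup_gen S \<subseteq> G"
  unfolding subgroup_gen_def by auto

lemma sg_gen_combination:
  assumes "a \<in> subgroup_gen (c ` {..<r::nat})"
  obtains e where "a = (\<Sum>i<r. zmul (e i) (c i))"
proof -
  define G where "G = {\<Sum>i<r. zmul (e i) (c i) | e. True}"
  have "is_subgroup G" unfolding is_subgroup_def
  proof (intro conjI ballI)
    show "0 \<in> G" unfolding G_def by (auto intro!: exI[of _ "\<lambda>_. 0"] simp: zmul_0)
    fix x assume "x \<in> G"
    then obtain e where x: "x = (\<Sum>i<r. zmul (e i) (c i))" unfolding G_def by auto
    show "- x \<in> G" unfolding G_def x
      by (auto intro!: exI[of _ "\<lambda>i. - e i"] simp: zmul_minus_left sum_negf)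
    fix y assume "y \<in> G"
    then obtain f where y: "y = (\<Sum>i<r. zmul (f i) (c i))" unfolding G_def by auto
    show "x + y \<in> G" unfolding G_def x y
      by (auto intro!: exI[of _ "\<lambda>i. e i + f i"] simp: zmul_add sum.distrib)
  qed
  moreover have "c ` {..<r} \<subseteq> G"
  proof
    fix x assume "x \<in> c ` {..<r}"
    then obtain j where j: "j < r" "x = c j" by auto
    have "x = (\<Sum>i<r. if i = j then c j else 0)" using j by simp
    also have "\<dots> = (\<Sum>i<r. zmul (if i = j then 1 else 0) (c i))"
      by (intro sum.cong refl) (auto simp: zmul_0 zmul_1)
    finally show "x \<in> G" unfolding G_def
      by (intro CollectI exI[of _ "\<lambda>i. if i = j then 1 else 0"] conjI TrueI)
  qed
  ultimately have "a \<in> G" using assms sg_gen_least by blast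
  thus ?thesis using that unfolding G_def by auto
qed

lemma fin_gen_enum:
  assumes "fin_gen_subgroup G"
  obtains c and r :: nat where "G = subgroup_gen (c ` {..<r})"
proof -
  obtain S where S: "finite S" "G = subgroup_gen S" using assms unfolding fin_gen_subgroup_def by auto
  obtain n :: nat and c where "S = c ` {i. i < n}"
    using finite_imp_nat_seg_image_inj_on[OF S(1)] by blast
  thus ?thesis using that[of c n] S(2) by (simp add: lessThan_def)
qed

text \<open>The integer vectors whose combination of generators falls into H form a lattice, and its
  generators map to generators of H.\<close>

lemma fin_gen_subgroup_of_fin_gen:
  assumes B: "fin_gen_subgroup B" and H: "is_subgroup H" "H \<subseteq> B"
  shows "fin_gen_subgroup H"
proof -
  obtain b and r :: nat where b: "B = subgroup_gen (b ` {..<r})" using fin_gen_enum[OF B] .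
  define P where "P e \<longleftrightarrow> (\<Sum>i<r. zmul (e i) (b i)) \<in> H" for e
  have Pcomb: "P (\<lambda>i. e i - q * f i)" if "P e" "P f" for e f q
  proof -
    have "(\<Sum>i<r. zmul (e i - q * f i) (b i)) = (\<Sum>i<r. zmul (e i) (b i)) - zmul q (\<Sum>i<r. zmul (f i) (b i))"
      by (simp add: zmul_diff zmul_mult zmul_sum sum_subtractf)
    thus ?thesis using that sg_diff[OF H(1)] sg_zmul[OF H(1)] unfolding P_def by simp
  qed
  obtain s :: nat and g \<gamma> where G: "\<gamma> \<ge> 0 \<and> (\<forall>k<s. P (g k)) \<and> (\<forall>e. P e \<longrightarrow> (\<forall>i\<ge>r. e i = 0) \<longrightarrow>
     (\<exists>n. (\<forall>i. e i = (\<Sum>k<s. n k * g k i)) \<and> (\<forall>k<s. \<bar>n k\<bar> \<le> \<gamma> * (\<Sum>i<r. \<bar>e i\<bar>))))"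
    using lattice_generators[of P r] Pcomb by auto
  define h where "h k = (\<Sum>i<r. zmul (g k i) (b i))" for k
  have "H = subgroup_gen (h ` {..<s})"
  proof
    show "subgroup_gen (h ` {..<s}) \<subseteq> H"
      using G by (intro sg_gen_least H) (auto simp: h_def P_def)
    show "H \<subseteq> subgroup_gen (h ` {..<s})"
    proof
      fix x assume x: "x \<in> H"
      then obtain e0 where e0: "x = (\<Sum>i<r. zmul (e0 i) (b i))"
        using H(2) b sg_gen_combination[of x b r] by blast
      define e where "e i = (if i < r then e0 i else 0)" for i
      have xe: "x = (\<Sum>i<r. zmul (e i) (b i))" unfolding e0 e_def by (intro sum.cong) auto
      hence "P e" unfolding P_def using x by simp
      moreover have "\<forall>i\<ge>r. e i = 0" unfolding e_def by simp
      ultimately obtain n where n: "\<forall>i. e i = (\<Sum>k<s. n k * g k i)" using G by blast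
      have "x = (\<Sum>i<r. \<Sum>k<s. zmul (n k) (zmul (g k i) (b i)))"
        unfolding xe by (intro sum.cong refl) (simp add: n[rule_format] zmul_sum_left zmul_mult)
      also have "\<dots> = (\<Sum>k<s. zmul (n k) (h k))"
        unfolding h_def zmul_sum by (rule sum.swap)
      also have "\<dots> \<in> subgroup_gen (h ` {..<s})"
        using sg_gen_superset[of "h ` {..<s}"] by (intro sg_sum[OF sg_gen] sg_zmul[OF sg_gen]) auto
      finally show "x \<in> subgroup_gen (h ` {..<s})" .
    qed
  qed
  thus ?thesis unfolding fin_gen_subgroup_def by blast
qed

text \<open>Pigeonhole: reduce exponents modulo m and cut the unit cube into D^r boxes.\<close>

lemma fin_gen_of_discrete:
  fixes c :: "nat \<Rightarrow> 'a::ab_group_add"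
  assumes B: "is_subgroup B" and c: "\<And>i. i < r \<Longrightarrow> c i \<in> B"
    and tor: "\<And>b. b \<in> B \<Longrightarrow> \<exists>m>0. \<exists>e. nmul m b = (\<Sum>i<r. zmul (e i) (c i))"
    and disc: "\<And>b m e. b \<in> B \<Longrightarrow> m > 0 \<Longrightarrow> nmul m b = (\<Sum>i<r. zmul (e i) (c i)) \<Longrightarrow>
      (\<And>i. i < r \<Longrightarrow> int D * \<bar>e i\<bar> \<le> int m) \<Longrightarrow> b = 0"
  shows "fin_gen_subgroup B"
proof -
  \<comment> \<open>The number of boxes per coordinate; the summand 1 keeps it positive for D =
    0.\<close>
  define d where "d = int D + 1"
  define red where "red b m e \<longleftrightarrow> m > 0 \<and> nmul m b = (\<Sum>i<r. zmul (e i) (c i)) \<and> (\<forall>i<r. 0 \<le> e i \<and> e i < int m)"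
    for b m e
  define R where "R = {b \<in> B. \<exists>m e. red b m e}"
  have "\<forall>b. \<exists>m e. b \<in> R \<longrightarrow> red b m e" unfolding R_def by auto
  then obtain m e where me: "\<And>b. b \<in> R \<Longrightarrow> red b (m b) (e b)" by metis
  define f where "f b = map (\<lambda>i. d * e b i div int (m b)) [0..<r]" for b
  have "f ` R \<subseteq> {xs. set xs \<subseteq> {0..<d} \<and> length xs = r}"
  proof safe
    fix b x assume b: "b \<in> R" "x \<in> set (f b)"
    then obtain i where i: "i < r" "x = d * e b i div int (m b)" unfolding f_def by auto
    have e: "0 \<le> e b i" "e b i < int (m b)" "m b > 0" using me[OF b(1)] i unfolding red_def by auto
    have "d * e b i < d * int (m b)" using e unfolding d_def by (intro mult_strict_left_mono) auto
    moreover have "x * int (m b) \<le> d * e b i"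
      using div_mult_mod_eq[of "d * e b i" "int (m b)"] pos_mod_sign[of "int (m b)" "d * e b i"] e(3)
      unfolding i(2) by linarith
    ultimately have "x * int (m b) < d * int (m b)" by linarith
    hence "x < d" using e(3) by simp
    moreover have "0 \<le> x" unfolding i(2) using e by (simp add: pos_imp_zdiv_nonneg_iff d_def)
    ultimately show "x \<in> {0..<d}" by simp
  qed (auto simp: f_def)
  hence finfR: "finite (f ` R)" using finite_lists_length_eq[of "{0..<d}" r] finite_subset by blast
  have "inj_on f R"
  proof (rule inj_onI)
    fix b b' assume bb: "b \<in> R" "b' \<in> R" "f b = f b'"
    have r: "red b (m b) (e b)" "red b' (m b') (e b')" using me bb by auto
    \<comment> \<open>Points in one box differ by at most 1/d in each coordinate; cross multiplying
      by m b and m b' brings the difference within the reach of \<open>disc\<close>.\<close>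
    have "b - b' = 0"
    proof (rule disc)
      show "b - b' \<in> B" using bb sg_diff[OF B] unfolding R_def by auto
      show "m b * m b' > 0" using r unfolding red_def by simp
      have n1: "zmul (int (m b)) b = (\<Sum>i<r. zmul (e b i) (c i))"
        and n2: "zmul (int (m b')) b' = (\<Sum>i<r. zmul (e b' i) (c i))"
        using r unfolding red_def zmul_int by auto
      have "nmul (m b * m b') (b - b') = zmul (int (m b')) (zmul (int (m b)) b) - zmul (int (m b)) (zmul (int (m b')) b')"
        unfolding zmul_mult[symmetric] zmul_diff_right[symmetric] zmul_int[symmetric]
        by (simp add: mult.commute zmul_diff_right)
      also have "\<dots> = (\<Sum>i<r. zmul (int (m b') * e b i - int (m b) * e b' i) (c i))"
        unfolding n1 n2 by (simp add: zmul_sum zmul_diff zmul_mult sum_subtractf)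
      finally show "nmul (m b * m b') (b - b') = (\<Sum>i<r. zmul (int (m b') * e b i - int (m b) * e b' i) (c i))" .
      fix i assume i: "i < r"
      have q: "d * e b i div int (m b) = d * e b' i div int (m b')"
        using bb(3) i unfolding f_def by (simp add: list_eq_iff_nth_eq)
      define x where "x = d * e b i div int (m b)"
      have mp: "int (m b) > 0" "int (m b') > 0" using r unfolding red_def by auto
      have b1: "x * int (m b) \<le> d * e b i" "d * e b i < (x + 1) * int (m b)"
        using mp(1) div_mult_mod_eq[of "d * e b i" "int (m b)"] pos_mod_bound[OF mp(1), of "d * e b i"]
          pos_mod_sign[OF mp(1), of "d * e b i"] unfolding x_def distrib_right by linarith+
      have b2: "x * int (m b') \<le> d * e b' i" "d * e b' i < (x + 1) * int (m b')"
        using mp(2) div_mult_mod_eq[of "d * e b' i" "int (m b')"] pos_mod_bound[OF mp(2), of "d * e b' i"]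
          pos_mod_sign[OF mp(2), of "d * e b' i"] unfolding x_def q distrib_right by linarith+
      define M where "M = int (m b) * int (m b')"
      define A1 where "A1 = int (m b') * e b i"
      define A2 where "A2 = int (m b) * e b' i"
      have c1: "x * M \<le> d * A1" "d * A1 \<le> x * M + M"
        using mult_right_mono[OF b1(1), of "int (m b')"] mult_right_mono[OF less_imp_le[OF b1(2)], of "int (m b')"]
        unfolding M_def A1_def by (simp_all add: algebra_simps)
      have c2: "x * M \<le> d * A2" "d * A2 \<le> x * M + M"
        using mult_right_mono[OF b2(1), of "int (m b)"] mult_right_mono[OF less_imp_le[OF b2(2)], of "int (m b)"]
        unfolding M_def A2_def by (simp_all add: algebra_simps)
      have "d * \<bar>A1 - A2\<bar> = \<bar>d * A1 - d * A2\<bar>"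
        unfolding right_diff_distrib[symmetric] abs_mult by (simp add: d_def)
      hence "d * \<bar>A1 - A2\<bar> \<le> M" using c1 c2 by linarith
      moreover have "int D * \<bar>A1 - A2\<bar> \<le> d * \<bar>A1 - A2\<bar>" unfolding d_def by (intro mult_right_mono) auto
      ultimately have "int D * \<bar>A1 - A2\<bar> \<le> M" by linarith
      thus "int D * \<bar>int (m b') * e b i - int (m b) * e b' i\<bar> \<le> int (m b * m b')"
        unfolding A1_def A2_def M_def by simp
    qed
    thus "b = b'" by simp
  qed
  hence finR: "finite R" using finfR by (rule finite_imageD[rotated])
  have "B = subgroup_gen (c ` {..<r} \<union> R)"
  proof
    show "subgroup_gen (c ` {..<r} \<union> R) \<subseteq> B" using c by (intro sg_gen_least B) (auto simp: R_def)
    show "B \<subseteq> subgroup_gen (c ` {..<r} \<union> R)"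
    proof
      fix b assume b: "b \<in> B"
      obtain n g where n: "n > 0" "nmul n b = (\<Sum>i<r. zmul (g i) (c i))" using tor[OF b] by auto
      \<comment> \<open>Subtracting the integral parts moves b into R.\<close>
      define y where "y = (\<Sum>i<r. zmul (g i div int n) (c i))"
      have yB: "y \<in> B" unfolding y_def using c by (intro sg_sum[OF B] sg_zmul[OF B]) auto
      have "nmul n (b - y) = (\<Sum>i<r. zmul (g i mod int n) (c i))"
      proof -
        have "nmul n (b - y) = (\<Sum>i<r. zmul (g i) (c i)) - zmul (int n) y"
          using n(2) by (simp add: zmul_int[symmetric] zmul_diff_right)
        also have "\<dots> = (\<Sum>i<r. zmul (g i - int n * (g i div int n)) (c i))"
          unfolding y_def by (simp add: zmul_sum zmul_diff zmul_mult sum_subtractf)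
        finally show ?thesis by (simp add: minus_mult_div_eq_mod)
      qed
      hence "red (b - y) n (\<lambda>i. g i mod int n)" unfolding red_def using n by simp
      hence "b - y \<in> R" unfolding R_def using sg_diff[OF B b yB] by blast
      hence "b - y \<in> subgroup_gen (c ` {..<r} \<union> R)" using sg_gen_superset by blast
      moreover have "y \<in> subgroup_gen (c ` {..<r} \<union> R)" unfolding y_def
        using sg_gen_superset[of "c ` {..<r} \<union> R"] by (intro sg_sum[OF sg_gen] sg_zmul[OF sg_gen]) auto
      ultimately have "(b - y) + y \<in> subgroup_gen (c ` {..<r} \<union> R)" by (rule sg_add[OF sg_gen])
      thus "b \<in> subgroup_gen (c ` {..<r} \<union> R)" by simp
    qed
  qed
  moreover have "finite (c ` {..<r} \<union> R)" using finR by simp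
  ultimately show ?thesis unfolding fin_gen_subgroup_def by blast
qed

section \<open>The primes of the torsion group A/C\<close>

lemma sg_coprime:
  assumes C: "is_subgroup C" and x: "nmul a x \<in> C" "nmul b x \<in> C" and "coprime a b"
  shows "x \<in> C"
proof -
  obtain u v where uv: "u * int a + v * int b = gcd (int a) (int b)" using bezout_int by blast
  hence "u * int a + v * int b = 1" using assms(4) by simp
  hence "x = zmul (u * int a + v * int b) x" by (simp add: zmul_1)
  also have "\<dots> = zmul u (nmul a x) + zmul v (nmul b x)" by (simp add: zmul_add zmul_mult zmul_int)
  also have "\<dots> \<in> C" using x by (intro sg_add[OF C] sg_zmul[OF C])
  finally show ?thesis .
qed

text \<open>The primes p such that the image of G in A/C has an element of order p. As G need not
  contain C, this makes sense for every term of the minimax series.\<close>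

definition tors_primes :: "'a::ab_group_add set \<Rightarrow> 'a set \<Rightarrow> nat set" where
  "tors_primes C G = {p. prime p \<and> (\<exists>b\<in>G. b \<notin> C \<and> nmul p b \<in> C)}"

text \<open>Multiplication by N prime to p preserves order p modulo C; so if N b agrees modulo C
  with an element of L, the prime p already occurs in L.\<close>

lemma tors_primes_step:
  assumes C: "is_subgroup C" and b: "prime p" "b \<notin> C" "nmul p b \<in> C" and N: "coprime p N"
    and y: "y \<in> L" "nmul N b - y \<in> C"
  shows "p \<in> tors_primes C L"
proof -
  have "nmul N b \<notin> C" using sg_coprime[OF C b(3) _ N] b(2) by blast
  hence "y \<notin> C" using sg_add[OF C y(2), of y] by auto
  moreover have "nmul p y \<in> C"
  proof -
    have "nmul p y = nmul N (nmul p b) - nmul p (nmul N b - y)"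
      by (simp add: zmul_int[symmetric] zmul_diff_right zmul_mult[symmetric] mult.commute)
    thus ?thesis using sg_diff[OF C sg_nmul[OF C b(3)] sg_nmul[OF C y(2)]] by simp
  qed
  ultimately show ?thesis unfolding tors_primes_def using b(1) y(1) by blast
qed

text \<open>Only the divisors of N can be new primes, where N g lies in C: for all others, N b is
  congruent modulo C to an element of L.\<close>

lemma finite_tors_primes_cyclic:
  assumes C: "dense_in C UNIV" and L: "is_subgroup L" and cyc: "cyclic_factor L U"
    and fin: "finite (tors_primes C L)"
  shows "finite (tors_primes C U)"
proof -
  have sC: "is_subgroup C" using C unfolding dense_in_def by auto
  obtain g where g: "g \<in> U" "\<And>x. x \<in> U \<Longrightarrow> \<exists>m. x - zmul m g \<in> L" using cyc unfolding cyclic_factor_def by auto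
  obtain N where N: "N > 0" "nmul N g \<in> C" using C unfolding dense_in_def by auto
  have "tors_primes C U \<subseteq> tors_primes C L \<union> {p. p dvd N}"
  proof
    fix p assume "p \<in> tors_primes C U"
    then obtain b where b: "prime p" "b \<in> U" "b \<notin> C" "nmul p b \<in> C" unfolding tors_primes_def by auto
    show "p \<in> tors_primes C L \<union> {p. p dvd N}"
    proof (cases "p dvd N")
      case False
      hence cop: "coprime p N" using b(1) prime_imp_coprime_nat by blast
      obtain m where m: "b - zmul m g \<in> L" using g(2)[OF b(2)] by auto
      have "nmul N b - nmul N (b - zmul m g) = zmul m (nmul N g)"
        by (simp add: zmul_int[symmetric] zmul_diff_right zmul_mult[symmetric] mult.commute)
      hence "nmul N b - nmul N (b - zmul m g) \<in> C" using sg_zmul[OF sC N(2)] by simp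
      thus ?thesis using tors_primes_step[OF sC b(1,3,4) cop sg_nmul[OF L m]] by blast
    qed simp
  qed
  thus ?thesis using fin N finite_divisors_nat[of N] by (auto intro: finite_subset)
qed

text \<open>Only p0 can be new: some power of p0 takes b into L, and any other prime survives
  multiplication by it.\<close>

lemma finite_tors_primes_quasicyclic:
  assumes C: "dense_in C UNIV" and L: "is_subgroup L" and q: "quasicyclic_factor L U"
    and fin: "finite (tors_primes C L)"
  shows "finite (tors_primes C U)"
proof -
  have sC: "is_subgroup C" using C unfolding dense_in_def by auto
  obtain p0 g where g: "prime p0" "nmul p0 (g 0) \<in> L" "\<And>n. nmul p0 (g (Suc n)) - g n \<in> L"
    "\<And>x. x \<in> U \<Longrightarrow> \<exists>n m. x - zmul m (g n) \<in> L" using q unfolding quasicyclic_factor_def by auto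
  have pow: "nmul (p0 ^ Suc n) (g n) \<in> L" for n
  proof (induction n)
    case 0 thus ?case using g(2) by simp
  next
    case (Suc n)
    have "nmul (p0 ^ Suc (Suc n)) (g (Suc n)) = nmul (p0 ^ Suc n) (nmul p0 (g (Suc n)) - g n) + nmul (p0 ^ Suc n) (g n)"
      unfolding nmul_distrib[symmetric] by (simp add: nmul_mult[symmetric] mult.commute)
    thus ?case using sg_add[OF L sg_nmul[OF L g(3)] Suc] by simp
  qed
  have "tors_primes C U \<subseteq> tors_primes C L \<union> {p0}"
  proof
    fix p assume "p \<in> tors_primes C U"
    then obtain b where b: "prime p" "b \<in> U" "b \<notin> C" "nmul p b \<in> C" unfolding tors_primes_def by auto
    show "p \<in> tors_primes C L \<union> {p0}"
    proof (cases "p = p0")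
      case False
      obtain n m where nm: "b - zmul m (g n) \<in> L" using g(4)[OF b(2)] by auto
      define N where "N = p0 ^ Suc n"
      have cop: "coprime p N" using False b(1) g(1) unfolding N_def
        by (intro coprime_power_right_iff[THEN iffD2] disjI1 primes_coprime) auto
      have "nmul N b = nmul N (b - zmul m (g n)) + zmul m (nmul N (g n))"
        by (simp add: zmul_int[symmetric] zmul_diff_right zmul_mult[symmetric] mult.commute)
      hence "nmul N b \<in> L" using sg_add[OF L sg_nmul[OF L nm] sg_zmul[OF L]] pow[of n] unfolding N_def by metis
      thus ?thesis using tors_primes_step[OF sC b(1,3,4) cop, of "nmul N b" L] sg_0[OF sC] by simp
    qed simp
  qed
  thus ?thesis using fin by (auto intro: finite_subset)
qed

lemma coset_order_props:
  assumes "n > 0" "nmul n a \<in> C"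
  shows "coset_order C a > 0" "nmul (coset_order C a) a \<in> C"
    "\<And>k. k > 0 \<Longrightarrow> nmul k a \<in> C \<Longrightarrow> coset_order C a \<le> k"
  using LeastI[of "\<lambda>n. n > 0 \<and> nmul n a \<in> C" n] assms unfolding coset_order_def
  by (auto intro: Least_le)

lemma finite_pi_quot:
  assumes mm: "minimax TYPE('a::ab_group_add)" and C: "dense_in C (UNIV :: 'a set)"
  shows "finite (pi_quot C)"
proof -
  obtain n and G :: "nat \<Rightarrow> 'a set" where G: "G 0 = {0}" "G n = UNIV" "\<And>i. i \<le> n \<Longrightarrow> is_subgroup (G i)"
    "\<And>i. i < n \<Longrightarrow> cyclic_factor (G i) (G (Suc i)) \<or> quasicyclic_factor (G i) (G (Suc i))"
    using mm unfolding minimax_def by blast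
  have sC: "is_subgroup C" using C unfolding dense_in_def by auto
  have "finite (tors_primes C (G i))" if "i \<le> n" for i
    using that
  proof (induction i)
    case 0
    have "tors_primes C (G 0) = {}" unfolding tors_primes_def G(1) using sg_0[OF sC] by auto
    thus ?case by simp
  next
    case (Suc i)
    thus ?case using G(3)[of i] G(4)[of i] finite_tors_primes_cyclic[OF C] finite_tors_primes_quasicyclic[OF C] by auto
  qed
  hence "finite (tors_primes C UNIV)" using G(2) by (metis le_refl)
  moreover have "pi_quot C \<subseteq> tors_primes C UNIV"
  proof
    fix p assume "p \<in> pi_quot C"
    then obtain a m where p: "prime p" "m > 0" "nmul m a \<in> C" "p dvd coset_order C a" unfolding pi_quot_def by auto
    note co = coset_order_props[OF p(2,3)]
    obtain k where k: "coset_order C a = p * k" using p(4) by auto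
    have k0: "k > 0" "k < coset_order C a" using k co(1) prime_gt_1_nat[OF p(1)] by auto
    have "nmul k a \<notin> C" using co(3)[OF k0(1)] k0(2) by auto
    moreover have "nmul p (nmul k a) \<in> C" using co(2) unfolding k nmul_mult .
    ultimately show "p \<in> tors_primes C UNIV" unfolding tors_primes_def using p(1) by auto
  qed
  ultimately show ?thesis by (rule finite_subset[rotated])
qed

lemma pinum_coset_order:
  assumes "n > 0" "nmul n a \<in> C"
  shows "pinum (pi_quot C) (coset_order C a)"
  unfolding pinum_def using coset_order_props(1)[OF assms] assms unfolding pi_quot_def by auto

section \<open>Group rings and control\<close>

lemma is_ideal_sum:
  assumes "is_ideal I" "\<And>i. i \<in> A \<Longrightarrow> f i \<in> I"
  shows "sum f A \<in> I"
  using assms(2) by (induction A rule: infinite_finite_induct) (use assms(1) in \<open>auto simp: is_ideal_def\<close>)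

lemma ideal_span_subset:
  assumes "is_ideal I" "S \<subseteq> I"
  shows "ideal_span S \<subseteq> I"
proof
  fix x assume "x \<in> ideal_span S"
  then obtain n :: nat and f g where x: "x = (\<Sum>i<n. f i * g i)" "\<forall>i<n. f i \<in> S" unfolding ideal_span_def by auto
  have "f i * g i \<in> I" if "i < n" for i
    using assms x(2) that unfolding is_ideal_def by (metis mult.commute subsetD)
  thus "x \<in> I" unfolding x(1) by (intro is_ideal_sum[OF assms(1)]) simp
qed

lemma ideal_span_sum:
  assumes "finite T" "\<And>t. t \<in> T \<Longrightarrow> f t \<in> S"
  shows "(\<Sum>t\<in>T. f t * g t) \<in> ideal_span S"
proof -
  obtain h where h: "bij_betw h {..<card T} T"
    using ex_bij_betw_nat_finite[OF assms(1)] by (auto simp: atLeast0LessThan)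
  have "(\<Sum>t\<in>T. f t * g t) = (\<Sum>i<card T. f (h i) * g (h i))"
    using sum.reindex_bij_betw[OF h, of "\<lambda>t. f t * g t"] by simp
  moreover have "\<forall>i<card T. f (h i) \<in> S" using h assms(2) unfolding bij_betw_def by auto
  ultimately show ?thesis unfolding ideal_span_def
    by (intro CollectI exI[of _ "card T"] exI[of _ "\<lambda>i. f (h i)"] exI[of _ "\<lambda>i. g (h i)"]) auto
qed

lemma sum_single_lookup: "(\<Sum>a\<in>Poly_Mapping.keys x. Poly_Mapping.single a (Poly_Mapping.lookup x a)) = x"
  by (rule poly_mapping_eqI) (auto simp: lookup_sum lookup_single when_def sum.delta in_keys_iff)

section \<open>Homomorphisms from the group ring to a field\<close>

locale group_ring_hom =
  fixes \<phi> :: "('a::ab_group_add \<Rightarrow>\<^sub>0 'k::field_char_0) \<Rightarrow> 'c::field"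
  assumes add: "\<And>x y. \<phi> (x + y) = \<phi> x + \<phi> y"
    and mult: "\<And>x y. \<phi> (x * y) = \<phi> x * \<phi> y"
    and one: "\<phi> 1 = 1"
begin

definition P where "P = {x. \<phi> x = 0}"
definition emb :: "'a \<Rightarrow> 'c" where "emb a = \<phi> (Poly_Mapping.single a 1)"
definition scal :: "'k \<Rightarrow> 'c" where "scal c = \<phi> (Poly_Mapping.single 0 c)"

lemma zero: "\<phi> 0 = 0"
  by (metis add add_0 add_cancel_right_right)

lemma sum: "\<phi> (sum f I) = (\<Sum>i\<in>I. \<phi> (f i))"
  by (induction I rule: infinite_finite_induct) (auto simp: zero add)

lemma emb_0: "emb 0 = 1"
  unfolding emb_def by (simp add: one)

lemma emb_add: "emb (a + b) = emb a * emb b"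
  unfolding emb_def mult[symmetric] by (simp add: mult_single)

lemma emb_nz: "emb a \<noteq> 0"
  using emb_add[of a "- a"] emb_0 by auto

lemma emb_minus: "emb (- a) = inverse (emb a)"
  using emb_add[of a "- a"] emb_0 by (simp add: inverse_unique)

lemma emb_diff: "emb (a - b) = emb a / emb b"
  using emb_add[of a "- b"] by (simp add: emb_minus divide_inverse)

lemma emb_nmul: "emb (nmul n a) = emb a ^ n"
  by (induction n) (auto simp: emb_0 emb_add)

lemma emb_zmul: "emb (zmul n a) = emb a powi n"
  unfolding zmul_def power_int_def by (auto simp: emb_nmul emb_minus power_inverse)

lemma emb_sum: "emb (sum f I) = (\<Prod>i\<in>I. emb (f i))"
  by (induction I rule: infinite_finite_induct) (auto simp: emb_0 emb_add)

lemma scal_add: "scal (x + y) = scal x + scal y"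
  unfolding scal_def by (simp add: single_add add)

lemma scal_mult: "scal (x * y) = scal x * scal y"
  unfolding scal_def mult[symmetric] by (simp add: mult_single)

lemma scal_1: "scal 1 = 1"
  unfolding scal_def by (simp add: one)

lemma scal_0: "scal 0 = 0"
  by (simp add: scal_def zero)

lemma scal_minus: "scal (- x) = - scal x"
  using scal_add[of x "- x"] by (simp add: scal_0 eq_neg_iff_add_eq_0 add.commute)

lemma scal_inverse: "scal (inverse x) = inverse (scal x)"
proof (cases "x = 0")
  case False
  hence "scal x * scal (inverse x) = 1" unfolding scal_mult[symmetric] by (simp add: scal_1)
  thus ?thesis by (simp add: inverse_unique)
qed (simp add: scal_0)

lemma scal_nz: "x \<noteq> 0 \<Longrightarrow> scal x \<noteq> 0"
  using scal_mult[of x "inverse x"] scal_1 by auto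

lemma char0: "n > 0 \<Longrightarrow> of_nat n \<noteq> (0 :: 'c)"
proof -
  assume n: "n > 0"
  have "scal (of_nat m) = of_nat m" for m
    by (induction m) (auto simp: scal_0 scal_1 scal_add)
  thus ?thesis using scal_nz[of "of_nat n"] n by simp
qed

lemma phi_single: "\<phi> (Poly_Mapping.single a c) = scal c * emb a"
  unfolding scal_def emb_def mult[symmetric] by (simp add: mult_single)

lemma emb_eq_1:
  assumes "faithful P" "emb a = 1"
  shows "a = 0"
proof -
  have "\<phi> (Poly_Mapping.single a 1 - 1) + \<phi> 1 = \<phi> (Poly_Mapping.single a 1)" unfolding add[symmetric] by simp
  hence "\<phi> (Poly_Mapping.single a 1 - 1) = 0" using assms(2) one unfolding emb_def by simp
  thus ?thesis using assms(1) unfolding faithful_def P_def by blast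
qed

lemma P_ideal: "is_ideal P"
  unfolding is_ideal_def P_def by (simp add: zero add mult)

text \<open>The cosets are taken inside X so that independence over \<open>d\<close> can be stated
  for B alone.\<close>

definition indep_mod :: "'c set \<Rightarrow> 'a set \<Rightarrow> 'a set \<Rightarrow> bool" where
  "indep_mod K G X \<longleftrightarrow> (\<forall>I c. finite I \<longrightarrow> I \<subseteq> X \<longrightarrow> (\<forall>a\<in>I. c a \<in> K) \<longrightarrow>
     (\<forall>a\<in>I. \<forall>b\<in>I. a \<noteq> b \<longrightarrow> a - b \<notin> G) \<longrightarrow> (\<Sum>a\<in>I. c a * emb a) = 0 \<longrightarrow> (\<forall>a\<in>I. c a = 0))"

lemma indep_modD:
  assumes "indep_mod K G X" "finite I" "I \<subseteq> X" "\<And>a. a \<in> I \<Longrightarrow> c a \<in> K"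
    "\<And>a b. a \<in> I \<Longrightarrow> b \<in> I \<Longrightarrow> a \<noteq> b \<Longrightarrow> a - b \<notin> G" "(\<Sum>a\<in>I. c a * emb a) = 0" "a \<in> I"
  shows "c a = 0"
  using assms unfolding indep_mod_def by simp

lemma coset_reps:
  assumes G: "is_subgroup G" and I: "finite (I :: 'a set)"
  obtains R where "\<And>a. a \<in> I \<Longrightarrow> R a \<in> I" "\<And>a. a \<in> I \<Longrightarrow> a - R a \<in> G"
    "\<And>s t. s \<in> R ` I \<Longrightarrow> t \<in> R ` I \<Longrightarrow> s \<noteq> t \<Longrightarrow> s - t \<notin> G"
proof -
  define R where "R a = (SOME b. b \<in> I \<and> a - b \<in> G)" for a
  have R: "R a \<in> I \<and> a - R a \<in> G" if "a \<in> I" for a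
    unfolding R_def using that sg_0[OF G] by (intro someI[of "\<lambda>b. b \<in> I \<and> a - b \<in> G" a]) simp
  have eq: "R a = R b" if "a - b \<in> G" for a b
  proof -
    have "a - x \<in> G \<longleftrightarrow> b - x \<in> G" for x
      using sg_add[OF G that, of "b - x"] sg_diff[OF G _ that, of "a - x"] by auto
    thus ?thesis unfolding R_def by simp
  qed
  have "s = t" if st: "s \<in> R ` I" "t \<in> R ` I" "s - t \<in> G" for s t
  proof -
    obtain a b where ab: "a \<in> I" "s = R a" "b \<in> I" "t = R b" using st by auto
    have "R (R a) = R a" "R (R b) = R b" using eq[of a "R a"] eq[of b "R b"] R ab by auto
    thus ?thesis using eq[OF st(3)] ab by simp
  qed
  thus ?thesis using that[of R] R by blast
qed

lemma control_of_indep: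
  assumes G: "is_subgroup G" and K: "is_subfield K" "range scal \<subseteq> K" "emb ` G \<subseteq> K"
    and ind: "indep_mod K G UNIV"
  shows "controls G P"
  unfolding controls_def
proof
  show "ideal_span (P \<inter> group_subring G) \<subseteq> P" by (rule ideal_span_subset[OF P_ideal]) auto
  show "P \<subseteq> ideal_span (P \<inter> group_subring G)"
  proof
    fix x assume x: "x \<in> P"
    let ?I = "Poly_Mapping.keys x"
    obtain R where R: "\<And>a. a \<in> ?I \<Longrightarrow> R a \<in> ?I" "\<And>a. a \<in> ?I \<Longrightarrow> a - R a \<in> G"
      "\<And>s t. s \<in> R ` ?I \<Longrightarrow> t \<in> R ` ?I \<Longrightarrow> s \<noteq> t \<Longrightarrow> s - t \<notin> G"
      using coset_reps[OF G finite_keys] by blast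
    \<comment> \<open>The part of x in the coset of t, translated into kG. Its image lies in K
      because both k and G are mapped into K.\<close>
    define y where "y t = (\<Sum>a\<in>{a\<in>?I. R a = t}. Poly_Mapping.single (a - t) (Poly_Mapping.lookup x a))" for t
    have "x = (\<Sum>a\<in>?I. Poly_Mapping.single a (Poly_Mapping.lookup x a))" by (rule sum_single_lookup[symmetric])
    also have "\<dots> = (\<Sum>t\<in>R ` ?I. \<Sum>a\<in>{a\<in>?I. R a = t}. Poly_Mapping.single a (Poly_Mapping.lookup x a))"
      by (rule sum.image_gen) simp
    also have "\<dots> = (\<Sum>t\<in>R ` ?I. y t * Poly_Mapping.single t 1)"
      unfolding y_def sum_distrib_right by (intro sum.cong refl) (simp add: mult_single)
    finally have xy: "x = (\<Sum>t\<in>R ` ?I. y t * Poly_Mapping.single t 1)" .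
    have yG: "y t \<in> group_subring G" for t
    proof -
      have "Poly_Mapping.keys (y t) \<subseteq> (\<Union>a\<in>{a\<in>?I. R a = t}. Poly_Mapping.keys (Poly_Mapping.single (a - t) (Poly_Mapping.lookup x a)))"
        unfolding y_def by (rule keys_sum)
      also have "\<dots> \<subseteq> G" using R(2) by (auto split: if_splits)
      finally show ?thesis unfolding group_subring_def by simp
    qed
    have yK: "\<phi> (y t) \<in> K" for t
      unfolding y_def sum phi_single using K R(2)
      by (intro sf_sum[OF K(1)] sf_mult[OF K(1)]) auto
    have "(\<Sum>t\<in>R ` ?I. \<phi> (y t) * emb t) = \<phi> x" by (subst xy) (simp add: sum mult emb_def)
    hence "(\<Sum>t\<in>R ` ?I. \<phi> (y t) * emb t) = 0" using x unfolding P_def by simp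
    hence "\<phi> (y t) = 0" if "t \<in> R ` ?I" for t
      by (rule indep_modD[OF ind, rotated 4]) (use yK R(3) that in simp_all)
    hence "\<And>t. t \<in> R ` ?I \<Longrightarrow> y t \<in> P \<inter> group_subring G" using yG unfolding P_def by auto
    thus "x \<in> ideal_span (P \<inter> group_subring G)"
      by (subst xy) (intro ideal_span_sum, auto)
  qed
qed

text \<open>As for bases in a tower of fields: collecting terms by cosets of B gives coefficients in
  s, which vanish, and within one coset a translation by its representative leads back to B.\<close>

lemma indep_mod_trans:
  assumes B: "is_subgroup B" and s: "is_subfield s" "emb ` B \<subseteq> s" "d \<subseteq> s"
    and i1: "indep_mod s B UNIV" and i2: "indep_mod d H B"
  shows "indep_mod d H UNIV"
  unfolding indep_mod_def
proof (intro allI impI)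
  fix I c assume I: "finite I" "\<forall>a\<in>I. c a \<in> d" "\<forall>a\<in>I. \<forall>b\<in>I. a \<noteq> b \<longrightarrow> a - b \<notin> H"
    "(\<Sum>a\<in>I. c a * emb a) = 0"
  obtain R where R: "\<And>a. a \<in> I \<Longrightarrow> R a \<in> I" "\<And>a. a \<in> I \<Longrightarrow> a - R a \<in> B"
    "\<And>s t. s \<in> R ` I \<Longrightarrow> t \<in> R ` I \<Longrightarrow> s \<noteq> t \<Longrightarrow> s - t \<notin> B"
    using coset_reps[OF B I(1)] by blast
  define y where "y t = (\<Sum>a\<in>{a\<in>I. R a = t}. c a * emb (a - t))" for t
  have "(\<Sum>a\<in>I. c a * emb a) = (\<Sum>t\<in>R ` I. \<Sum>a\<in>{a\<in>I. R a = t}. c a * emb a)"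
    by (rule sum.image_gen) (rule I)
  also have "\<dots> = (\<Sum>t\<in>R ` I. y t * emb t)"
    unfolding y_def sum_distrib_right by (intro sum.cong refl) (simp add: emb_diff emb_nz)
  finally have ys: "(\<Sum>t\<in>R ` I. y t * emb t) = 0" using I(4) by simp
  have "y t \<in> s" for t unfolding y_def using I(2) s R(2)
    by (intro sf_sum[OF s(1)] sf_mult[OF s(1)]) auto
  hence y0: "y t = 0" if "t \<in> R ` I" for t
    by (intro indep_modD[OF i1 _ _ _ _ ys that]) (use I(1) R(3) in auto)
  show "\<forall>a\<in>I. c a = 0"
  proof
    fix a assume a: "a \<in> I"
    define t where "t = R a"
    define J where "J = {a\<in>I. R a = t}"
    have fJ: "finite J" unfolding J_def using I(1) by simp
    have inj: "inj_on (\<lambda>a. a - t) J" by (auto simp: inj_on_def)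
    have "(\<Sum>b\<in>(\<lambda>a. a - t) ` J. c (b + t) * emb b) = y t"
      unfolding y_def J_def[symmetric] by (subst sum.reindex[OF inj]) simp
    hence z: "(\<Sum>b\<in>(\<lambda>a. a - t) ` J. c (b + t) * emb b) = 0" using y0 a unfolding t_def by simp
    have aJ: "a - t \<in> (\<lambda>a. a - t) ` J" unfolding J_def t_def using a by simp
    have "c ((a - t) + t) = 0"
    proof (rule indep_modD[OF i2 _ _ _ _ z aJ])
      show "finite ((\<lambda>a. a - t) ` J)" using fJ by simp
      show "(\<lambda>a. a - t) ` J \<subseteq> B" unfolding J_def using R(2) by auto
      show "c (b + t) \<in> d" if "b \<in> (\<lambda>a. a - t) ` J" for b using that I(2) unfolding J_def by auto
      show "b - b' \<notin> H" if bb: "b \<in> (\<lambda>a. a - t) ` J" "b' \<in> (\<lambda>a. a - t) ` J" "b \<noteq> b'" for b b'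
        using bb I(3) unfolding J_def by auto
    qed
    thus "c a = 0" by simp
  qed
qed

text \<open>Differences in A become quotients in the field, so cosets of this subgroup are classes
  of radicals up to proportionality over K.\<close>

lemma indep_mod_radical:
  assumes cf: "closed_field0 TYPE('c)" and kum: "closed_field0.kum \<pi> K L"
    and X: "emb ` X \<subseteq> L" and rad: "\<And>a. a \<in> X \<Longrightarrow> \<exists>m. pinum \<pi> m \<and> emb a ^ m \<in> K"
  shows "indep_mod K {a. emb a \<in> K} X"
  unfolding indep_mod_def
proof (intro allI impI)
  fix I c assume I: "finite I" "I \<subseteq> X" "\<forall>a\<in>I. c a \<in> K" "\<forall>a\<in>I. \<forall>b\<in>I. a \<noteq> b \<longrightarrow> a - b \<notin> {a. emb a \<in> K}"
    "(\<Sum>a\<in>I. c a * emb a) = 0"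
  obtain m where m: "\<And>a. a \<in> X \<Longrightarrow> pinum \<pi> (m a) \<and> emb a ^ m a \<in> K" using rad by metis
  show "\<forall>a\<in>I. c a = 0"
    by (rule closed_field0.radical_independent[OF cf kum I(1), of emb m])
      (use X I m in \<open>auto simp: emb_nz emb_diff\<close>)
qed

end

section \<open>Radicals in fields generated by roots of unity\<close>

context closed_field0
begin

lemma finite_roots_of_unity: "m > 0 \<Longrightarrow> finite {z :: 'c. z ^ m = 1}"
proof -
  assume m: "m > 0"
  define f :: "'c poly" where "f = monom 1 m - 1"
  have "coeff f m = 1" unfolding f_def using m by simp
  hence "f \<noteq> 0" by auto
  hence "finite {z. poly f z = 0}" by (rule poly_roots_finite)
  moreover have "{z. poly f z = 0} = {z. z ^ m = 1}" unfolding f_def by (simp add: poly_monom)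
  ultimately show ?thesis by simp
qed

text \<open>This is K with all roots of unity of orders composed of primes in \<pi> adjoined. Two
  elements from the spans for m and n are added and multiplied in the span for m * n.\<close>

lemma root_adjunction_subfield:
  assumes K: "is_subfield (K :: 'c set)"
  shows "is_subfield (\<Union>m\<in>{m. pinum \<pi> m}. kspan K {z. z ^ m = 1})" (is "is_subfield ?W")
proof (rule sf_of_algebraic[OF K])
  have fin: "finite {z :: 'c. z ^ m = 1}" if "pinum \<pi> m" for m
    using finite_roots_of_unity that unfolding pinum_def by auto
  have mono: "kspan K {z. z ^ m = 1} \<subseteq> kspan K {z. z ^ (m * n) = 1}"
    "kspan K {z. z ^ n = 1} \<subseteq> kspan K {z. z ^ (m * n) = 1}" if "pinum \<pi> m" "pinum \<pi> n" for m n
  proof -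
    have "{z :: 'c. z ^ m = 1} \<subseteq> {z. z ^ (m * n) = 1}" by (auto simp: power_mult)
    thus "kspan K {z. z ^ m = 1} \<subseteq> kspan K {z. z ^ (m * n) = 1}"
      by (rule kspan_mono[OF K fin[OF pinum_mult[OF that]]])
    have "{z :: 'c. z ^ n = 1} \<subseteq> {z. z ^ (m * n) = 1}"
      unfolding mult.commute[of m n] by (auto simp: power_mult)
    thus "kspan K {z. z ^ n = 1} \<subseteq> kspan K {z. z ^ (m * n) = 1}"
      by (rule kspan_mono[OF K fin[OF pinum_mult[OF that]]])
  qed
  have prod: "x * y \<in> kspan K {z. z ^ m = 1}"
    if "pinum \<pi> m" "x \<in> kspan K {z. z ^ m = 1}" "y \<in> kspan K {z. z ^ m = 1}" for x y m
  proof -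
    have "(\<lambda>(a, b). a * b) ` ({z. z ^ m = 1} \<times> {z. z ^ m = 1}) \<subseteq> {z :: 'c. z ^ m = 1}"
      by (auto simp: power_mult_distrib)
    thus ?thesis
      using kspan_mult[OF K fin[OF that(1)] fin[OF that(1)] that(2,3)] kspan_mono[OF K fin[OF that(1)]] by blast
  qed
  have p1: "pinum \<pi> 1" unfolding pinum_def by auto
  have one: "1 \<in> kspan K {z. z ^ m = 1}" if "pinum \<pi> m" for m
    by (rule kspan_base[OF K fin[OF that]]) simp
  show "K \<subseteq> ?W" using one[OF p1] kspan_scale[OF K, of _ 1 "{z. z ^ 1 = 1}"] p1 by fastforce
  show "x + y \<in> ?W" "x * y \<in> ?W" if xy: "x \<in> ?W" "y \<in> ?W" for x y
  proof -
    obtain m n where mn: "pinum \<pi> m" "x \<in> kspan K {z. z ^ m = 1}" "pinum \<pi> n" "y \<in> kspan K {z. z ^ n = 1}"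
      using xy by auto
    have mn': "pinum \<pi> (m * n)" "m * n \<in> {m. pinum \<pi> m}" using pinum_mult[OF mn(1,3)] by auto
    have xy': "x \<in> kspan K {z. z ^ (m * n) = 1}" "y \<in> kspan K {z. z ^ (m * n) = 1}"
      using mono[OF mn(1,3)] mn by auto
    show "x + y \<in> ?W" by (rule UN_I[OF mn'(2)]) (rule kspan_add[OF K xy'])
    show "x * y \<in> ?W" by (rule UN_I[OF mn'(2)]) (rule prod[OF mn'(1) xy'])
  qed
  show "alg_over K x" if x: "x \<in> ?W" for x
  proof -
    obtain m where m: "pinum \<pi> m" "x \<in> kspan K {z. z ^ m = 1}" using x by auto
    have "x ^ i \<in> kspan K {z. z ^ m = 1}" for i
      by (induction i) (use one prod m in auto)
    from alg_of_kspan[OF K fin[OF m(1)] this] show ?thesis unfolding alg_over_def[OF K] by blast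
  qed
qed

text \<open>Write x with as few roots of unity as possible; these are then pairwise not proportional
  over K. Were x proportional to none of them, its expression would be a forbidden relation between
  radicals.\<close>

lemma radical_in_root_adjunction:
  assumes kum: "kum \<pi> K UNIV"
    and x: "x \<in> subfield_gen (K \<union> {z. \<exists>m. pinum \<pi> m \<and> z ^ m = 1})" "x \<noteq> 0" "pinum \<pi> m" "x ^ m \<in> K"
  obtains k z where "k \<in> K" "tors z" "x = k * z"
proof -
  have K: "is_subfield K" using kum unfolding kum_def by auto
  let ?W = "\<Union>m\<in>{m. pinum \<pi> m}. kspan K {z. z ^ m = 1}"
  have fin: "finite {z :: 'c. z ^ m = 1}" if "pinum \<pi> m" for m
    using finite_roots_of_unity that unfolding pinum_def by auto
  have p1: "pinum \<pi> 1" unfolding pinum_def by auto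
  have "K \<subseteq> ?W"
    using kspan_base[OF K fin[OF p1], of 1] kspan_scale[OF K, of _ 1 "{z. z ^ 1 = 1}"] p1 by fastforce
  moreover have "{z. \<exists>m. pinum \<pi> m \<and> z ^ m = 1} \<subseteq> ?W" using kspan_base[OF K fin] by blast
  ultimately have "x \<in> ?W"
    using sf_gen_least[OF root_adjunction_subfield[OF K], of "K \<union> {z. \<exists>m. pinum \<pi> m \<and> z ^ m = 1}" \<pi>] x(1) by blast
  then obtain n where n: "pinum \<pi> n" "x \<in> kspan K {z. z ^ n = 1}" by auto
  obtain Z where Z: "Z \<subseteq> {z. z ^ n = 1} \<and> x \<in> kspan K Z"
    "\<And>Z'. Z' \<subseteq> {z. z ^ n = 1} \<and> x \<in> kspan K Z' \<Longrightarrow> card Z \<le> card Z'"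
    using ex_has_least_nat[of "\<lambda>Z. Z \<subseteq> {z. z ^ n = 1} \<and> x \<in> kspan K Z" "{z. z ^ n = 1}" card] n(2) by blast
  have finZ: "finite Z" using Z(1) fin[OF n(1)] finite_subset by blast
  have n0: "n > 0" using n(1) unfolding pinum_def by simp
  have Znz: "z \<noteq> 0" if "z \<in> Z" for z using Z(1) that n0 by (auto simp: power_0_left)
  have tz: "tors z" if "z \<in> Z" for z unfolding tors_def using Z(1) that n0 by auto
  have "\<exists>z\<in>Z. x / z \<in> K"
  proof (rule ccontr)
    assume no: "\<not> ?thesis"
    have xZ: "x \<notin> Z" using no x(2) sf_1[OF K] by force
    have nonprop: "z / z' \<notin> K" if zz: "z \<in> Z" "z' \<in> Z" "z \<noteq> z'" for z z'
    proof
      assume q: "z / z' \<in> K"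
      have f1: "finite (Z - {z})" using finZ by simp
      have "x \<in> kspan K (Z - {z})"
      proof (rule kspan_least[OF K conjunct2[OF Z(1)]])
        show "0 \<in> kspan K (Z - {z})" by (rule kspan_0[OF K])
        show "u + v \<in> kspan K (Z - {z})" if "u \<in> kspan K (Z - {z})" "v \<in> kspan K (Z - {z})" for u v
          using that by (rule kspan_add[OF K])
        show "c * s \<in> kspan K (Z - {z})" if cs: "c \<in> K" "s \<in> Z" for c s
        proof (cases "s = z")
          case True
          have "c * s = (c * (z / z')) * z'" using True Znz[OF zz(2)] by simp
          moreover have "(c * (z / z')) * z' \<in> kspan K (Z - {z})"
            using zz by (intro kspan_scale[OF K] sf_mult[OF K] kspan_base[OF K f1] cs q) auto
          ultimately show ?thesis by (simp only:)
        next
          case False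
          thus ?thesis using cs by (intro kspan_scale[OF K] kspan_base[OF K f1]) auto
        qed
      qed
      moreover have "Z - {z} \<subseteq> {z. z ^ n = 1}" using Z(1) by auto
      ultimately have "card Z \<le> card (Z - {z})" using Z(2)[of "Z - {z}"] by simp
      thus False using card_Diff1_less[OF finZ zz(1)] by linarith
    qed
    obtain k where k: "x = (\<Sum>s\<in>Z. k s * s)" "\<forall>s. k s \<in> K" using kspanE[OF K conjunct2[OF Z(1)]] .
    \<comment> \<open>The expression of x, read as a relation whose coefficient at x is 1.\<close>
    have "\<forall>i\<in>insert x Z. (if i = x then 1 else - k i) = (0::'c)"
    proof (rule radical_independent[OF kum, of _ "\<lambda>i. i" "\<lambda>i. if i = x then m else n"])
      show "finite (insert x Z)" using finZ by simp
      fix i assume i: "i \<in> insert x Z"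
      show "i \<in> UNIV" by simp
      show "i \<noteq> 0" using i x(2) Znz by auto
      show "pinum \<pi> (if i = x then m else n)" using x(3) n(1) by simp
      show "i ^ (if i = x then m else n) \<in> K" using i x(4) Z(1) sf_1[OF K] by auto
      show "(if i = x then 1 else - k i) \<in> K" using k(2) sf_1[OF K] sf_minus[OF K] by auto
    next
      fix i j assume ij: "i \<in> insert x Z" "j \<in> insert x Z" "i \<noteq> j"
      show "i / j \<notin> K"
      proof
        assume q: "i / j \<in> K"
        hence q': "j / i \<in> K" using sf_inverse[OF K q] by simp
        show False using ij q q' no nonprop by auto
      qed
    next
      have "(\<Sum>i\<in>Z. (if i = x then 1 else - k i) * i) = - x"
        unfolding k(1) sum_negf[symmetric] using xZ unfolding k(1) by (intro sum.cong) auto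
      thus "(\<Sum>i\<in>insert x Z. (if i = x then 1 else - k i) * i) = 0" using finZ xZ by simp
    qed
    thus False by (metis insertI1 zero_neq_one)
  qed
  then obtain z where "z \<in> Z" "x / z \<in> K" by auto
  thus ?thesis using that[of "x / z" z] tz Znz by simp
qed

end

text \<open>The map \<phi> is the projection of kA onto R followed by the inclusion of R in an
  algebraically closed field containing h, so all fields are subsets of 'c. Elements of A have
  nonzero images, hence intersections with multiplicative groups become preimages under
  \<open>emb\<close>.\<close>

theorem theorem3p3:
  fixes P :: "('a::ab_group_add \<Rightarrow>\<^sub>0 'k::field_char_0) set"
    and \<phi> :: "('a \<Rightarrow>\<^sub>0 'k) \<Rightarrow> 'c::field"
    and C D :: "'a set"
    and i4 :: 'c
  assumes k_fg: "fin_gen_field TYPE('k)"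
    and A_tf: "torsion_free TYPE('a)"
    and A_minimax: "minimax TYPE('a)"
    and P_prime: "is_prime_ideal P"
    and P_faithful: "faithful P"
    and \<Omega>_closed: "alg_closed TYPE('c)"
    and \<phi>_add: "\<And>x y. \<phi> (x + y) = \<phi> x + \<phi> y"
    and \<phi>_mult: "\<And>x y. \<phi> (x * y) = \<phi> x * \<phi> y"
    and \<phi>_one: "\<phi> 1 = 1"
    and \<phi>_ker: "{x. \<phi> x = 0} = P"
    and C_fg: "fin_gen_subgroup C"
    and C_dense: "dense_in C UNIV"
    and i4_prim: "i4 ^ 2 = - 1"
    and D_dense: "dense_in D C"
  defines "kk \<equiv> (\<lambda>c. \<phi> (Poly_Mapping.single 0 c)) ` UNIV"
    and "emb \<equiv> (\<lambda>a. \<phi> (Poly_Mapping.single a 1))"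
    and "\<tau> \<equiv> {x. \<exists>p n. p \<in> pi_quot C \<and> n > 0 \<and> x ^ (p ^ n) = 1} \<union> {i4}"
  defines "s \<equiv> subfield_gen (kk \<union> \<tau> \<union> emb ` C)"
  defines "B \<equiv> {a. emb a \<in> s}"
    and "d \<equiv> subfield_gen (kk \<union> emb ` D \<union> roots_of_unity_in s)"
  defines "H \<equiv> {a. emb a \<in> d}"
  shows "fin_gen_subgroup B \<and> dense_in B UNIV \<and> fin_gen_subgroup H \<and> dense_in H UNIV
         \<and> H \<subseteq> B \<and> controls B P \<and> controls H P"
proof -
  interpret gr: group_ring_hom \<phi> by unfold_locales (rule \<phi>_add \<phi>_mult \<phi>_one)+
  interpret cf: closed_field0 "TYPE('c)" by unfold_locales (rule \<Omega>_closed, rule gr.char0)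
  have P: "gr.P = P" unfolding gr.P_def using \<phi>_ker .
  have emb: "emb = gr.emb" unfolding emb_def gr.emb_def ..
  have kk: "kk = range gr.scal" unfolding kk_def gr.scal_def ..
  define \<pi> where "\<pi> = pi_quot C"
  have \<pi>p: "p \<in> \<pi> \<Longrightarrow> prime p" for p unfolding \<pi>_def pi_quot_def by auto
  have fin\<pi>: "finite \<pi>" unfolding \<pi>_def by (rule finite_pi_quot[OF A_minimax C_dense])
  have sC: "is_subgroup C" and DC: "D \<subseteq> C"
    using C_dense D_dense unfolding dense_in_def by auto
  have ss: "is_subfield s" and sd: "is_subfield d" unfolding s_def d_def by (rule sf_gen)+
  have s_sup: "kk \<subseteq> s" "\<tau> \<subseteq> s" "emb ` C \<subseteq> s" using sf_gen_superset[of "kk \<union> \<tau> \<union> emb ` C"] unfolding s_def by auto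
  have d_sup: "kk \<subseteq> d" "emb ` D \<subseteq> d" "roots_of_unity_in s \<subseteq> d"
    using sf_gen_superset[of "kk \<union> emb ` D \<union> roots_of_unity_in s"] unfolding d_def by auto
  have "emb ` D \<subseteq> s" using s_sup(3) DC by blast
  hence ds: "d \<subseteq> s" unfolding d_def using s_sup(1) ss
    by (intro sf_gen_least) (auto simp: roots_of_unity_in_def)
  have subg: "is_subgroup {a. emb a \<in> M}" if "is_subfield M" for M
    unfolding is_subgroup_def emb
    using that by (auto simp: gr.emb_0 gr.emb_add gr.emb_minus sf_1 sf_mult sf_inverse)
  have sB: "is_subgroup B" and sH: "is_subgroup H" unfolding B_def H_def using subg ss sd by auto
  have HB: "H \<subseteq> B" unfolding H_def B_def using ds by auto
  have CB: "C \<subseteq> B" and DH: "D \<subseteq> H" unfolding B_def H_def using s_sup d_sup by auto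
  have C_ex: "\<exists>n>0. nmul n a \<in> C" for a using C_dense unfolding dense_in_def by auto
  have D_ex: "\<exists>n>0. nmul n a \<in> D" for a
  proof -
    obtain n where n: "n > 0" "nmul n a \<in> C" using C_ex by auto
    obtain m where m: "m > 0" "nmul m (nmul n a) \<in> D" using D_dense n(2) unfolding dense_in_def by auto
    show ?thesis using n m by (intro exI[of _ "m * n"]) (simp add: nmul_mult)
  qed
  have denseB: "dense_in B UNIV" and denseH: "dense_in H UNIV"
    unfolding dense_in_def using sB sH C_ex D_ex CB DH by blast+
  \<comment> \<open>Every element of A is a radical over any field containing the image of C, with
    an exponent composed of primes in \<pi>.\<close>
  have co: "pinum \<pi> (coset_order C a)" "nmul (coset_order C a) a \<in> C" for a
    using C_ex[of a] pinum_coset_order[of _ a C] coset_order_props(2)[of _ a C] unfolding \<pi>_def by auto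
  have \<tau>root: "z \<in> \<tau>" if "p \<in> \<pi>" "z ^ p = 1" for p z
  proof -
    have "p \<in> pi_quot C \<and> (1::nat) > 0 \<and> z ^ (p ^ 1) = 1" using that unfolding \<pi>_def by simp
    thus ?thesis unfolding \<tau>_def by blast
  qed
  have i4: "i4 \<in> \<tau>" unfolding \<tau>_def by simp
  have i4r: "i4 ^ 4 = 1"
  proof -
    have "i4 ^ 4 = (i4 ^ 2) ^ 2" by (simp add: power_mult[symmetric])
    thus ?thesis using i4_prim by simp
  qed
  have "i4 \<in> roots_of_unity_in s" unfolding roots_of_unity_in_def
    using s_sup(2) i4 i4r by (auto intro!: exI[of _ "4::nat"])
  hence i4d: "i4 \<in> d" using d_sup(3) by auto

  have kum_s: "cf.kum \<pi> s UNIV"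
    unfolding cf.kum_def using ss sf_UNIV i4_prim i4 s_sup(2) \<tau>root by blast
  have indB: "gr.indep_mod s B UNIV"
    unfolding B_def emb
  proof (rule gr.indep_mod_radical[OF cf.closed_field0_axioms kum_s])
    fix a :: 'a
    have "gr.emb a ^ coset_order C a \<in> s"
      using co(2)[of a] s_sup(3) unfolding gr.emb_nmul[symmetric] emb by auto
    thus "\<exists>m. pinum \<pi> m \<and> gr.emb a ^ m \<in> s" using co(1) by blast
  qed simp
  \<comment> \<open>Orders modulo D may involve any primes, so all primes are allowed here; inside
    \<open>s\<close> this is possible because \<open>d\<close> contains every root of unity of
    \<open>s\<close>.\<close>
  have kum_d: "cf.kum UNIV d s"
  proof -
    have "z \<in> d" if "prime p" "z \<in> s" "z ^ p = 1" for p :: nat and z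
      using d_sup(3) that prime_gt_0_nat[of p] unfolding roots_of_unity_in_def by auto
    thus ?thesis unfolding cf.kum_def using ss sd ds i4d i4_prim by blast
  qed
  have indH: "gr.indep_mod d H B"
    unfolding H_def emb
  proof (rule gr.indep_mod_radical[OF cf.closed_field0_axioms kum_d])
    show "gr.emb ` B \<subseteq> s" unfolding B_def emb by auto
    fix a assume "a \<in> B"
    obtain n where n: "n > 0" "nmul n a \<in> D" using D_ex by auto
    hence "gr.emb a ^ n \<in> d" using d_sup(2) unfolding gr.emb_nmul[symmetric] emb by auto
    thus "\<exists>m. pinum UNIV m \<and> gr.emb a ^ m \<in> d" using n(1) unfolding pinum_def by auto
  qed
  have controlB: "controls B P"
    using gr.control_of_indep[OF sB ss _ _ indB] s_sup(1) unfolding P kk B_def emb by auto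
  have "gr.indep_mod d H UNIV"
    by (rule gr.indep_mod_trans[OF sB ss _ ds indB indH]) (auto simp: B_def emb)
  hence controlH: "controls H P"
    using gr.control_of_indep[OF sH sd] d_sup(1) unfolding P kk H_def emb by auto

  obtain c and r :: nat where c: "C = subgroup_gen (c ` {..<r})" using fin_gen_enum[OF C_fg] .
  have cC: "c i \<in> C" if "i < r" for i using sg_gen_superset[of "c ` {..<r}"] that unfolding c by auto
  obtain S where S: "finite (S :: 'k set)" "subfield_gen S = UNIV" using k_fg unfolding fin_gen_field_def by auto
  \<comment> \<open>Only the p-th roots of unity are taken, not those of order p^n, so that G is
    finite; they suffice for the Kummer condition.\<close>
  define G where "G = gr.scal ` S \<union> gr.emb ` c ` {..<r} \<union> (\<Union>p\<in>\<pi>. {z. z ^ p = 1}) \<union> {i4}"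
  have finG: "finite G" unfolding G_def
    using S(1) fin\<pi> cf.finite_roots_of_unity prime_gt_0_nat \<pi>p by auto
  define K where "K = subfield_gen G"
  have K: "is_subfield K" unfolding K_def by (rule sf_gen)
  have GK: "G \<subseteq> K" unfolding K_def by (rule sf_gen_superset)
  have discK: "disc K" unfolding K_def by (rule cf.disc_fin_gen[OF finG])
  have kkK: "kk \<subseteq> K"
  proof -
    have "is_subfield {x. gr.scal x \<in> K}" unfolding is_subfield_def
      using K by (auto simp: gr.scal_0 gr.scal_1 gr.scal_add gr.scal_mult gr.scal_minus gr.scal_inverse
          sf_0 sf_1 sf_add sf_mult sf_minus sf_inverse)
    moreover have "S \<subseteq> {x. gr.scal x \<in> K}" using GK unfolding G_def by auto
    ultimately have "UNIV \<subseteq> {x. gr.scal x \<in> K}" using sf_gen_least S(2) by metis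
    thus ?thesis unfolding kk by auto
  qed
  have CK: "emb ` C \<subseteq> K"
  proof -
    have "C \<subseteq> {a. emb a \<in> K}" unfolding c
      using GK by (intro sg_gen_least subg[OF K]) (auto simp: G_def emb)
    thus ?thesis by auto
  qed
  have kum_K: "cf.kum \<pi> K UNIV"
    unfolding cf.kum_def using K sf_UNIV i4_prim GK unfolding G_def by blast
  \<comment> \<open>The roots of order p^n that K misses lie in the extension treated by
    \<open>radical_in_root_adjunction\<close>, so that extension contains \<open>s\<close>.\<close>
  have "\<tau> \<subseteq> K \<union> {z. \<exists>m. pinum \<pi> m \<and> z ^ m = 1}"
  proof
    fix x assume "x \<in> \<tau>"
    then consider "x = i4" | p n where "p \<in> \<pi>" "n > 0" "x ^ (p ^ n) = 1" unfolding \<tau>_def \<pi>_def by auto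
    thus "x \<in> K \<union> {z. \<exists>m. pinum \<pi> m \<and> z ^ m = 1}"
    proof cases
      case 1 thus ?thesis using GK unfolding G_def by auto
    next
      case 2
      have "pinum \<pi> (p ^ n)" unfolding pinum_def
      proof (intro conjI allI impI)
        show "p ^ n > 0" using \<pi>p[OF 2(1)] prime_gt_0_nat by simp
        fix q assume "prime q" "q dvd p ^ n"
        hence "q = p" using \<pi>p[OF 2(1)] by (metis prime_dvd_power primes_dvd_imp_eq)
        thus "q \<in> \<pi>" using 2 by simp
      qed
      thus ?thesis using 2(3) by auto
    qed
  qed
  hence s_sub: "s \<subseteq> subfield_gen (K \<union> {z. \<exists>m. pinum \<pi> m \<and> z ^ m = 1})"
    unfolding s_def using kkK CK by (intro sf_gen_mono) auto

  define q where "q i = gr.emb (c i)" for i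
  have q: "\<forall>i<r. q i \<in> K \<and> q i \<noteq> 0" unfolding q_def using cC CK gr.emb_nz emb by auto
  obtain N :: nat where N: "\<And>u m z e. u \<in> K \<Longrightarrow> m > 0 \<Longrightarrow> tors z \<Longrightarrow>
        u ^ m = z * (\<Prod>i<r. q i powi e i) \<Longrightarrow> (\<forall>i<r. int N * \<bar>e i\<bar> \<le> int m) \<Longrightarrow> tors u"
    using discK[unfolded disc_def, rule_format, of r q] q by blast
  have fgB: "fin_gen_subgroup B"
  proof (rule fin_gen_of_discrete[OF sB, of r c N])
    show "c i \<in> B" if "i < r" for i using cC[OF that] CB by auto
    show "\<exists>m>0. \<exists>e. nmul m b = (\<Sum>i<r. zmul (e i) (c i))" if "b \<in> B" for b
    proof -
      obtain m where m: "m > 0" "nmul m b \<in> C" using C_ex by auto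
      obtain e where "nmul m b = (\<Sum>i<r. zmul (e i) (c i))"
        using sg_gen_combination[OF m(2)[unfolded c]] .
      thus ?thesis using m(1) by blast
    qed
    fix b m e
    assume b: "b \<in> B" and m: "m > 0" and eq: "nmul m b = (\<Sum>i<r. zmul (e i) (c i))"
      and small: "\<And>i. i < r \<Longrightarrow> int N * \<bar>e i\<bar> \<le> int m"
    have "gr.emb b \<in> subfield_gen (K \<union> {z. \<exists>m. pinum \<pi> m \<and> z ^ m = 1})"
      using b s_sub unfolding B_def emb by auto
    moreover have "gr.emb b ^ coset_order C b \<in> K"
      using co(2)[of b] CK unfolding gr.emb_nmul[symmetric] emb by auto
    \<comment> \<open>The image of b lies only in \<open>s\<close>, but up to a root of unity it is
      an element k of the finitely generated field K, where discreteness is available.\<close>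
    ultimately obtain k z where kz: "k \<in> K" "tors z" "gr.emb b = k * z"
      using cf.radical_in_root_adjunction[OF kum_K _ gr.emb_nz co(1)] by blast
    have "(k * z) ^ m = (\<Prod>i<r. q i powi e i)"
      unfolding kz(3)[symmetric] gr.emb_nmul[symmetric] eq gr.emb_sum q_def gr.emb_zmul ..
    moreover have "z \<noteq> 0" using kz(3) gr.emb_nz[of b] by auto
    ultimately have "k ^ m = inverse z ^ m * (\<Prod>i<r. q i powi e i)"
      by (simp add: power_mult_distrib power_inverse field_simps)
    \<comment> \<open>The power of the inverse of z is absorbed by the torsion factor that
      \<open>disc\<close> admits.\<close>
    hence "tors k" using N[OF kz(1) m tors_power[OF tors_inverse[OF kz(2)]]] small by blast
    hence "tors (gr.emb b)" unfolding kz(3) using kz(2) by (rule tors_mult)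
    then obtain n where n: "n > 0" "gr.emb (nmul n b) = 1" unfolding tors_def gr.emb_nmul by auto
    \<comment> \<open>Faithfulness turns a root of unity in the image of A into an element of finite
      order, which torsion-freeness makes trivial.\<close>
    hence "nmul n b = 0" using gr.emb_eq_1 P_faithful unfolding P by blast
    thus "b = 0" using A_tf n(1) unfolding torsion_free_def by blast
  qed
  have fgH: "fin_gen_subgroup H" by (rule fin_gen_subgroup_of_fin_gen[OF fgB sH HB])
  show ?thesis using fgB denseB fgH denseH HB controlB controlH by blast
qed

end
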